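(* Let $p=p(n)\in(0,1)$ and, for any integer $m\ge 2$, let $S_{m,n}$ be the number of $m$-stars in $G(n,p)$. For any given integer $k\ge 1$, as $n\to \infty$, the following assertions hold. (i) If $np\to c$ for some constant $c > 0$, then $$\frac{1}{\sqrt{n}}\Big(S_{2,n}-\mathbb{E}[S_{2,n}],\,S_{3,n}-\mathbb{E}[S_{3,n}],\, \cdots,\, S_{k+1,n}-\mathbb{E}[S_{k+1,n}]\Big)^{\top}$$ converges in distribution to the $k$-dimensional normal distribution $N(\mathbf{0},\mathbf{\Sigma}_{k}^{\star})$ with mean vector $\mathbf 0$ and covariance matrix $\mathbf{\Sigma}_{k}^{\star}$ whose $(m,l)$-entry is $$\sigma_{ml}^{\star}=\frac{c^{m+l-1}}{(m-1)!(l-1)!} +\sum_{s=1}^{\min(m,l)}\frac{c^{m+l-s}}{s!(m-s)!(l-s)!}, \quad 1\le m,l\le k.$$ (ii) If $np\to \infty$ and $n^2 (1-p)^3\to \infty$, then $$\sqrt{\frac{p}{2(1-p)}}\left(\frac{S_{2,n}-\mathbb{E}[S_{2,n}]}{np},\,\frac{S_{3,n}-\mathbb{E}[S_{3,n}]}{(np)^2},\,\cdots,\,\frac{S_{k+1,n}-\mathbb{E}[S_{k+1,n}]}{\frac{1}{(k-1)!}(np)^k}\right)^{\top}$$ (the $m$-th coordinate inside the parentheses being $\frac{S_{m+1,n}-\mathbb{E}[S_{m+1,n}]}{\frac{1}{(m-1)!}(np)^m}$, $1\le m\le k$) converges in distribution to $N(\mathbf{0},\mathbf{U}_{k})$, where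 $\mathbf{U}_{k}$ is the $k\times k$ matrix with all entries equal to 1.
   Context: $G(n,p)$ is the Erdős–Rényi random graph on the vertex set $\{1,\dots,n\}$, in which each possible edge is present independently with probability $p$, where $0<p<1$ and $p=p(n)$ may depend on $n$. $I_{ij}$ is the indicator of the event that there is an edge between $i$ and $j$ (so $I_{ii}=0$, $I_{ij}=I_{ji}$). For $m\ge 2$, an $m$-star is a tree on $m$ vertices with one vertex (the center) of degree $m-1$ and the others of degree 1; two 2-stars on the same pair of vertices but with different centers are counted as distinct, so $S_{2,n}$ is twice the number of edges. Precisely, $S_{m,n}=\sum_{i=1}^n\ \sum_{1\le j_1<\cdots<j_{m-1}\le n}I_{ij_1}\cdots I_{ij_{m-1}}$. Normal distributions are allowed to be degenerate (singular covariance matrix). *)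

theory Defs
  imports "HOL-Probability.Probability"
begin

text \<open>A graph on the vertex set \<open>{1..n}\<close> is given by its set of edges, each edge being a
  two-element subset of \<open>{1..n}\<close>.\<close>

definition all_edges :: "nat \<Rightarrow> nat set set" where
  "all_edges n = {e. e \<subseteq> {1..n} \<and> card e = 2}"

definition Gnp :: "nat \<Rightarrow> real \<Rightarrow> nat set set pmf" where
  "Gnp n p = map_pmf (\<lambda>b. {e \<in> all_edges n. b e})
     (Pi_pmf (all_edges n) False (\<lambda>_. bernoulli_pmf p))"

text \<open>Since edges have two elements, \<open>adj E i i = 0\<close> almost surely under \<open>Gnp n p\<close>.\<close>

definition adj :: "nat set set \<Rightarrow> nat \<Rightarrow> nat \<Rightarrow> real" where
  "adj E i j = of_bool ({i, j} \<in> E)"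

text \<open>The inner sum over \<open>j\<^sub>1 < \<dots> < j\<^bsub>m-1\<^esub>\<close> is written as a sum over the sets
  \<open>J = {j\<^sub>1, \<dots>, j\<^bsub>m-1\<^esub>}\<close>.\<close>

definition stars :: "nat \<Rightarrow> nat \<Rightarrow> nat set set \<Rightarrow> real" where
  "stars m n E = (\<Sum>i\<in>{1..n}. \<Sum>J | J \<subseteq> {1..n} \<and> card J = m - 1. \<Prod>j\<in>J. adj E i j)"

definition centered_stars :: "nat \<Rightarrow> nat \<Rightarrow> real \<Rightarrow> nat set set \<Rightarrow> real" where
  "centered_stars m n p E =
     stars m n E - measure_pmf.expectation (Gnp n p) (stars m n)"

text \<open>\<open>mv_normal N \<mu> \<Sigma>\<close>: the measure \<open>N\<close> is the normal distribution with mean vector \<open>\<mu>\<close> and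
  covariance matrix \<open>\<Sigma>\<close>, defined by its characteristic function so that singular
  \<open>\<Sigma>\<close> are covered.\<close>

definition mv_normal :: "(real ^ 'k) measure \<Rightarrow> real ^ 'k \<Rightarrow> real ^ 'k ^ 'k \<Rightarrow> bool" where
  "mv_normal N \<mu> \<Sigma> \<longleftrightarrow> prob_space N \<and> sets N = sets borel \<and>
     (\<forall>t. (CLINT x|N. iexp (t \<bullet> x)) =
          exp (\<i> * of_real (t \<bullet> \<mu>) - of_real (t \<bullet> (\<Sigma> *v t)) / 2))"

text \<open>Unlike \<^const>\<open>weak_conv_m\<close>, this is not restricted to measures on the real line.\<close>

definition weak_conv_vec ::
    "(nat \<Rightarrow> 'a::euclidean_space measure) \<Rightarrow> 'a measure \<Rightarrow> bool" where
  "weak_conv_vec M N \<longleftrightarrow>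
     (\<forall>f :: 'a \<Rightarrow> real. continuous_on UNIV f \<longrightarrow> bounded (range f) \<longrightarrow>
        (\<lambda>n. \<integral>x. f x \<partial>M n) \<longlonglongrightarrow> (\<integral>x. f x \<partial>N))"

text \<open>\<open>X n\<close> is a random vector defined on the probability space of \<open>Gnp n (p n)\<close>.\<close>

definition tends_in_distr_normal ::
    "(nat \<Rightarrow> real) \<Rightarrow> (nat \<Rightarrow> nat set set \<Rightarrow> real ^ 'k) \<Rightarrow> real ^ 'k \<Rightarrow> real ^ 'k ^ 'k \<Rightarrow> bool" where
  "tends_in_distr_normal p X \<mu> \<Sigma> \<longleftrightarrow>
     (\<exists>N. mv_normal N \<mu> \<Sigma> \<and>
          weak_conv_vec (\<lambda>n. distr (measure_pmf (Gnp n (p n))) borel (X n)) N)"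

definition sigma_star :: "real \<Rightarrow> nat \<Rightarrow> nat \<Rightarrow> real" where
  "sigma_star c m l = c ^ (m + l - 1) / (fact (m - 1) * fact (l - 1)) +
     (\<Sum>s=1..min m l. c ^ (m + l - s) / (fact s * fact (m - s) * fact (l - s)))"

end

theory Submission
  imports Defs "HOL-Real_Asymp.Real_Asymp"
begin

text \<open>Since \<open>S\<^bsub>m+1,n\<^esub>\<close> is the sum over the vertices of \<open>deg i choose m\<close>, every linear combination of
  star counts is a sum \<open>\<Sum>i. h (deg i)\<close>, and the degree of a vertex is independent of the graph with
  that vertex removed.

  (i) For \<open>np \<rightarrow> c\<close>, the characteristic function \<open>\<phi>\<close> of the normalised sum satisfies
  \<open>\<phi>' = - \<lambda> \<sigma>\<^sup>2 \<phi> + O(n\<^bsup>-1/2\<^esup>)\<close>. To see this, compare the graph with the one in which a vertex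
  is removed: the change of the sum is bounded in moments, and its leading part factorises by
  independence. The limit covariance has an explicit square root, coming from the expansion of
  \<open>deg choose m\<close> in orthogonal polynomials of the Poisson distribution.

  (ii) For \<open>np \<rightarrow> \<infinity>\<close>, subtract from \<open>deg choose m\<close> its linear projection. The remainders at different
  vertices are uncorrelated, and the Poincare inequality for the binomial distribution, applied twice,
  shows that they are negligible. So all coordinates are asymptotically equal to the normalised
  number of edges, which is binomial.

  Convergence in distribution follows from convergence of characteristic functions and tightness,
  by approximation with trigonometric polynomials.\<close>

section \<open>Expectations over random subsets and binomial distributions\<close>

text \<open>The summands \<open>h (deg E i)\<close> are unbounded and dependent, since any two
  vertices share a potential edge. The growth bound \<open>K * 2 ^ d\<close> fits the sparse regime:
  a binomial variable with bounded mean has bounded exponential moments. The estimate for one vertex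
  is a first order Taylor expansion in the effect of its star: the constant term vanishes by
  centring, the linear term produces the variance, and the error is O(\<theta>^2) with \<theta> of
  order n^(-1/2). Summing n such errors and dividing by sqrt n leaves n^(-1/2). For np \<rightarrow>
  \<infinity> these exponential moments blow up, so only second moments are used. One Poincare step
  would merely show that the scaled remainder is bounded; the second gains the factor (1 - p) /
  (np). The two hypotheses of (ii) together give n^2 p (1 - p) \<rightarrow> \<infinity>, that is,
  the variance of the number of edges diverges.\<close>

definition expect :: "real \<Rightarrow> 'a set \<Rightarrow> ('a set \<Rightarrow> 'b::real_normed_vector) \<Rightarrow> 'b" where
  "expect p A F = (\<Sum>S\<in>Pow A. (p ^ card S * (1 - p) ^ card (A - S)) *\<^sub>R F S)"

text \<open>A binomial variable is the size of a random subset of \<open>{..<N}\<close>, so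
  linearity and monotonicity are inherited from \<open>expect\<close>. Values in a normed space let
  real moments and complex characteristic functions share the same lemmas.\<close>

definition bin_ex :: "real \<Rightarrow> nat \<Rightarrow> (nat \<Rightarrow> 'b::real_normed_vector) \<Rightarrow> 'b" where
  "bin_ex p N g = expect p {..<N} (\<lambda>S. g (card S))"

lemma expect_empty [simp]: "expect p {} F = F {}"
  by (simp add: expect_def)

text \<open>Conditions on whether \<open>e\<close> is present. The inductions for
  \<open>expect\<close> and \<open>bin_ex\<close> all go through this step.\<close>

lemma expect_insert:
  assumes "finite A" "e \<notin> A"
  shows "expect p (insert e A) F =
    (1 - p) *\<^sub>R expect p A F + p *\<^sub>R expect p A (\<lambda>S. F (insert e S))"
proof -
  have "expect p (insert e A) F =
      (\<Sum>S\<in>Pow A. (p ^ card S * (1 - p) ^ card (insert e A - S)) *\<^sub>R F S) +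
      (\<Sum>S\<in>insert e ` Pow A. (p ^ card S * (1 - p) ^ card (insert e A - S)) *\<^sub>R F S)"
    unfolding expect_def Pow_insert using assms by (subst sum.union_disjoint) auto
  also have "(\<Sum>S\<in>insert e ` Pow A. (p ^ card S * (1 - p) ^ card (insert e A - S)) *\<^sub>R F S) =
      (\<Sum>S\<in>Pow A. (p ^ card (insert e S) * (1 - p) ^ card (insert e A - insert e S)) *\<^sub>R F (insert e S))"
    using assms by (subst sum.reindex) (auto intro!: inj_onI)
  also have "\<dots> = (\<Sum>S\<in>Pow A. p *\<^sub>R (p ^ card S * (1 - p) ^ card (A - S)) *\<^sub>R F (insert e S))"
  proof (rule sum.cong[OF refl])
    fix S assume S: "S \<in> Pow A"
    then have "insert e A - insert e S = A - S" "card (insert e S) = Suc (card S)"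
      using assms by (auto intro: finite_subset card_insert_disjoint)
    then show "(p ^ card (insert e S) * (1 - p) ^ card (insert e A - insert e S)) *\<^sub>R F (insert e S) =
       p *\<^sub>R (p ^ card S * (1 - p) ^ card (A - S)) *\<^sub>R F (insert e S)" by simp
  qed
  also have "(\<Sum>S\<in>Pow A. (p ^ card S * (1 - p) ^ card (insert e A - S)) *\<^sub>R F S) =
      (\<Sum>S\<in>Pow A. (1 - p) *\<^sub>R (p ^ card S * (1 - p) ^ card (A - S)) *\<^sub>R F S)"
  proof (rule sum.cong[OF refl])
    fix S assume S: "S \<in> Pow A"
    then have "insert e A - S = insert e (A - S)" using assms by auto
    moreover have "card (insert e (A - S)) = Suc (card (A - S))"
      using assms by (intro card_insert_disjoint) auto
    ultimately show "(p ^ card S * (1 - p) ^ card (insert e A - S)) *\<^sub>R F S =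
       (1 - p) *\<^sub>R (p ^ card S * (1 - p) ^ card (A - S)) *\<^sub>R F S" by (simp add: algebra_simps)
  qed
  finally show ?thesis by (simp add: expect_def scaleR_sum_right)
qed

lemma expect_cong:
  assumes "A = B" "\<And>S. S \<subseteq> B \<Longrightarrow> F S = G S"
  shows "expect p A F = expect p B G"
  using assms by (auto simp: expect_def intro!: sum.cong)

lemma expect_add: "expect p A (\<lambda>S. F S + G S) = expect p A F + expect p A G"
  by (simp add: expect_def scaleR_right_distrib sum.distrib)

lemma expect_diff: "expect p A (\<lambda>S. F S - G S) = expect p A F - expect p A G"
  by (simp add: expect_def scaleR_right_diff_distrib sum_subtractf)

lemma expect_sum: "expect p A (\<lambda>S. \<Sum>i\<in>I. F i S) = (\<Sum>i\<in>I. expect p A (F i))"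
  unfolding expect_def scaleR_sum_right by (rule sum.swap)

lemma expect_cmult:
  fixes c :: "'b::real_normed_algebra"
  shows "expect p A (\<lambda>S. c * F S) = c * expect p A F"
  by (simp add: expect_def sum_distrib_left)

lemma expect_multc:
  fixes c :: "'b::real_normed_algebra"
  shows "expect p A (\<lambda>S. F S * c) = expect p A F * c"
  by (simp add: expect_def sum_distrib_right)

lemma expect_const: "finite A \<Longrightarrow> expect p A (\<lambda>_. c) = c"
  by (induction A rule: finite_induct) (simp_all add: expect_insert flip: scaleR_left_distrib)

lemma expect_of_real:
  "expect p A (\<lambda>S. of_real (F S)) = (of_real (expect p A F) :: 'b::real_normed_algebra_1)"
  by (simp add: expect_def scaleR_conv_of_real)

text \<open>Independence in Fubini form: restrictions of the random set to disjoint ground sets are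
  averaged one after the other. It will separate the edges at a vertex from the remaining
  graph.\<close>

lemma expect_Un:
  assumes "finite A" "finite B" "A \<inter> B = {}"
  shows "expect p (A \<union> B) F = expect p A (\<lambda>S. expect p B (\<lambda>T. F (S \<union> T)))"
  using assms
proof (induction A arbitrary: F rule: finite_induct)
  case (insert e A)
  then show ?case by (simp add: expect_insert)
qed simp

lemma card_insert_subset:
  "finite A \<Longrightarrow> e \<notin> A \<Longrightarrow> S \<subseteq> A \<Longrightarrow> card (insert e S) = Suc (card S)"
  by (metis card_insert_disjoint finite_subset subsetD)

lemma expect_card: "finite A \<Longrightarrow> expect p A (\<lambda>S. g (card S)) = bin_ex p (card A) g"
proof (induction A arbitrary: g rule: finite_induct)
  case (insert e A)
  have "expect p A (\<lambda>S. g (card (insert e S))) = expect p A (\<lambda>S. g (Suc (card S)))"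
    using insert.hyps by (intro expect_cong) (auto simp: card_insert_subset)
  moreover have "expect p {..<card A} (\<lambda>S. g (card (insert (card A) S))) =
      expect p {..<card A} (\<lambda>S. g (Suc (card S)))"
    by (intro expect_cong) (auto simp: card_insert_subset[of "{..<card A}"])
  ultimately show ?case
    using insert insert.IH[of "\<lambda>x. g (Suc x)"] unfolding card_insert_disjoint[OF insert.hyps] bin_ex_def lessThan_Suc
    by (simp add: expect_insert)
qed (simp add: bin_ex_def)

lemma bin_ex_0 [simp]: "bin_ex p 0 g = g 0"
  by (simp add: bin_ex_def)

lemma bin_ex_Suc: "bin_ex p (Suc N) g = (1 - p) *\<^sub>R bin_ex p N g + p *\<^sub>R bin_ex p N (\<lambda>x. g (Suc x))"
proof -
  have "expect p {..<N} (\<lambda>S. g (card (insert N S))) = expect p {..<N} (\<lambda>S. g (Suc (card S)))"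
    by (intro expect_cong) (auto simp: card_insert_subset[of "{..<N}"])
  then show ?thesis
    unfolding bin_ex_def lessThan_Suc by (subst expect_insert) auto
qed

lemma bin_ex_add: "bin_ex p N (\<lambda>x. f x + g x) = bin_ex p N f + bin_ex p N g"
  by (simp add: bin_ex_def expect_add)

lemma bin_ex_diff: "bin_ex p N (\<lambda>x. f x - g x) = bin_ex p N f - bin_ex p N g"
  by (simp add: bin_ex_def expect_diff)

lemma bin_ex_sum: "bin_ex p N (\<lambda>x. \<Sum>i\<in>I. f i x) = (\<Sum>i\<in>I. bin_ex p N (f i))"
  by (simp add: bin_ex_def expect_sum)

lemma bin_ex_cmult: "bin_ex p N (\<lambda>x. c * f x) = c * bin_ex p N f"
  for c :: "'b::real_normed_algebra"
  by (simp add: bin_ex_def expect_cmult)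

lemma bin_ex_const [simp]: "bin_ex p N (\<lambda>x. c) = c"
  by (simp add: bin_ex_def expect_const)

text \<open>Any r given trials all succeed with probability p^r; the induction is Pascal's
  rule.\<close>

lemma bin_ex_choose: "bin_ex p N (\<lambda>x. real (x choose r)) = real (N choose r) * p ^ r"
proof (induction N arbitrary: r)
  case 0
  then show ?case by (cases r) auto
next
  case (Suc N)
  then show ?case
    by (cases r) (simp_all add: bin_ex_Suc bin_ex_add algebra_simps)
qed

lemma bin_ex_power: "bin_ex p N (\<lambda>x. a ^ x) = (1 + p * (a - 1)) ^ N" for a :: real
  by (induction N) (simp_all add: bin_ex_Suc bin_ex_cmult algebra_simps)

section \<open>Positivity and moment inequalities\<close>

context
  fixes p :: real
  assumes p01: "0 \<le> p" "p \<le> 1"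
begin

lemma expect_mono:
  fixes F G :: "'a set \<Rightarrow> real"
  assumes "\<And>S. S \<subseteq> A \<Longrightarrow> F S \<le> G S"
  shows "expect p A F \<le> expect p A G"
  unfolding expect_def using assms p01 by (intro sum_mono) (auto intro!: mult_left_mono)

lemma expect_nonneg:
  fixes F :: "'a set \<Rightarrow> real"
  assumes "\<And>S. S \<subseteq> A \<Longrightarrow> 0 \<le> F S"
  shows "0 \<le> expect p A F"
  unfolding expect_def using assms p01 by (intro sum_nonneg) auto

lemma norm_expect_le: "norm (expect p A F) \<le> expect p A (\<lambda>S. norm (F S))"
  unfolding expect_def using p01 by (intro sum_norm_le) auto

lemma norm_expect_le_mono:
  assumes "\<And>S. S \<subseteq> A \<Longrightarrow> norm (F S) \<le> G S"
  shows "norm (expect p A F) \<le> expect p A G"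
  by (rule order_trans[OF norm_expect_le]) (rule expect_mono[OF assms])

lemma bin_ex_mono:
  fixes f g :: "nat \<Rightarrow> real"
  assumes "\<And>x. f x \<le> g x"
  shows "bin_ex p N f \<le> bin_ex p N g"
  unfolding bin_ex_def using assms by (intro expect_mono) auto

lemma bin_ex_nonneg:
  fixes f :: "nat \<Rightarrow> real"
  assumes "\<And>x. 0 \<le> f x"
  shows "0 \<le> bin_ex p N f"
  unfolding bin_ex_def using assms by (intro expect_nonneg) auto

lemma bin_ex_norm_le_mono:
  assumes "\<And>x. norm (f x) \<le> g x"
  shows "norm (bin_ex p N f) \<le> bin_ex p N g"
  unfolding bin_ex_def using assms by (intro norm_expect_le_mono) auto

text \<open>By 1 + x \<le> exp x the bound depends on \<open>N\<close> and \<open>p\<close> only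
  through \<open>N * p\<close>. Hence functions of growth \<open>K * 2 ^ d\<close> have moments
  bounded uniformly in n in the sparse regime.\<close>

lemma bin_ex_power_le:
  fixes a :: real
  assumes "a \<ge> 1" "real N * p \<le> C"
  shows "bin_ex p N (\<lambda>x. a ^ x) \<le> exp ((a - 1) * C)"
proof -
  have "(1 + p * (a - 1)) ^ N \<le> exp (p * (a - 1)) ^ N"
    using assms p01 by (intro power_mono exp_ge_add_one_self) auto
  also have "\<dots> = exp ((a - 1) * (real N * p))"
    by (simp add: mult_ac flip: exp_of_nat_mult)
  also have "\<dots> \<le> exp ((a - 1) * C)"
    using assms by (simp add: mult_left_mono)
  finally show ?thesis by (simp add: bin_ex_power)
qed

lemma bin_ex_jensen: "(bin_ex p N f)\<^sup>2 \<le> bin_ex p N (\<lambda>x. (f x)\<^sup>2)" for f :: "nat \<Rightarrow> real"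
proof -
  let ?m = "bin_ex p N f"
  have "0 \<le> bin_ex p N (\<lambda>x. (f x - ?m)\<^sup>2)" by (rule bin_ex_nonneg) simp
  also have "(\<lambda>x. (f x - ?m)\<^sup>2) = (\<lambda>x. (f x)\<^sup>2 - (2 * ?m) * f x + ?m\<^sup>2)"
    by (auto simp: power2_eq_square algebra_simps)
  also have "bin_ex p N \<dots> = bin_ex p N (\<lambda>x. (f x)\<^sup>2) - ?m\<^sup>2"
    by (simp only: bin_ex_add bin_ex_diff bin_ex_cmult bin_ex_const) (simp add: power2_eq_square)
  finally show ?thesis by simp
qed

lemma expect_power2_le: "(expect p A F)\<^sup>2 \<le> expect p A (\<lambda>S. (F S)\<^sup>2)"
  if "finite A" for F :: "'a set \<Rightarrow> real"
proof -
  let ?m = "expect p A F"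
  have "0 \<le> expect p A (\<lambda>S. (F S - ?m)\<^sup>2)" by (rule expect_nonneg) simp
  also have "(\<lambda>S. (F S - ?m)\<^sup>2) = (\<lambda>S. (F S)\<^sup>2 - (2 * ?m) * F S + ?m\<^sup>2)"
    by (auto simp: power2_eq_square algebra_simps)
  also have "expect p A \<dots> = expect p A (\<lambda>S. (F S)\<^sup>2) - ?m\<^sup>2"
    by (simp only: expect_add expect_diff expect_cmult expect_const[OF that])
      (simp add: power2_eq_square)
  finally show ?thesis by simp
qed

end

lemma bin_ex_variance:
  "bin_ex p N (\<lambda>x. (f x - bin_ex p N f)\<^sup>2) = bin_ex p N (\<lambda>x. (f x)\<^sup>2) - (bin_ex p N f)\<^sup>2"
  for f :: "nat \<Rightarrow> real"
proof -
  let ?m = "bin_ex p N f"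
  have "(\<lambda>x. (f x - ?m)\<^sup>2) = (\<lambda>x. (f x)\<^sup>2 - (2 * ?m) * f x + ?m\<^sup>2)"
    by (auto simp: power2_eq_square algebra_simps)
  then show ?thesis
    by (simp only: bin_ex_add bin_ex_diff bin_ex_cmult bin_ex_const) (simp add: power2_eq_square)
qed

text \<open>Efron-Stein argument: averaging out one trial splits the variance into the mean
  conditional variance, with density \<open>p * (1 - p)\<close> times the square of
  \<open>D x\<close>, and the variance of the conditional mean \<open>g\<close>, to which the
  induction hypothesis applies.\<close>

lemma bin_ex_poincare:
  fixes h :: "nat \<Rightarrow> real"
  assumes p: "0 \<le> p" "p \<le> 1"
  shows "bin_ex p (Suc N) (\<lambda>x. (h x)\<^sup>2) - (bin_ex p (Suc N) h)\<^sup>2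
    \<le> real (Suc N) * p * (1 - p) * bin_ex p N (\<lambda>x. (h (Suc x) - h x)\<^sup>2)"
proof (induction N arbitrary: h)
  case 0
  show ?case by (simp add: bin_ex_Suc power2_eq_square algebra_simps)
next
  case (Suc N)
  define g where "g x = (1 - p) * h x + p * h (Suc x)" for x
  define D where "D x = h (Suc x) - h x" for x
  have g: "bin_ex p (Suc (Suc N)) h = bin_ex p (Suc N) g"
    by (subst bin_ex_Suc) (simp add: g_def[abs_def] bin_ex_add bin_ex_cmult)
  have "bin_ex p (Suc (Suc N)) (\<lambda>x. (h x)\<^sup>2) =
      bin_ex p (Suc N) (\<lambda>x. (1 - p) * (h x)\<^sup>2 + p * (h (Suc x))\<^sup>2)"
    by (subst bin_ex_Suc) (simp add: bin_ex_add bin_ex_cmult)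
  also have "(\<lambda>x. (1 - p) * (h x)\<^sup>2 + p * (h (Suc x))\<^sup>2) =
      (\<lambda>x. (p * (1 - p)) * (D x)\<^sup>2 + (g x)\<^sup>2)"
    by (auto simp: g_def D_def power2_eq_square algebra_simps)
  also have "bin_ex p (Suc N) \<dots> = p * (1 - p) * bin_ex p (Suc N) (\<lambda>x. (D x)\<^sup>2)
      + bin_ex p (Suc N) (\<lambda>x. (g x)\<^sup>2)"
    by (simp only: bin_ex_add bin_ex_cmult)
  finally have 1: "bin_ex p (Suc (Suc N)) (\<lambda>x. (h x)\<^sup>2) - (bin_ex p (Suc (Suc N)) h)\<^sup>2 =
      p * (1 - p) * bin_ex p (Suc N) (\<lambda>x. (D x)\<^sup>2) +
      (bin_ex p (Suc N) (\<lambda>x. (g x)\<^sup>2) - (bin_ex p (Suc N) g)\<^sup>2)"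
    unfolding g by simp
  \<comment> \<open>The increment of \<open>g\<close> is the average of \<open>D x\<close> and
    \<open>D (Suc x)\<close> with weights 1 - p and p, so convexity of the square applies.\<close>
  have "bin_ex p N (\<lambda>x. (g (Suc x) - g x)\<^sup>2) \<le>
      bin_ex p N (\<lambda>x. (1 - p) * (D x)\<^sup>2 + p * (D (Suc x))\<^sup>2)"
  proof (rule bin_ex_mono[OF p])
    fix x
    have "(1 - p) * (D x)\<^sup>2 + p * (D (Suc x))\<^sup>2 - (g (Suc x) - g x)\<^sup>2 = p * (1 - p) * (D (Suc x) - D x)\<^sup>2"
      by (simp add: g_def D_def power2_eq_square algebra_simps)
    moreover have "\<dots> \<ge> 0" using p by simp
    ultimately show "(g (Suc x) - g x)\<^sup>2 \<le> (1 - p) * (D x)\<^sup>2 + p * (D (Suc x))\<^sup>2" by linarith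
  qed
  also have "\<dots> = bin_ex p (Suc N) (\<lambda>x. (D x)\<^sup>2)"
    by (simp add: bin_ex_Suc bin_ex_add bin_ex_cmult)
  finally have "real (Suc N) * p * (1 - p) * bin_ex p N (\<lambda>x. (g (Suc x) - g x)\<^sup>2) \<le>
      real (Suc N) * p * (1 - p) * bin_ex p (Suc N) (\<lambda>x. (D x)\<^sup>2)"
    using p by (intro mult_left_mono) auto
  with Suc.IH[of g] 1 show ?case
    unfolding D_def by (simp add: algebra_simps)
qed

text \<open>Here s is the size of the intersection of an m-set and an l-set. Their union has m + l -
  s elements, and the coefficient counts its divisions into a common part and two private
  parts.\<close>

lemma choose_mult_choose:
  "real (x choose m) * real (x choose l) =
    (\<Sum>s\<le>min m l. fact (m + l - s) / (fact s * fact (m - s) * fact (l - s)) * real (x choose (m + l - s)))"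
proof (cases "m \<le> x")
  case True
  have "x choose l = (\<Sum>s\<le>l. (m choose s) * ((x - m) choose (l - s)))"
    using vandermonde[of m "x - m" l] True by simp
  also have "\<dots> = (\<Sum>s\<le>min m l. (m choose s) * ((x - m) choose (l - s)))"
    by (intro sum.mono_neutral_right) auto
  finally have "real (x choose m) * real (x choose l) =
      (\<Sum>s\<le>min m l. real (x choose m) * real ((m choose s) * ((x - m) choose (l - s))))"
    by (simp add: sum_distrib_left)
  also have "\<dots> = (\<Sum>s\<le>min m l. fact (m + l - s) / (fact s * fact (m - s) * fact (l - s)) * real (x choose (m + l - s)))"
  proof (rule sum.cong[OF refl])
    fix s assume "s \<in> {..min m l}"
    then have s: "s \<le> m" "s \<le> l" by auto
    have e: "m + l - s - m = l - s" using s by simp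
    have "(x choose m) * ((x - m) choose (l - s)) = (x choose (m + l - s)) * ((m + l - s) choose m)"
    proof (cases "m + l - s \<le> x")
      case True
      then show ?thesis using choose_mult[of m "m + l - s" x] s e by simp
    next
      case False
      then have "x - m < l - s" using s \<open>m \<le> x\<close> by linarith
      then show ?thesis using False by (simp add: binomial_eq_0)
    qed
    then have "real (x choose m) * real ((m choose s) * ((x - m) choose (l - s))) =
       real (m choose s) * real ((m + l - s) choose m) * real (x choose (m + l - s))"
      by (metis (no_types, lifting) mult.assoc mult.commute of_nat_mult)
    also have "real (m choose s) * real ((m + l - s) choose m) = fact (m + l - s) / (fact s * fact (m - s) * fact (l - s))"
      using s e by (simp add: binomial_fact)
    finally show "real (x choose m) * real ((m choose s) * ((x - m) choose (l - s))) =
      fact (m + l - s) / (fact s * fact (m - s) * fact (l - s)) * real (x choose (m + l - s))" .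
  qed
  finally show ?thesis .
next
  case False
  then have "real (x choose m) = 0" by simp
  moreover have "(\<Sum>s\<le>min m l. fact (m + l - s) / (fact s * fact (m - s) * fact (l - s)) * real (x choose (m + l - s))) = 0"
  proof (rule sum.neutral, rule ballI)
    fix s assume "s \<in> {..min m l}"
    then have "s \<le> l" by simp
    then have "x < m + l - s" using False by linarith
    then show "fact (m + l - s) / (fact s * fact (m - s) * fact (l - s)) * real (x choose (m + l - s)) = 0"
      by simp
  qed
  ultimately show ?thesis by simp
qed

lemma expect_pmf:
  fixes F :: "'a set \<Rightarrow> 'b::{banach, second_countable_topology}"
  assumes A: "finite A" and p: "0 \<le> p" "p \<le> 1"
  shows "measure_pmf.expectation (map_pmf (\<lambda>b. {e \<in> A. b e}) (Pi_pmf A False (\<lambda>_. bernoulli_pmf p))) F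
    = expect p A F"
proof -
  let ?P = "Pi_pmf A False (\<lambda>_. bernoulli_pmf p)"
  let ?f = "\<lambda>S e. e \<in> S"
  have "measure_pmf.expectation (map_pmf (\<lambda>b. {e \<in> A. b e}) ?P) F
      = measure_pmf.expectation ?P (\<lambda>b. F {e \<in> A. b e})"
    by simp
  also have "\<dots> = (\<Sum>b\<in>?f ` Pow A. pmf ?P b *\<^sub>R F {e \<in> A. b e})"
  proof (rule integral_measure_pmf)
    show "finite (?f ` Pow A)" using A by simp
    fix b assume "b \<in> set_pmf ?P"
    \<comment> \<open>The default value \<open>False\<close> outside \<open>A\<close> makes every
      \<open>b\<close> in the support the indicator of a subset of \<open>A\<close>.\<close>
    then have "\<forall>x. x \<notin> A \<longrightarrow> b x = False" using set_Pi_pmf_subset[OF A, of False] by blast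
    then have "b = ?f {e. b e}" "{e. b e} \<in> Pow A" by auto
    then show "b \<in> ?f ` Pow A" by blast
  qed
  also have "\<dots> = (\<Sum>S\<in>Pow A. pmf ?P (?f S) *\<^sub>R F {e \<in> A. e \<in> S})"
    by (subst sum.reindex) (auto intro!: inj_onI simp: fun_eq_iff)
  also have "\<dots> = expect p A F"
    unfolding expect_def
  proof (rule sum.cong[OF refl])
    fix S assume S: "S \<in> Pow A"
    have "pmf ?P (?f S) = (\<Prod>e\<in>A. if e \<in> S then p else 1 - p)"
      using A S p by (subst pmf_Pi) (auto intro!: prod.cong)
    also have "\<dots> = p ^ card S * (1 - p) ^ card (A - S)"
      using A S by (subst prod.If_cases) (auto simp: Int_absorb1 Diff_eq Int_commute Collect_neg_eq)
    finally show "pmf ?P (?f S) *\<^sub>R F {e \<in> A. e \<in> S} = (p ^ card S * (1 - p) ^ card (A - S)) *\<^sub>R F S"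
      using S by (simp add: Collect_conj_eq Int_absorb1)
  qed
  finally show ?thesis .
qed

section \<open>Vertex degrees in random graphs\<close>

definition edges :: "nat set \<Rightarrow> nat set set" where
  "edges U = {e. e \<subseteq> U \<and> card e = 2}"

definition star :: "nat \<Rightarrow> nat set \<Rightarrow> nat set set" where
  "star i U = (\<lambda>j. {i, j}) ` (U - {i})"

definition deg :: "nat set set \<Rightarrow> nat \<Rightarrow> nat" where
  "deg E i = card {e \<in> E. i \<in> e}"

definition deg_sum :: "nat set \<Rightarrow> (nat \<Rightarrow> real) \<Rightarrow> nat set set \<Rightarrow> real" where
  "deg_sum V h E = (\<Sum>i\<in>V. h (deg E i))"

text \<open>The change of the degree sum when the star \<open>S\<close> at i is added to a graph
  \<open>T\<close> avoiding i: the degree of i jumps from 0 to \<open>card S\<close>, and that of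
  each new neighbour rises by one.\<close>

definition vertex_incr :: "(nat \<Rightarrow> real) \<Rightarrow> nat \<Rightarrow> nat set \<Rightarrow> nat set set \<Rightarrow> nat set set \<Rightarrow> real" where
  "vertex_incr h i U S T = h (card S) - h 0 +
     (\<Sum>j\<in>U - {i}. of_bool ({i, j} \<in> S) * (h (Suc (deg T j)) - h (deg T j)))"

lemma finite_edges [simp]: "finite U \<Longrightarrow> finite (edges U)"
  by (rule finite_subset[of _ "Pow U"]) (auto simp: edges_def)

lemma finite_star [simp]: "finite U \<Longrightarrow> finite (star i U)"
  by (simp add: star_def)

lemma card_star: "i \<in> U \<Longrightarrow> card (star i U) = card U - 1"
  unfolding star_def by (subst card_image) (auto simp: inj_on_def doubleton_eq_iff)

lemma edges_split: "i \<in> U \<Longrightarrow> edges U = star i U \<union> edges (U - {i})"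
  by (auto simp: edges_def star_def card_2_iff)

lemma star_edges_disjoint: "star i U \<inter> edges (U - {i}) = {}"
  by (auto simp: edges_def star_def)

lemma deg_Un_same:
  assumes "S \<subseteq> star i U" "T \<subseteq> edges (U - {i})"
  shows "deg (S \<union> T) i = card S"
proof -
  have "{e \<in> S \<union> T. i \<in> e} = S" using assms by (auto simp: star_def edges_def)
  then show ?thesis by (simp add: deg_def)
qed

lemma deg_eq_0: "T \<subseteq> edges W \<Longrightarrow> v \<notin> W \<Longrightarrow> deg T v = 0"
  unfolding deg_def edges_def by (metis (mono_tags, lifting) card.empty empty_Collect_eq mem_Collect_eq subset_iff)

lemma deg_Un_other:
  assumes "finite U" "S \<subseteq> star i U" "T \<subseteq> edges (U - {i})" "j \<in> U - {i}"
  shows "deg (S \<union> T) j = deg T j + of_bool ({i, j} \<in> S)"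
proof -
  have 1: "{e \<in> S \<union> T. j \<in> e} = {e \<in> T. j \<in> e} \<union> (if {i, j} \<in> S then {{i, j}} else {})"
    using assms by (auto simp: star_def)
  have "finite T" using assms finite_edges finite_subset by (metis finite_Diff)
  moreover have "{i, j} \<notin> T" using assms by (auto simp: edges_def)
  ultimately show ?thesis unfolding deg_def 1 by auto
qed

text \<open>The sum runs over a fixed \<open>V\<close> while the graph lives on \<open>U\<close>;
  vertices of \<open>V - U\<close> have degree 0 on both sides. Keeping \<open>V\<close> allows
  vertices to be removed repeatedly without changing the functional.\<close>

lemma deg_sum_Un:
  assumes "finite V" "U \<subseteq> V" "i \<in> U" "S \<subseteq> star i U" "T \<subseteq> edges (U - {i})"
  shows "deg_sum V h (S \<union> T) = deg_sum V h T + vertex_incr h i U S T"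
proof -
  have "finite U" using assms finite_subset by blast
  have S: "sum f V = f i + sum f (U - {i}) + sum f (V - U)" for f :: "nat \<Rightarrow> real"
    using sum.subset_diff[of U V f] sum.remove[of U i f] assms \<open>finite U\<close> by simp
  have 1: "deg (S \<union> T) i = card S" "deg T i = 0"
    using deg_Un_same[of S i U T] deg_eq_0[of T "U - {i}" i] assms by auto
  have 2: "deg (S \<union> T) j = 0" "deg T j = 0" if "j \<in> V - U" for j
    using deg_eq_0[of "S \<union> T" U j] deg_eq_0[of T "U - {i}" j] assms that edges_split[of i U] by auto
  have 3: "h (deg (S \<union> T) j) = h (deg T j) + of_bool ({i, j} \<in> S) * (h (Suc (deg T j)) - h (deg T j))"
    if "j \<in> U - {i}" for j
    using deg_Un_other[of U S i T j] assms that \<open>finite U\<close> by auto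
  have "deg_sum V h (S \<union> T) = h (card S) + (\<Sum>j\<in>U - {i}. h (deg T j) +
      of_bool ({i, j} \<in> S) * (h (Suc (deg T j)) - h (deg T j))) + (\<Sum>j\<in>V - U. h 0)"
    unfolding deg_sum_def S[of "\<lambda>j. h (deg (S \<union> T) j)"] using 1 2 3 by simp
  moreover have "deg_sum V h T = h 0 + (\<Sum>j\<in>U - {i}. h (deg T j)) + (\<Sum>j\<in>V - U. h 0)"
    unfolding deg_sum_def S[of "\<lambda>j. h (deg T j)"] using 1 2 by simp
  ultimately show ?thesis by (simp add: vertex_incr_def sum.distrib)
qed

section \<open>Laws and covariances of vertex degrees\<close>

lemma expect_edges_split:
  assumes "finite U" "i \<in> U"
  shows "expect p (edges U) F =
    expect p (star i U) (\<lambda>S. expect p (edges (U - {i})) (\<lambda>T. F (S \<union> T)))"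
  using assms star_edges_disjoint by (simp add: edges_split[of i U] expect_Un)

lemma expect_deg:
  assumes "finite U" "i \<in> U"
  shows "expect p (edges U) (\<lambda>E. g (deg E i)) = bin_ex p (card U - 1) g"
proof -
  have "expect p (edges U) (\<lambda>E. g (deg E i)) = expect p (star i U) (\<lambda>S. g (card S))"
    unfolding expect_edges_split[OF assms]
  proof (rule expect_cong[OF refl])
    fix S assume S: "S \<subseteq> star i U"
    have "expect p (edges (U - {i})) (\<lambda>T. g (deg (S \<union> T) i)) = expect p (edges (U - {i})) (\<lambda>T. g (card S))"
      using S by (intro expect_cong) (auto simp: deg_Un_same)
    then show "expect p (edges (U - {i})) (\<lambda>T. g (deg (S \<union> T) i)) = g (card S)"
      using assms by (simp add: expect_const)
  qed
  then show ?thesis using assms by (simp add: expect_card card_star)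
qed

text \<open>Given that {i, j} is present, the other \<open>card U - 2\<close> potential edges at i
  are still independent, and the degree is shifted by one.\<close>

lemma expect_star_edge:
  fixes g :: "nat \<Rightarrow> real"
  assumes "finite U" "i \<in> U" "j \<in> U" "j \<noteq> i"
  shows "expect p (star i U) (\<lambda>S. g (card S) * of_bool ({i, j} \<in> S)) = p * bin_ex p (card U - 2) (\<lambda>x. g (Suc x))"
proof -
  let ?A = "star i U - {{i, j}}"
  have ij: "{i, j} \<in> star i U" using assms by (auto simp: star_def)
  have c: "card ?A = card U - 2" using assms ij by (simp add: card_star)
  have f: "finite ?A" using assms by simp
  have "expect p (star i U) (\<lambda>S. g (card S) * of_bool ({i, j} \<in> S)) =
      expect p (insert {i, j} ?A) (\<lambda>S. g (card S) * of_bool ({i, j} \<in> S))"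
    using ij by (simp add: insert_absorb)
  also have "\<dots> = (1 - p) * expect p ?A (\<lambda>S. g (card S) * of_bool ({i, j} \<in> S)) +
      p * expect p ?A (\<lambda>S. g (card (insert {i, j} S)) * of_bool ({i, j} \<in> insert {i, j} S))"
    using f by (subst expect_insert) auto
  also have "expect p ?A (\<lambda>S. g (card S) * of_bool ({i, j} \<in> S)) = expect p ?A (\<lambda>S. 0)"
    by (rule expect_cong) auto
  also have "expect p ?A (\<lambda>S. g (card (insert {i, j} S)) * of_bool ({i, j} \<in> insert {i, j} S)) =
      expect p ?A (\<lambda>S. g (Suc (card S)))"
    using f by (intro expect_cong) (auto simp: card_insert_subset[of ?A])
  finally show ?thesis using f by (simp add: expect_const expect_card[of ?A p "\<lambda>x. g (Suc x)"] c)
qed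

text \<open>Let A and B be the means of \<open>g\<close> without and with the edge. Centring says (1
  - p) A + p B = 0, hence B = (1 - p) (B - A).\<close>

lemma expect_star_edge_centered:
  fixes g :: "nat \<Rightarrow> real"
  assumes "finite U" "i \<in> U" "j \<in> U" "j \<noteq> i"
    and "bin_ex p (card U - 1) g = 0"
  shows "expect p (star i U) (\<lambda>S. g (card S) * of_bool ({i, j} \<in> S)) =
    p * (1 - p) * bin_ex p (card U - 2) (\<lambda>x. g (Suc x) - g x)"
proof -
  have "card {i, j} \<le> card U" using assms by (intro card_mono) auto
  then have "card U - 1 = Suc (card U - 2)" using assms by simp
  then have "(1 - p) * bin_ex p (card U - 2) g + p * bin_ex p (card U - 2) (\<lambda>x. g (Suc x)) = 0"
    using assms(5) by (simp add: bin_ex_Suc)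
  then have "bin_ex p (card U - 2) (\<lambda>x. g (Suc x)) =
    (1 - p) * bin_ex p (card U - 2) (\<lambda>x. g (Suc x) - g x)"
    by (simp add: bin_ex_diff algebra_simps)
  then show ?thesis by (simp add: expect_star_edge[OF assms(1-4)])
qed

text \<open>Two degrees interact only through their common edge. Given the star of i, the mean of
  \<open>g (deg E j)\<close> is affine in the indicator of {i, j}, and the constant part is killed
  by the centring of \<open>f\<close>.\<close>

lemma expect_deg_deg:
  fixes f g :: "nat \<Rightarrow> real"
  assumes U: "finite U" "i \<in> U" "j \<in> U" "j \<noteq> i"
    and 0: "bin_ex p (card U - 1) f = 0"
  shows "expect p (edges U) (\<lambda>E. f (deg E i) * g (deg E j)) =
    p * (1 - p) * bin_ex p (card U - 2) (\<lambda>x. f (Suc x) - f x) * bin_ex p (card U - 2) (\<lambda>x. g (Suc x) - g x)"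
proof -
  let ?B = "\<lambda>g::nat \<Rightarrow> real. bin_ex p (card U - 2) g"
  have "expect p (edges U) (\<lambda>E. f (deg E i) * g (deg E j)) =
      expect p (star i U) (\<lambda>S. f (card S) * ?B g + f (card S) * of_bool ({i, j} \<in> S) * ?B (\<lambda>x. g (Suc x) - g x))"
    unfolding expect_edges_split[OF U(1,2)]
  proof (rule expect_cong[OF refl])
    fix S assume S: "S \<subseteq> star i U"
    let ?b = "of_bool ({i, j} \<in> S) :: real"
    have "expect p (edges (U - {i})) (\<lambda>T. f (deg (S \<union> T) i) * g (deg (S \<union> T) j)) =
        expect p (edges (U - {i})) (\<lambda>T. f (card S) * g (deg T j) + f (card S) * ?b * (g (Suc (deg T j)) - g (deg T j)))"
      using S U by (intro expect_cong) (auto simp: deg_Un_same deg_Un_other algebra_simps)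
    also have "\<dots> = f (card S) * ?B g + f (card S) * ?b * ?B (\<lambda>x. g (Suc x) - g x)"
      using U by (simp add: expect_add expect_cmult expect_deg[of "U - {i}" j p g]
        expect_deg[of "U - {i}" j p "\<lambda>x. g (Suc x) - g x"] numeral_2_eq_2)
    finally show "expect p (edges (U - {i})) (\<lambda>T. f (deg (S \<union> T) i) * g (deg (S \<union> T) j)) =
        f (card S) * ?B g + f (card S) * ?b * ?B (\<lambda>x. g (Suc x) - g x)" .
  qed
  also have "\<dots> = expect p (star i U) (\<lambda>S. f (card S)) * ?B g +
     expect p (star i U) (\<lambda>S. f (card S) * of_bool ({i, j} \<in> S)) * ?B (\<lambda>x. g (Suc x) - g x)"
    by (simp add: expect_add expect_multc)
  also have "expect p (star i U) (\<lambda>S. f (card S)) = 0"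
    using U 0 by (simp add: expect_card card_star)
  finally show ?thesis by (simp add: expect_star_edge_centered[OF U 0])
qed

lemma expect_deg_sum_power2:
  fixes f :: "nat \<Rightarrow> real"
  assumes V: "finite V" and 0: "bin_ex p (card V - 1) f = 0"
  shows "expect p (edges V) (\<lambda>E. (deg_sum V f E)\<^sup>2) =
    real (card V) * (bin_ex p (card V - 1) (\<lambda>x. (f x)\<^sup>2) +
      (real (card V) - 1) * p * (1 - p) * (bin_ex p (card V - 2) (\<lambda>x. f (Suc x) - f x))\<^sup>2)"
proof -
  let ?a = "p * (1 - p) * (bin_ex p (card V - 2) (\<lambda>x. f (Suc x) - f x))\<^sup>2"
  have "expect p (edges V) (\<lambda>E. (deg_sum V f E)\<^sup>2) =
      (\<Sum>i\<in>V. \<Sum>j\<in>V. expect p (edges V) (\<lambda>E. f (deg E i) * f (deg E j)))"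
    by (simp add: deg_sum_def power2_eq_square sum_product expect_sum)
  also have "\<dots> = (\<Sum>i\<in>V. bin_ex p (card V - 1) (\<lambda>x. (f x)\<^sup>2) + (real (card V) - 1) * ?a)"
  proof (rule sum.cong[OF refl])
    fix i assume i: "i \<in> V"
    have "(\<Sum>j\<in>V. expect p (edges V) (\<lambda>E. f (deg E i) * f (deg E j))) =
       expect p (edges V) (\<lambda>E. f (deg E i) * f (deg E i)) + (\<Sum>j\<in>V - {i}. ?a)"
      using V i by (subst sum.remove[of V i])
        (auto simp: expect_deg_deg[OF V i _ _ 0, of _ f] power2_eq_square intro!: sum.cong)
    also have "(\<Sum>j\<in>V - {i}. ?a) = (real (card V) - 1) * ?a"
      using V i by (simp add: of_nat_diff Suc_leI card_gt_0_iff) (metis One_nat_def Suc_leI card_gt_0_iff empty_iff of_nat_1 of_nat_diff)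
    also have "expect p (edges V) (\<lambda>E. f (deg E i) * f (deg E i)) = bin_ex p (card V - 1) (\<lambda>x. (f x)\<^sup>2)"
      using expect_deg[OF V i, of p "\<lambda>x. (f x)\<^sup>2"] by (simp add: power2_eq_square)
    finally show "(\<Sum>j\<in>V. expect p (edges V) (\<lambda>E. f (deg E i) * f (deg E j))) =
       bin_ex p (card V - 1) (\<lambda>x. (f x)\<^sup>2) + (real (card V) - 1) * ?a" .
  qed
  finally show ?thesis by simp
qed

section \<open>Removing a vertex\<close>

lemma norm_iexp_minus_one: "cmod (iexp x - 1) \<le> \<bar>x\<bar>"
  using iexp_approx1[of x 0] by simp

lemma norm_iexp_approx_linear: "cmod (iexp x - 1 - \<i> * x) \<le> x\<^sup>2 / 2"
  using iexp_approx1[of x 1] by (simp add: numeral_2_eq_2 algebra_simps)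

lemma norm_iexp_diff: "cmod (iexp x - iexp y) \<le> \<bar>x - y\<bar>"
proof -
  have "iexp x - iexp y = iexp y * (iexp (x - y) - 1)"
    by (simp add: algebra_simps flip: exp_add)
  then show ?thesis using norm_iexp_minus_one[of "x - y"] by (simp add: norm_mult)
qed

lemma power2_mult_pow2: "(c * 2 ^ d)\<^sup>2 = c\<^sup>2 * 4 ^ d" for c :: real
  by (simp add: power_mult_distrib power2_eq_square flip: power_mult_distrib[of 2 2])

text \<open>The exponents come from \<open>bin_ex_power_le\<close>: 7 = 8 - 1 for the moment of
  \<open>8 ^ card S\<close>, and 6 = 3 + 3 for two moments with base 4. The 72 is 18 * 4, the 4
  stemming from the shifted power \<open>4 ^ Suc x\<close>.\<close>

definition incr_const :: "real \<Rightarrow> real \<Rightarrow> real" where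
  "incr_const K C = K\<^sup>2 * (8 * exp (7 * C) + 72 * C * exp (6 * C))"

definition removal_const :: "real \<Rightarrow> real \<Rightarrow> real" where
  "removal_const K C = exp C + incr_const K C"

text \<open>The summands bound, in this order, the Taylor remainder, the cost of comparing the
  variance term on the smaller graph with the full graph, and the same cost for the terms of the
  neighbours.\<close>

definition stein_const :: "real \<Rightarrow> real \<Rightarrow> real" where
  "stein_const K C = (K + K * exp C) * incr_const K C + K\<^sup>2 * exp (3 * C) * removal_const K C +
     C * (3 * K * exp C) * (3 * K * removal_const K C + 3 * K * exp C * (2 * removal_const K C))"

context
  fixes p C K :: real and h :: "nat \<Rightarrow> real"
  assumes p01: "0 \<le> p" "p \<le> 1"
    and h: "\<And>d. \<bar>h d\<bar> \<le> K * 2 ^ d"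
begin

lemma growth_const_nonneg: "0 \<le> K"
  using h[of 0] by simp

lemma growth_diff_le: "\<bar>h (Suc d) - h d\<bar> \<le> 3 * K * 2 ^ d"
  using h[of d] h[of "Suc d"] by simp

text \<open>The weight \<open>2 ^ card S\<close> is reserved for a later factor of growth
  \<open>2 ^ d\<close> evaluated at the degree of i. The right-hand side contains only exponentials,
  so that independence turns it into binomial exponential moments.\<close>

lemma vertex_incr_pointwise:
  assumes U: "finite U" and S: "S \<subseteq> star i U"
  shows "2 ^ card S * (vertex_incr h i U S T)\<^sup>2 \<le>
    8 * K\<^sup>2 * 8 ^ card S + 18 * K\<^sup>2 * (\<Sum>j\<in>U - {i}. 4 ^ card S * of_bool ({i, j} \<in> S) * 4 ^ deg T j)"
proof -
  let ?s = "card S"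
  define N where "N = {j \<in> U - {i}. {i, j} \<in> S}"
  have fN: "finite N" using U by (simp add: N_def)
  have sumN: "sum f N = (\<Sum>j\<in>U - {i}. of_bool ({i, j} \<in> S) * f j)" for f :: "nat \<Rightarrow> real"
    using U by (intro sum.mono_neutral_cong_left) (auto simp: N_def)
  have "card N = card ((\<lambda>j. {i, j}) ` N)"
    by (intro card_image[symmetric]) (auto simp: inj_on_def doubleton_eq_iff)
  also have "\<dots> \<le> ?s"
    using U S by (intro card_mono) (auto simp: N_def intro: finite_subset)
  finally have cN: "card N \<le> ?s" .
  define a where "a = h ?s - h 0"
  define b where "b = (\<Sum>j\<in>N. h (Suc (deg T j)) - h (deg T j))"
  have Z: "vertex_incr h i U S T = a + b"
    unfolding vertex_incr_def a_def b_def sumN ..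
  have p1: "(1::real) \<le> 2 ^ ?s" by simp
  have "K * 1 \<le> K * 2 ^ ?s" by (rule mult_left_mono[OF p1 growth_const_nonneg])
  then have "\<bar>a\<bar> \<le> 2 * K * 2 ^ ?s" unfolding a_def using h[of ?s] h[of 0] by simp
  then have "a\<^sup>2 \<le> (2 * K * 2 ^ ?s)\<^sup>2" by (metis abs_ge_zero power2_abs power_mono)
  then have a2: "a\<^sup>2 \<le> 4 * K\<^sup>2 * 4 ^ ?s"
    unfolding power2_mult_pow2 by simp
  \<comment> \<open>Cauchy-Schwarz over the neighbours of i; their number is at most
    \<open>card S\<close>, hence at most \<open>2 ^ card S\<close>.\<close>
  have "b\<^sup>2 \<le> (\<Sum>j\<in>N. (h (Suc (deg T j)) - h (deg T j))\<^sup>2) * real (card N)"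
    unfolding b_def using sum_squared_le_sum_of_squares[of "\<lambda>j. h (Suc (deg T j)) - h (deg T j)" N] by simp
  also have "\<dots> \<le> (\<Sum>j\<in>N. 9 * K\<^sup>2 * 4 ^ deg T j) * 2 ^ ?s"
  proof (rule mult_mono)
    show "(\<Sum>j\<in>N. (h (Suc (deg T j)) - h (deg T j))\<^sup>2) \<le> (\<Sum>j\<in>N. 9 * K\<^sup>2 * 4 ^ deg T j)"
    proof (rule sum_mono)
      fix j
      have "(h (Suc (deg T j)) - h (deg T j))\<^sup>2 \<le> (3 * K * 2 ^ deg T j)\<^sup>2"
        using growth_diff_le[of "deg T j"] by (metis abs_ge_zero power2_abs power_mono)
      also have "\<dots> = 9 * K\<^sup>2 * 4 ^ deg T j"
        unfolding power2_mult_pow2 by simp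
      finally show "(h (Suc (deg T j)) - h (deg T j))\<^sup>2 \<le> 9 * K\<^sup>2 * 4 ^ deg T j" .
    qed
    have "real (card N) \<le> real ?s" using cN by simp
    also have "\<dots> \<le> 2 ^ ?s" using of_nat_less_two_power[of ?s, where 'a = real] by simp
    finally show "real (card N) \<le> 2 ^ ?s" .
  qed (auto intro!: sum_nonneg)
  finally have b2: "b\<^sup>2 \<le> 9 * K\<^sup>2 * 2 ^ ?s * (\<Sum>j\<in>N. 4 ^ deg T j)"
    by (simp add: sum_distrib_left mult_ac)
  have "(a + b)\<^sup>2 \<le> 2 * a\<^sup>2 + 2 * b\<^sup>2"
    using zero_le_power2[of "a - b"] by (simp add: power2_eq_square algebra_simps)
  also have "\<dots> \<le> 8 * K\<^sup>2 * 4 ^ ?s + 18 * K\<^sup>2 * 2 ^ ?s * (\<Sum>j\<in>N. 4 ^ deg T j)"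
    using a2 b2 by simp
  finally have "2 ^ ?s * (a + b)\<^sup>2 \<le> 2 ^ ?s * (8 * K\<^sup>2 * 4 ^ ?s + 18 * K\<^sup>2 * 2 ^ ?s * (\<Sum>j\<in>N. 4 ^ deg T j))"
    by (rule mult_left_mono) simp
  also have "\<dots> = 8 * K\<^sup>2 * (2 ^ ?s * 4 ^ ?s) + 18 * K\<^sup>2 * ((2 ^ ?s * 2 ^ ?s) * (\<Sum>j\<in>N. 4 ^ deg T j))"
    by (simp add: algebra_simps)
  also have "2 ^ ?s * 4 ^ ?s = (8::real) ^ ?s"
    by (simp flip: power_mult_distrib)
  also have "2 ^ ?s * 2 ^ ?s = (4::real) ^ ?s"
    by (simp flip: power_mult_distrib)
  also have "4 ^ ?s * (\<Sum>j\<in>N. 4 ^ deg T j) = (\<Sum>j\<in>U - {i}. 4 ^ ?s * of_bool ({i, j} \<in> S) * (4::real) ^ deg T j)"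
    unfolding sumN sum_distrib_left by (simp add: mult_ac)
  finally show ?thesis unfolding Z .
qed

text \<open>The star of i is independent of the graph \<open>T\<close> on \<open>U - {i}\<close>,
  where j has \<open>card U - 2\<close> potential edges. The sum over j has about n terms,
  compensated by the probability p that j is a neighbour of i.\<close>

lemma vertex_incr_moment:
  assumes U: "finite U" "i \<in> U" and C: "real (card U) * p \<le> C"
  shows "expect p (star i U) (\<lambda>S. expect p (edges (U - {i})) (\<lambda>T. 2 ^ card S * (vertex_incr h i U S T)\<^sup>2))
    \<le> incr_const K C"
proof -
  have Cn: "real m * p \<le> C" if "m \<le> card U" for m
    using C mult_right_mono[of "real m" "real (card U)" p] that p01 by simp
  have C0: "0 \<le> C" using Cn[of 0] by simp
  let ?B = "\<lambda>m. bin_ex p m (\<lambda>x. 4 ^ x :: real)"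
  have B: "?B m \<le> exp (3 * C)" "0 \<le> ?B m" if "m \<le> card U" for m
    using bin_ex_power_le[OF p01, of 4 m C] Cn[OF that] by (auto intro: bin_ex_nonneg[OF p01])
  have "expect p (star i U) (\<lambda>S. expect p (edges (U - {i})) (\<lambda>T. 2 ^ card S * (vertex_incr h i U S T)\<^sup>2))
    \<le> expect p (star i U) (\<lambda>S. expect p (edges (U - {i})) (\<lambda>T. 8 * K\<^sup>2 * 8 ^ card S +
         18 * K\<^sup>2 * (\<Sum>j\<in>U - {i}. 4 ^ card S * of_bool ({i, j} \<in> S) * 4 ^ deg T j)))"
    using U by (intro expect_mono[OF p01] vertex_incr_pointwise) auto
  also have "\<dots> = expect p (star i U) (\<lambda>S. 8 * K\<^sup>2 * 8 ^ card S +
         18 * K\<^sup>2 * (\<Sum>j\<in>U - {i}. 4 ^ card S * of_bool ({i, j} \<in> S) * ?B (card U - 2)))"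
    using U by (intro expect_cong refl)
      (simp add: expect_add expect_const expect_cmult expect_sum expect_deg[of "U - {i}" _ p "\<lambda>x. 4 ^ x"] numeral_2_eq_2)
  also have "\<dots> = 8 * K\<^sup>2 * bin_ex p (card U - 1) (\<lambda>x. 8 ^ x) +
     18 * K\<^sup>2 * (\<Sum>j\<in>U - {i}. p * bin_ex p (card U - 2) (\<lambda>x. 4 ^ Suc x) * ?B (card U - 2))"
    using U by (simp add: expect_add expect_cmult expect_multc expect_sum expect_star_edge[of U i _ p "\<lambda>x. 4 ^ x"]
        expect_card[of "star i U" p "\<lambda>x. 8 ^ x"] card_star)
  also have "bin_ex p (card U - 2) (\<lambda>x. (4::real) ^ Suc x) = 4 * ?B (card U - 2)"
    by (simp add: bin_ex_cmult)
  also have "(\<Sum>j\<in>U - {i}. p * (4 * ?B (card U - 2)) * ?B (card U - 2)) =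
      4 * (real (card U - 1) * p) * (?B (card U - 2) * ?B (card U - 2))"
    using U by simp
  also have "8 * K\<^sup>2 * bin_ex p (card U - 1) (\<lambda>x. 8 ^ x) + 18 * K\<^sup>2 * (4 * (real (card U - 1) * p) * (?B (card U - 2) * ?B (card U - 2))) \<le>
     8 * K\<^sup>2 * exp (7 * C) + 18 * K\<^sup>2 * (4 * C * (exp (3 * C) * exp (3 * C)))"
    using bin_ex_power_le[OF p01, of 8 "card U - 1" C] Cn[of "card U - 1"] B[of "card U - 2"] C0 p01
    by (intro add_mono mult_left_mono mult_mono) auto
  also have "\<dots> = incr_const K C"
    by (simp add: incr_const_def algebra_simps flip: exp_add)
  finally show ?thesis .
qed

lemma incr_const_nonneg: "0 \<le> C \<Longrightarrow> 0 \<le> incr_const K C"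
  by (simp add: incr_const_def)

lemma removal_const_nonneg: "0 \<le> C \<Longrightarrow> 0 \<le> removal_const K C"
  using incr_const_nonneg by (simp add: removal_const_def)

lemma vertex_incr_abs_moment:
  assumes U: "finite U" "i \<in> U" and C: "real (card U) * p \<le> C"
  shows "expect p (star i U) (\<lambda>S. expect p (edges (U - {i})) (\<lambda>T. 2 ^ card S * \<bar>vertex_incr h i U S T\<bar>))
    \<le> removal_const K C"
proof -
  have "expect p (star i U) (\<lambda>S. expect p (edges (U - {i})) (\<lambda>T. 2 ^ card S * \<bar>vertex_incr h i U S T\<bar>))
     \<le> expect p (star i U) (\<lambda>S. expect p (edges (U - {i})) (\<lambda>T. 2 ^ card S + 2 ^ card S * (vertex_incr h i U S T)\<^sup>2))"
  proof (intro expect_mono[OF p01])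
    fix S T
    let ?z = "vertex_incr h i U S T"
    \<comment> \<open>This reduces the first moment to the second; the 1 gives the summand
      \<open>exp C\<close> of \<open>removal_const\<close>.\<close>
    have "\<bar>?z\<bar> \<le> 1 + ?z\<^sup>2"
      using zero_le_power2[of "\<bar>?z\<bar> - 1"] by (simp add: power2_diff)
    then have "2 ^ card S * \<bar>?z\<bar> \<le> 2 ^ card S * (1 + ?z\<^sup>2)" by (intro mult_left_mono) auto
    then show "2 ^ card S * \<bar>?z\<bar> \<le> 2 ^ card S + 2 ^ card S * ?z\<^sup>2" by (simp add: algebra_simps)
  qed
  also have "\<dots> = bin_ex p (card U - 1) (\<lambda>x. 2 ^ x) +
      expect p (star i U) (\<lambda>S. expect p (edges (U - {i})) (\<lambda>T. 2 ^ card S * (vertex_incr h i U S T)\<^sup>2))"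
    using U by (simp add: expect_add expect_const expect_card[of "star i U" p "\<lambda>x. 2 ^ x"] card_star)
  also have "\<dots> \<le> exp ((2 - 1) * C) + incr_const K C"
  proof (intro add_mono vertex_incr_moment[OF U C] bin_ex_power_le[OF p01])
    show "real (card U - 1) * p \<le> C"
      using C mult_right_mono[of "real (card U - 1)" "real (card U)" p] p01 by simp
  qed simp
  finally show ?thesis by (simp add: removal_const_def)
qed

text \<open>\<open>g (deg E i)\<close> depends only on the star of i, and deleting that star changes
  \<open>F\<close> by at most \<open>\<bar>\<theta>\<bar>\<close> times the increment, since
  \<open>iexp\<close> is Lipschitz. After the deletion the two factors are independent.\<close>

lemma vertex_removal:
  fixes \<theta> \<kappa> :: real
  assumes V: "finite V" "U \<subseteq> V" "i \<in> U" and C: "real (card U) * p \<le> C"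
    and g: "\<And>d. \<bar>g d\<bar> \<le> G * 2 ^ d"
  defines "F \<equiv> \<lambda>E. iexp (\<theta> * (deg_sum V h E - \<kappa>))"
  shows "cmod (expect p (edges U) (\<lambda>E. of_real (g (deg E i)) * F E) -
      of_real (bin_ex p (card U - 1) g) * expect p (edges (U - {i})) F) \<le> \<bar>\<theta>\<bar> * G * removal_const K C"
proof -
  have U: "finite U" using V finite_subset by blast
  have G0: "0 \<le> G" using g[of 0] by simp
  let ?z = "\<lambda>S T. vertex_incr h i U S T"
  have 1: "expect p (edges U) (\<lambda>E. of_real (g (deg E i)) * F E) =
     expect p (star i U) (\<lambda>S. expect p (edges (U - {i})) (\<lambda>T. of_real (g (card S)) * F (S \<union> T)))"
    unfolding expect_edges_split[OF U \<open>i \<in> U\<close>]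
    by (intro expect_cong refl) (simp add: deg_Un_same)
  have 2: "of_real (bin_ex p (card U - 1) g) * expect p (edges (U - {i})) F =
     expect p (star i U) (\<lambda>S. expect p (edges (U - {i})) (\<lambda>T. of_real (g (card S)) * F T))"
    using U V by (simp add: expect_cmult expect_multc expect_of_real expect_card card_star)
  have "cmod (expect p (edges U) (\<lambda>E. of_real (g (deg E i)) * F E) -
      of_real (bin_ex p (card U - 1) g) * expect p (edges (U - {i})) F) =
     cmod (expect p (star i U) (\<lambda>S. expect p (edges (U - {i})) (\<lambda>T. of_real (g (card S)) * (F (S \<union> T) - F T))))"
    unfolding 1 2 by (simp add: right_diff_distrib expect_diff)
  also have "\<dots> \<le> expect p (star i U) (\<lambda>S. expect p (edges (U - {i})) (\<lambda>T. \<bar>\<theta>\<bar> * G * (2 ^ card S * \<bar>?z S T\<bar>)))"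
  proof (intro norm_expect_le_mono[OF p01])
    fix S T assume S: "S \<subseteq> star i U" and T: "T \<subseteq> edges (U - {i})"
    have "cmod (F (S \<union> T) - F T) \<le> \<bar>\<theta> * (deg_sum V h (S \<union> T) - \<kappa>) - \<theta> * (deg_sum V h T - \<kappa>)\<bar>"
      unfolding F_def by (rule norm_iexp_diff)
    also have "\<dots> = \<bar>\<theta>\<bar> * \<bar>?z S T\<bar>"
      by (simp add: deg_sum_Un[OF V S T] algebra_simps flip: abs_mult)
    finally have "\<bar>g (card S)\<bar> * cmod (F (S \<union> T) - F T) \<le> G * 2 ^ card S * (\<bar>\<theta>\<bar> * \<bar>?z S T\<bar>)"
      using g G0 by (intro mult_mono) auto
    then show "cmod (of_real (g (card S)) * (F (S \<union> T) - F T)) \<le> \<bar>\<theta>\<bar> * G * (2 ^ card S * \<bar>?z S T\<bar>)"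
      by (simp add: norm_mult mult_ac)
  qed
  also have "\<dots> = \<bar>\<theta>\<bar> * G * expect p (star i U) (\<lambda>S. expect p (edges (U - {i})) (\<lambda>T. 2 ^ card S * \<bar>?z S T\<bar>))"
    by (simp add: expect_cmult)
  also have "\<dots> \<le> \<bar>\<theta>\<bar> * G * removal_const K C"
    using vertex_incr_abs_moment[OF U \<open>i \<in> U\<close> C] G0 by (intro mult_left_mono) auto
  finally show ?thesis .
qed

lemma vertex_removal_1:
  fixes \<theta> \<kappa> :: real
  assumes V: "finite V" "U \<subseteq> V" "i \<in> U" and C: "real (card U) * p \<le> C"
  defines "F \<equiv> \<lambda>E. iexp (\<theta> * (deg_sum V h E - \<kappa>))"
  shows "cmod (expect p (edges U) F - expect p (edges (U - {i})) F) \<le> \<bar>\<theta>\<bar> * removal_const K C"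
  using vertex_removal[OF V C, of "\<lambda>_. 1" 1 \<theta> \<kappa>] by (simp add: F_def)

text \<open>With z the increment, F (S \<union> T) = F T * iexp (\<theta> z) is expanded to first
  order. The linear term pairs the centred \<open>h (deg E i)\<close> with z: its own part gives the
  variance \<open>v\<close>, and each neighbour contributes through the single shared edge. What
  remains are expectations over graphs with one or two vertices fewer, exchanged for the full one at
  cost O(\<theta>).\<close>

lemma stein_vertex:
  fixes \<theta> \<kappa> :: real
  assumes V: "finite V" "i \<in> V" and C: "real (card V) * p \<le> C"
  defines "F \<equiv> \<lambda>E. iexp (\<theta> * (deg_sum V h E - \<kappa>))"
    and "\<mu> \<equiv> bin_ex p (card V - 1) h"
    and "a \<equiv> bin_ex p (card V - 2) (\<lambda>x. h (Suc x) - h x)"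
  defines "v \<equiv> bin_ex p (card V - 1) (\<lambda>x. (h x - \<mu>)\<^sup>2)"
  shows "cmod (expect p (edges V) (\<lambda>E. of_real (h (deg E i) - \<mu>) * F E) -
      \<i> * \<theta> * of_real (v + (real (card V) - 1) * p * (1 - p) * a\<^sup>2) * expect p (edges V) F)
    \<le> \<theta>\<^sup>2 * stein_const K C"
proof -
  let ?W = "V - {i}"
  let ?z = "\<lambda>S T. vertex_incr h i V S T"
  let ?R = "removal_const K C"
  let ?D = "\<lambda>x. h (Suc x) - h x"
  have Cn: "real m * p \<le> C" if "m \<le> card V" for m
    using C mult_right_mono[of "real m" "real (card V)" p] that p01 by simp
  have C0: "0 \<le> C" using Cn[of 0] by simp
  have R0: "0 \<le> ?R" using removal_const_nonneg[OF C0] .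
  have mu: "\<bar>\<mu>\<bar> \<le> K * exp C"
  proof -
    have "\<bar>\<mu>\<bar> \<le> bin_ex p (card V - 1) (\<lambda>x. K * 2 ^ x)"
      unfolding \<mu>_def using bin_ex_norm_le_mono[OF p01, of h "\<lambda>x. K * 2 ^ x"] h by simp
    also have "\<dots> \<le> K * exp ((2 - 1) * C)"
      unfolding bin_ex_cmult using Cn by (intro mult_left_mono bin_ex_power_le[OF p01] growth_const_nonneg) auto
    finally show ?thesis by simp
  qed
  have a: "\<bar>a\<bar> \<le> 3 * K * exp C"
  proof -
    have "\<bar>a\<bar> \<le> bin_ex p (card V - 2) (\<lambda>x. 3 * K * 2 ^ x)"
      unfolding a_def using bin_ex_norm_le_mono[OF p01, of ?D "\<lambda>x. 3 * K * 2 ^ x"] growth_diff_le by simp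
    also have "\<dots> \<le> 3 * K * exp ((2 - 1) * C)"
      unfolding bin_ex_cmult using Cn growth_const_nonneg by (intro mult_left_mono bin_ex_power_le[OF p01]) auto
    finally show ?thesis by simp
  qed
  have v: "0 \<le> v" "v \<le> K\<^sup>2 * exp (3 * C)"
  proof -
    show "0 \<le> v" unfolding v_def by (rule bin_ex_nonneg[OF p01]) simp
    have "v \<le> bin_ex p (card V - 1) (\<lambda>x. (h x)\<^sup>2)"
      unfolding v_def \<mu>_def bin_ex_variance by simp
    also have "\<dots> \<le> bin_ex p (card V - 1) (\<lambda>x. K\<^sup>2 * 4 ^ x)"
    proof (rule bin_ex_mono[OF p01])
      fix x
      have "(h x)\<^sup>2 \<le> (K * 2 ^ x)\<^sup>2" using h[of x] by (metis abs_ge_zero power2_abs power_mono)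
      also have "\<dots> = K\<^sup>2 * 4 ^ x"
        unfolding power2_mult_pow2 by simp
      finally show "(h x)\<^sup>2 \<le> K\<^sup>2 * 4 ^ x" .
    qed
    also have "\<dots> \<le> K\<^sup>2 * exp ((4 - 1) * C)"
      unfolding bin_ex_cmult using Cn by (intro mult_left_mono bin_ex_power_le[OF p01]) auto
    finally show "v \<le> K\<^sup>2 * exp (3 * C)" by simp
  qed
  define \<xi> where "\<xi> d = h d - \<mu>" for d
  have xi0: "bin_ex p (card V - 1) \<xi> = 0" by (simp add: \<xi>_def[abs_def] bin_ex_diff \<mu>_def)
  have xi: "\<bar>\<xi> d\<bar> \<le> (K + K * exp C) * 2 ^ d" for d
  proof -
    have "K * exp C * 1 \<le> K * exp C * 2 ^ d" using growth_const_nonneg by (intro mult_left_mono) auto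
    then show ?thesis unfolding \<xi>_def using h[of d] mu by (simp add: algebra_simps)
  qed
  have xiD: "\<xi> (Suc x) - \<xi> x = ?D x" for x by (simp add: \<xi>_def)
  let ?EE = "\<lambda>G. expect p (star i V) (\<lambda>S. expect p (edges ?W) (\<lambda>T. G S T))"
  define \<rho> where "\<rho> S T = of_real (\<xi> (card S)) * F T * (iexp (\<theta> * ?z S T) - 1 - \<i> * of_real (\<theta> * ?z S T))" for S T
  \<comment> \<open>The contribution of a neighbour j still couples \<open>deg T j\<close> with
    \<open>F T\<close>, so it is not yet a multiple of the characteristic function.\<close>
  define c where "c j = expect p (edges ?W) (\<lambda>T. of_real (?D (deg T j)) * F T)" for j
  have 1: "expect p (edges V) (\<lambda>E. of_real (\<xi> (deg E i)) * F E) =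
     ?EE (\<lambda>S T. of_real (\<xi> (card S)) * F T + \<i> * \<theta> * (of_real (\<xi> (card S) * ?z S T) * F T) + \<rho> S T)"
    unfolding expect_edges_split[OF V]
  proof (intro expect_cong refl)
    fix S T assume S: "S \<subseteq> star i V" and T: "T \<subseteq> edges ?W"
    have "F (S \<union> T) = F T * iexp (\<theta> * ?z S T)"
      unfolding F_def deg_sum_Un[OF V(1) subset_refl V(2) S T]
      by (simp add: algebra_simps flip: exp_add)
    then show "of_real (\<xi> (deg (S \<union> T) i)) * F (S \<union> T) =
       of_real (\<xi> (card S)) * F T + \<i> * \<theta> * (of_real (\<xi> (card S) * ?z S T) * F T) + \<rho> S T"
      unfolding \<rho>_def deg_Un_same[OF S T] by (simp add: algebra_simps)
  qed
  have 2: "?EE (\<lambda>S T. of_real (\<xi> (card S)) * F T) = 0"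
    using V xi0 by (simp add: expect_cmult expect_multc expect_of_real expect_card card_star)
  have 3: "?EE (\<lambda>S T. of_real (\<xi> (card S) * ?z S T) * F T) =
     of_real v * expect p (edges ?W) F + of_real (p * (1 - p) * a) * (\<Sum>j\<in>?W. c j)"
  proof -
    have "?EE (\<lambda>S T. of_real (\<xi> (card S) * ?z S T) * F T) =
       ?EE (\<lambda>S T. of_real (\<xi> (card S) * (h (card S) - h 0)) * F T +
         (\<Sum>j\<in>?W. of_real (\<xi> (card S) * of_bool ({i, j} \<in> S)) * (of_real (?D (deg T j)) * F T)))"
      by (intro expect_cong refl)
        (simp add: vertex_incr_def algebra_simps sum_distrib_left sum_distrib_right sum_subtractf)
    also have "\<dots> = of_real (bin_ex p (card V - 1) (\<lambda>x. \<xi> x * (h x - h 0))) * expect p (edges ?W) F +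
       (\<Sum>j\<in>?W. of_real (expect p (star i V) (\<lambda>S. \<xi> (card S) * of_bool ({i, j} \<in> S))) * c j)"
      unfolding c_def using V
      by (simp only: expect_add expect_sum expect_cmult expect_multc expect_of_real)
        (simp add: expect_card[of "star i V" p "\<lambda>x. \<xi> x * (h x - h 0)"] card_star)
    also have "bin_ex p (card V - 1) (\<lambda>x. \<xi> x * (h x - h 0)) = v"
    proof -
      \<comment> \<open>As \<xi> is centred, subtracting \<open>h 0\<close> is as good as
        subtracting \<mu>.\<close>
      have "(\<lambda>x. \<xi> x * (h x - h 0)) = (\<lambda>x. (h x - \<mu>)\<^sup>2 + (\<mu> - h 0) * \<xi> x)"
        by (auto simp: \<xi>_def power2_eq_square algebra_simps)
      then show ?thesis using xi0 by (simp add: bin_ex_add bin_ex_cmult v_def)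
    qed
    also have "(\<Sum>j\<in>?W. of_real (expect p (star i V) (\<lambda>S. \<xi> (card S) * of_bool ({i, j} \<in> S))) * c j) =
       of_real (p * (1 - p) * a) * (\<Sum>j\<in>?W. c j)"
      unfolding sum_distrib_left using V
      by (intro sum.cong refl) (auto simp: expect_star_edge_centered[OF _ _ _ _ xi0] xiD a_def)
    finally show ?thesis .
  qed
  have 4: "cmod (?EE \<rho>) \<le> \<theta>\<^sup>2 * ((K + K * exp C) * incr_const K C)"
  proof -
    have "cmod (?EE \<rho>) \<le> ?EE (\<lambda>S T. \<theta>\<^sup>2 * (K + K * exp C) * (2 ^ card S * (?z S T)\<^sup>2))"
    proof (intro norm_expect_le_mono[OF p01])
      fix S T
      have "cmod (\<rho> S T) = \<bar>\<xi> (card S)\<bar> * cmod (iexp (\<theta> * ?z S T) - 1 - \<i> * of_real (\<theta> * ?z S T))"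
        by (simp add: \<rho>_def norm_mult F_def)
      also have "\<dots> \<le> ((K + K * exp C) * 2 ^ card S) * ((\<theta> * ?z S T)\<^sup>2 / 2)"
        using growth_const_nonneg by (intro mult_mono xi norm_iexp_approx_linear) auto
      also have "\<dots> \<le> ((K + K * exp C) * 2 ^ card S) * ((\<theta> * ?z S T)\<^sup>2)"
        using growth_const_nonneg by (intro mult_left_mono) auto
      finally show "cmod (\<rho> S T) \<le> \<theta>\<^sup>2 * (K + K * exp C) * (2 ^ card S * (?z S T)\<^sup>2)"
        by (simp add: power_mult_distrib algebra_simps)
    qed
    also have "\<dots> = \<theta>\<^sup>2 * ((K + K * exp C) * ?EE (\<lambda>S T. 2 ^ card S * (?z S T)\<^sup>2))"
      by (simp add: expect_cmult)
    also have "\<dots> \<le> \<theta>\<^sup>2 * ((K + K * exp C) * incr_const K C)"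
      using growth_const_nonneg by (intro mult_left_mono vertex_incr_moment[OF V C]) auto
    finally show ?thesis .
  qed
  let ?\<phi> = "expect p (edges V) F"
  have 5: "cmod (expect p (edges ?W) F - ?\<phi>) \<le> \<bar>\<theta>\<bar> * ?R"
    using vertex_removal_1[OF V(1) subset_refl V(2) C, of \<theta> \<kappa>] unfolding F_def by (simp add: norm_minus_commute)
  have 6: "cmod (c j - of_real a * ?\<phi>) \<le> \<bar>\<theta>\<bar> * (3 * K * ?R + 3 * K * exp C * (2 * ?R))" if j: "j \<in> ?W" for j
  proof -
    have CW: "real (card ?W) * p \<le> C" using V by (simp add: Cn)
    have e: "card ?W - 1 = card V - 2" using V by simp
    \<comment> \<open>Removing j as well decouples \<open>deg T j\<close> from \<open>F\<close>. Its
      degree in the graph without i has \<open>card V - 2\<close> trials, exactly as in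
      \<open>a\<close>. Restoring both vertices costs one \<open>?R\<close> each, hence the factor
      2.\<close>
    have A: "cmod (c j - of_real a * expect p (edges (?W - {j})) F) \<le> \<bar>\<theta>\<bar> * (3 * K) * ?R"
      using vertex_removal[OF V(1) _ j CW, of ?D "3 * K" \<theta> \<kappa>] growth_diff_le unfolding c_def F_def a_def e by auto
    have B: "cmod (expect p (edges (?W - {j})) F - expect p (edges ?W) F) \<le> \<bar>\<theta>\<bar> * ?R"
      using vertex_removal_1[OF V(1) _ j CW, of \<theta> \<kappa>] unfolding F_def by (auto simp: norm_minus_commute)
    have "cmod (expect p (edges (?W - {j})) F - ?\<phi>) \<le> \<bar>\<theta>\<bar> * (2 * ?R)"
      using norm_triangle_le[OF add_mono[OF B 5]] by (simp add: algebra_simps)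
    then have "cmod (of_real a * (expect p (edges (?W - {j})) F - ?\<phi>)) \<le> (3 * K * exp C) * (\<bar>\<theta>\<bar> * (2 * ?R))"
      unfolding norm_mult using a growth_const_nonneg by (intro mult_mono) auto
    from norm_triangle_le[OF add_mono[OF A this]] show ?thesis by (simp add: algebra_simps)
  qed
  have card_W: "real (card ?W) = real (card V) - 1"
  proof -
    have "card V \<noteq> 0" using V by auto
    then have "1 \<le> card V" by linarith
    then show ?thesis using V of_nat_diff[of 1 "card V", where 'a = real] by simp
  qed
  have pq: "0 \<le> p * (1 - p)" "p * (1 - p) \<le> p" using p01 by (auto simp: mult_left_le)
  \<comment> \<open>The sum has \<open>card V - 1\<close> terms of order \<theta>; the prefactor p
    turns this number into at most \<open>C\<close>.\<close>
  have 7: "cmod (of_real (p * (1 - p) * a) * (\<Sum>j\<in>?W. c j - of_real a * ?\<phi>)) \<le>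
      \<bar>\<theta>\<bar> * (C * (3 * K * exp C) * (3 * K * ?R + 3 * K * exp C * (2 * ?R)))"
  proof -
    let ?e = "\<bar>\<theta>\<bar> * (3 * K * ?R + 3 * K * exp C * (2 * ?R))"
    have e0: "0 \<le> ?e" using growth_const_nonneg R0 by simp
    have "cmod (\<Sum>j\<in>?W. c j - of_real a * ?\<phi>) \<le> (\<Sum>j\<in>?W. ?e)"
      by (rule sum_norm_le) (rule 6)
    also have "\<dots> = real (card ?W) * ?e" by simp
    finally have "cmod (of_real (p * (1 - p) * a) * (\<Sum>j\<in>?W. c j - of_real a * ?\<phi>)) \<le>
        (p * \<bar>a\<bar>) * (real (card ?W) * ?e)"
      unfolding norm_mult
    proof (intro mult_mono)
      have "cmod (of_real (p * (1 - p) * a)) = p * (1 - p) * \<bar>a\<bar>"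
        unfolding norm_of_real abs_mult[of "p * (1 - p)"] using pq by simp
      then show "cmod (of_real (p * (1 - p) * a)) \<le> p * \<bar>a\<bar>"
        using pq by (simp add: mult_right_mono)
    qed (use p01 in auto)
    also have "\<dots> = (real (card ?W) * p) * \<bar>a\<bar> * ?e" by simp
    also have "\<dots> \<le> C * (3 * K * exp C) * ?e"
      using V p01 C0 e0 a by (intro mult_right_mono mult_mono Cn) auto
    finally show ?thesis by (simp add: algebra_simps)
  qed
  have 8: "cmod (of_real v * (expect p (edges ?W) F - ?\<phi>)) \<le> \<bar>\<theta>\<bar> * (K\<^sup>2 * exp (3 * C) * ?R)"
  proof -
    have "cmod (of_real v * (expect p (edges ?W) F - ?\<phi>)) \<le> (K\<^sup>2 * exp (3 * C)) * (\<bar>\<theta>\<bar> * ?R)"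
      unfolding norm_mult using v 5 by (intro mult_mono) auto
    then show ?thesis by (simp add: algebra_simps)
  qed
  let ?A = "of_real v * (expect p (edges ?W) F - ?\<phi>)"
  let ?B = "of_real (p * (1 - p) * a) * (\<Sum>j\<in>?W. c j - of_real a * ?\<phi>)"
  have "expect p (edges V) (\<lambda>E. of_real (h (deg E i) - \<mu>) * F E) =
     \<i> * \<theta> * (of_real v * expect p (edges ?W) F + of_real (p * (1 - p) * a) * (\<Sum>j\<in>?W. c j)) + ?EE \<rho>"
    using 1 2 3 unfolding \<xi>_def by (simp add: expect_add expect_cmult)
  also have "of_real v * expect p (edges ?W) F + of_real (p * (1 - p) * a) * (\<Sum>j\<in>?W. c j) =
     ?A + ?B + of_real (v + real (card ?W) * p * (1 - p) * a\<^sup>2) * ?\<phi>"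
    by (simp add: sum_subtractf algebra_simps power2_eq_square)
  finally have "expect p (edges V) (\<lambda>E. of_real (h (deg E i) - \<mu>) * F E) -
      \<i> * \<theta> * of_real (v + (real (card V) - 1) * p * (1 - p) * a\<^sup>2) * ?\<phi> = \<i> * \<theta> * (?A + ?B) + ?EE \<rho>"
    unfolding card_W by (simp add: algebra_simps)
  also have "cmod \<dots> \<le> \<bar>\<theta>\<bar> * cmod (?A + ?B) + cmod (?EE \<rho>)"
    by (rule order_trans[OF norm_triangle_ineq]) (simp add: norm_mult)
  also have "\<dots> \<le> \<bar>\<theta>\<bar> * (\<bar>\<theta>\<bar> * (K\<^sup>2 * exp (3 * C) * ?R) +
      \<bar>\<theta>\<bar> * (C * (3 * K * exp C) * (3 * K * ?R + 3 * K * exp C * (2 * ?R)))) +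
      \<theta>\<^sup>2 * ((K + K * exp C) * incr_const K C)"
    by (intro add_mono mult_left_mono 4 order_trans[OF norm_triangle_ineq] 7 8) auto
  also have "\<dots> = \<theta>\<^sup>2 * stein_const K C"
  proof -
    have "\<theta>\<^sup>2 = \<bar>\<theta>\<bar> * \<bar>\<theta>\<bar>" by (simp add: power2_eq_square)
    then show ?thesis by (simp only: stein_const_def) (simp only: algebra_simps)
  qed
  finally show ?thesis .
qed

end

section \<open>Characteristic functions of sums over degrees\<close>

text \<open>A quantitative form of the Stein--Tikhomirov argument: the characteristic function of the
  standard normal distribution solves \<open>\<phi>' = - \<lambda> \<sigma>\<^sup>2 \<phi>\<close>, so an approximate solution is close to it.\<close>

lemma gaussian_ode_bound:
  fixes \<phi> \<phi>' :: "real \<Rightarrow> complex" and w B :: real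
  assumes \<phi>: "\<And>x. (\<phi> has_vector_derivative \<phi>' x) (at x)" and 0: "\<phi> 0 = 1"
    and w: "w \<ge> 0"
    and B: "\<And>x. 0 < x \<Longrightarrow> x < 1 \<Longrightarrow> cmod (\<phi>' x + of_real (x * w) * \<phi> x) \<le> B"
  shows "cmod (\<phi> 1 - of_real (exp (- w / 2))) \<le> B"
proof -
  \<comment> \<open>Integrating factor: the derivative of \<psi> is the defect of the differential
    equation times exp(x^2 w / 2). On [0, 1] this is at most exp(w / 2), which cancels against the
    same factor at x = 1.\<close>
  define \<psi> where "\<psi> x = exp (x\<^sup>2 * w / 2) *\<^sub>R \<phi> x" for x
  define \<psi>' where "\<psi>' x = exp (x\<^sup>2 * w / 2) *\<^sub>R (\<phi>' x + of_real (x * w) * \<phi> x)" for x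
  have der: "(\<psi> has_vector_derivative \<psi>' x) (at x)" for x
    unfolding \<psi>_def \<psi>'_def
    by (rule has_vector_derivative_eq_rhs, rule has_vector_derivative_scaleR[OF _ \<phi>])
      (auto intro!: derivative_eq_intros simp: algebra_simps scaleR_conv_of_real)
  have "continuous_on {0..1} \<psi>"
    using der has_vector_derivative_continuous continuous_at_imp_continuous_on by blast
  moreover have "(\<psi> has_derivative (\<lambda>h. h *\<^sub>R \<psi>' x)) (at x)" for x
    using der[of x] by (simp add: has_vector_derivative_def)
  ultimately obtain x where x: "x \<in> {0<..<1}" "norm (\<psi> 1 - \<psi> 0) \<le> norm ((1 - 0) *\<^sub>R \<psi>' x)"
    using mvt_general[of 0 1 \<psi> "\<lambda>x h. h *\<^sub>R \<psi>' x"] by auto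
  have "x\<^sup>2 \<le> 1\<^sup>2" using x by (intro power_mono) auto
  then have "x\<^sup>2 * w / 2 \<le> w / 2" using w by (simp add: mult_left_le_one_le)
  then have "norm (\<psi>' x) \<le> exp (w / 2) * B"
    unfolding \<psi>'_def norm_scaleR using B[of x] x by (intro mult_mono) auto
  then have "norm (\<psi> 1 - \<psi> 0) \<le> exp (w / 2) * B" using x by simp
  moreover have "\<psi> 1 - \<psi> 0 = exp (w / 2) *\<^sub>R (\<phi> 1 - of_real (exp (- w / 2)))"
    by (simp add: \<psi>_def 0 scaleR_conv_of_real algebra_simps flip: exp_add of_real_mult)
  ultimately show ?thesis by simp
qed

text \<open>The differential equation runs along x \<mapsto> E iexp(x W). The derivative is a sum
  over vertices, each handled by \<open>stein_vertex\<close> at \<theta> = x / sqrt n; n errors of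
  size \<theta>^2 and the outer factor 1 / sqrt n give the rate.\<close>

lemma deg_sum_char_bound:
  fixes p C K :: real and h :: "nat \<Rightarrow> real"
  assumes p01: "0 \<le> p" "p \<le> 1" and V: "finite V" "V \<noteq> {}" and C: "real (card V) * p \<le> C"
    and h: "\<And>d. \<bar>h d\<bar> \<le> K * 2 ^ d"
  defines "\<mu> \<equiv> bin_ex p (card V - 1) h"
    and "a \<equiv> bin_ex p (card V - 2) (\<lambda>x. h (Suc x) - h x)"
  defines "w \<equiv> bin_ex p (card V - 1) (\<lambda>x. (h x)\<^sup>2) - \<mu>\<^sup>2 + (real (card V) - 1) * p * (1 - p) * a\<^sup>2"
  shows "cmod (expect p (edges V) (\<lambda>E. iexp ((deg_sum V h E - real (card V) * \<mu>) / sqrt (real (card V)))) -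
      of_real (exp (- w / 2))) \<le> stein_const K C / sqrt (real (card V))"
proof -
  let ?n = "real (card V)"
  have n: "?n > 0" using V by (simp add: card_gt_0_iff)
  define W where "W E = (deg_sum V h E - ?n * \<mu>) / sqrt ?n" for E
  define \<phi> where "\<phi> x = expect p (edges V) (\<lambda>E. iexp (x * W E))" for x
  define \<phi>' where "\<phi>' x = expect p (edges V) (\<lambda>E. \<i> * W E * iexp (x * W E))" for x
  have c1: "1 \<le> ?n" using n by simp
  have w0: "w \<ge> 0"
    using bin_ex_jensen[OF p01, of "card V - 1" h] c1 p01 unfolding w_def \<mu>_def by (intro add_nonneg_nonneg) auto
  have "cmod (\<phi> 1 - of_real (exp (- w / 2))) \<le> stein_const K C / sqrt ?n"
  proof (rule gaussian_ode_bound[OF _ _ w0])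
    fix x
    have "((\<lambda>x. iexp (x * c)) has_vector_derivative \<i> * c * iexp (x * c)) (at x)" for c
      using exp_scaleR_has_vector_derivative_right[of "\<i> * of_real c" x UNIV]
      by (simp add: scaleR_conv_of_real mult_ac)
    then show "(\<phi> has_vector_derivative \<phi>' x) (at x)"
      unfolding \<phi>_def \<phi>'_def expect_def
      by (intro has_vector_derivative_sum bounded_linear.has_vector_derivative[OF bounded_linear_scaleR_right])
  next
    show "\<phi> 0 = 1" using V by (simp add: \<phi>_def expect_const)
  next
    fix x :: real assume x: "0 < x" "x < 1"
    define \<theta> where "\<theta> = x / sqrt ?n"
    have e: "x * W E = \<theta> * (deg_sum V h E - ?n * \<mu>)" for E
      by (simp add: W_def \<theta>_def)
    have W: "W E = (1 / sqrt ?n) * (\<Sum>i\<in>V. h (deg E i) - \<mu>)" for E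
      by (simp add: W_def deg_sum_def sum_subtractf)
    have "\<phi>' x = \<i> / sqrt ?n * (\<Sum>i\<in>V. expect p (edges V) (\<lambda>E. of_real (h (deg E i) - \<mu>) * iexp (x * W E)))"
      unfolding \<phi>'_def
      by (simp add: W sum_distrib_left sum_distrib_right mult_ac flip: expect_sum expect_cmult)
    moreover have "of_real (x * w) * \<phi> x = - (\<i> / sqrt ?n * (\<Sum>i\<in>V. \<i> * \<theta> * of_real w * \<phi> x))"
      using n by (simp add: \<theta>_def field_simps flip: of_real_mult)
    ultimately have "\<phi>' x + of_real (x * w) * \<phi> x = \<i> / sqrt ?n *
        (\<Sum>i\<in>V. expect p (edges V) (\<lambda>E. of_real (h (deg E i) - \<mu>) * iexp (x * W E)) - \<i> * \<theta> * of_real w * \<phi> x)"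
      by (simp add: sum_subtractf algebra_simps)
    then have "cmod (\<phi>' x + of_real (x * w) * \<phi> x) = 1 / sqrt ?n *
       cmod (\<Sum>i\<in>V. expect p (edges V) (\<lambda>E. of_real (h (deg E i) - \<mu>) * iexp (x * W E)) - \<i> * \<theta> * of_real w * \<phi> x)"
      by (simp add: norm_mult norm_divide)
    also have "\<dots> \<le> 1 / sqrt ?n * (\<Sum>i\<in>V. \<theta>\<^sup>2 * stein_const K C)"
    proof (intro mult_left_mono sum_norm_le)
      fix i assume "i \<in> V"
      from stein_vertex[OF p01 h V(1) this C, of \<theta> "?n * \<mu>"]
      show "cmod (expect p (edges V) (\<lambda>E. of_real (h (deg E i) - \<mu>) * iexp (x * W E)) - \<i> * \<theta> * of_real w * \<phi> x)
         \<le> \<theta>\<^sup>2 * stein_const K C"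
        unfolding \<phi>_def e w_def a_def \<mu>_def bin_ex_variance .
    qed simp
    also have "\<dots> = x\<^sup>2 * (stein_const K C / sqrt ?n)"
      using n by (simp add: \<theta>_def power_divide)
    also have "\<dots> \<le> stein_const K C / sqrt ?n"
    proof -
      have "0 \<le> stein_const K C"
      proof -
        have "0 \<le> K" using h[of 0] by simp
        moreover have "0 \<le> C" using C p01 n by (smt (verit) mult_nonneg_nonneg)
        ultimately show ?thesis
          by (simp add: stein_const_def removal_const_def incr_const_def)
      qed
      moreover have "x\<^sup>2 \<le> 1" using x by (simp add: power_le_one)
      ultimately show ?thesis
        using mult_left_le_one_le[of "stein_const K C / sqrt ?n" "x\<^sup>2"] by simp
    qed
    finally show "cmod (\<phi>' x + of_real (x * w) * \<phi> x) \<le> stein_const K C / sqrt ?n" .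
  qed
  then show ?thesis by (simp add: \<phi>_def W_def)
qed

section \<open>Limits of binomial moments for convergent np\<close>

lemma tendsto_shift_mult:
  fixes p :: "nat \<Rightarrow> real"
  assumes "(\<lambda>n. real n * p n) \<longlonglongrightarrow> c"
  shows "(\<lambda>n. real (n - a) * p n) \<longlonglongrightarrow> c" and "p \<longlonglongrightarrow> 0"
proof -
  have "(\<lambda>n. (real n * p n) * (1 / real n)) \<longlonglongrightarrow> c * 0"
    by (intro tendsto_mult assms lim_1_over_n)
  moreover have "\<forall>\<^sub>F n in sequentially. (real n * p n) * (1 / real n) = p n"
    using eventually_gt_at_top[of 0] by eventually_elim simp
  ultimately show p: "p \<longlonglongrightarrow> 0" using tendsto_cong by force
  have "(\<lambda>n. real n * p n - real a * p n) \<longlonglongrightarrow> c - real a * 0"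
    by (intro tendsto_diff tendsto_mult assms tendsto_const p)
  moreover have "\<forall>\<^sub>F n in sequentially. real n * p n - real a * p n = real (n - a) * p n"
    using eventually_ge_at_top[of a] by eventually_elim (simp add: of_nat_diff algebra_simps)
  ultimately show "(\<lambda>n. real (n - a) * p n) \<longlonglongrightarrow> c" using tendsto_cong by force
qed

text \<open>The limits are the means of \<open>X choose r\<close> for a Poisson variable X with mean
  c. The shift \<open>a\<close> covers n - 1 potential edges at a vertex as well as n - 2 after
  conditioning on one.\<close>

lemma choose_power_tendsto:
  fixes p :: "nat \<Rightarrow> real"
  assumes "(\<lambda>n. real n * p n) \<longlonglongrightarrow> c"
  shows "(\<lambda>n. real ((n - a) choose r) * p n ^ r) \<longlonglongrightarrow> c ^ r / fact r"
proof (induction r)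
  case (Suc r)
  have e: "real ((n - a) choose Suc r) * p n ^ Suc r =
      real ((n - a) choose r) * p n ^ r * (real (n - (a + r)) * p n) / real (Suc r)" for n
  proof -
    have "real ((n - a) choose Suc r) * p n ^ Suc r =
        (real (Suc r) * real ((n - a) choose Suc r)) * p n ^ Suc r / real (Suc r)" by simp
    also have "real (Suc r) * real ((n - a) choose Suc r) = real (n - a - r) * real ((n - a) choose r)"
      by (metis binomial_absorb_comp binomial_absorption of_nat_mult)
    finally show ?thesis by (simp add: mult_ac)
  qed
  have "(\<lambda>n. real ((n - a) choose r) * p n ^ r * (real (n - (a + r)) * p n) / real (Suc r))
     \<longlonglongrightarrow> c ^ r / fact r * c / real (Suc r)"
    by (intro tendsto_intros Suc.IH tendsto_shift_mult assms) auto
  then show ?case unfolding e by (simp add: field_simps)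
qed simp

lemma bin_ex_choose_mult:
  "bin_ex p N (\<lambda>x. real (x choose m) * real (x choose l)) =
    (\<Sum>s\<le>min m l. fact (m + l - s) / (fact s * fact (m - s) * fact (l - s)) *
      (real (N choose (m + l - s)) * p ^ (m + l - s)))"
  unfolding choose_mult_choose by (simp only: bin_ex_sum bin_ex_cmult bin_ex_choose)

lemma bin_ex_choose_diff:
  assumes "m \<ge> 1"
  shows "bin_ex p N (\<lambda>x. real (Suc x choose m) - real (x choose m)) = real (N choose (m - 1)) * p ^ (m - 1)"
  using assms bin_ex_choose[of p N "m - 1"] by (cases m) simp_all

text \<open>The product formula for binomial coefficients gives a sum from s = 0, and its s = 0 term
  cancels against the product of the means. The first term of \<open>sigma_star\<close> comes from
  the edges shared by different vertices.\<close>

lemma sigma_star_tendsto: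
  fixes p :: "nat \<Rightarrow> real"
  assumes c: "(\<lambda>n. real n * p n) \<longlonglongrightarrow> c" and m: "m \<ge> 1" and l: "l \<ge> 1"
  shows "(\<lambda>n. bin_ex (p n) (n - 1) (\<lambda>x. real (x choose m) * real (x choose l)) -
      bin_ex (p n) (n - 1) (\<lambda>x. real (x choose m)) * bin_ex (p n) (n - 1) (\<lambda>x. real (x choose l)) +
      (real n - 1) * p n * (1 - p n) *
        (bin_ex (p n) (n - 2) (\<lambda>x. real (Suc x choose m) - real (x choose m)) *
         bin_ex (p n) (n - 2) (\<lambda>x. real (Suc x choose l) - real (x choose l))))
    \<longlonglongrightarrow> sigma_star c m l"
proof -
  have p0: "p \<longlonglongrightarrow> 0" by (rule tendsto_shift_mult[OF c])
  have np: "(\<lambda>n. (real n - 1) * p n * (1 - p n)) \<longlonglongrightarrow> (c - 0) * (1 - 0)"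
  proof -
    have "(\<lambda>n. (real n * p n - p n) * (1 - p n)) \<longlonglongrightarrow> (c - 0) * (1 - 0)"
      by (intro tendsto_intros c p0)
    then show ?thesis by (simp add: algebra_simps)
  qed
  note lim = choose_power_tendsto[OF c]
  have "(\<lambda>n. bin_ex (p n) (n - 1) (\<lambda>x. real (x choose m) * real (x choose l)) -
      bin_ex (p n) (n - 1) (\<lambda>x. real (x choose m)) * bin_ex (p n) (n - 1) (\<lambda>x. real (x choose l)) +
      (real n - 1) * p n * (1 - p n) *
        (bin_ex (p n) (n - 2) (\<lambda>x. real (Suc x choose m) - real (x choose m)) *
         bin_ex (p n) (n - 2) (\<lambda>x. real (Suc x choose l) - real (x choose l))))
    \<longlonglongrightarrow> (\<Sum>s\<le>min m l. fact (m + l - s) / (fact s * fact (m - s) * fact (l - s)) * (c ^ (m + l - s) / fact (m + l - s)))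
     - c ^ m / fact m * (c ^ l / fact l) + (c - 0) * (1 - 0) * (c ^ (m - 1) / fact (m - 1) * (c ^ (l - 1) / fact (l - 1)))"
    unfolding bin_ex_choose_mult bin_ex_choose bin_ex_choose_diff[OF m] bin_ex_choose_diff[OF l]
    by (intro tendsto_add tendsto_diff tendsto_mult tendsto_sum tendsto_const np lim)
  also have "(\<Sum>s\<le>min m l. fact (m + l - s) / (fact s * fact (m - s) * fact (l - s)) * (c ^ (m + l - s) / fact (m + l - s))) =
      (\<Sum>s\<le>min m l. c ^ (m + l - s) / (fact s * fact (m - s) * fact (l - s)))"
    by (intro sum.cong refl) simp
  also have "\<dots> = c ^ (m + l) / (fact m * fact l) +
      (\<Sum>s=1..min m l. c ^ (m + l - s) / (fact s * fact (m - s) * fact (l - s)))"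
    by (simp add: sum.atLeast_Suc_atMost flip: atLeast0AtMost)
  also have "\<dots> - c ^ m / fact m * (c ^ l / fact l) +
       (c - 0) * (1 - 0) * (c ^ (m - 1) / fact (m - 1) * (c ^ (l - 1) / fact (l - 1))) = sigma_star c m l"
  proof -
    have "m + l - 1 = Suc ((m - 1) + (l - 1))" using m l by simp
    then have "c ^ (m + l - 1) = c * (c ^ (m - 1) * c ^ (l - 1))" by (simp only: power_Suc power_add)
    then show ?thesis by (simp add: sigma_star_def power_add)
  qed
  finally show ?thesis .
qed

section \<open>Convergence of characteristic functions in several dimensions\<close>

inductive trig_poly :: "('a::euclidean_space \<Rightarrow> complex) \<Rightarrow> bool" where
  exp: "trig_poly (\<lambda>x. c * iexp (t \<bullet> x))"
| add: "trig_poly f \<Longrightarrow> trig_poly g \<Longrightarrow> trig_poly (\<lambda>x. f x + g x)"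

lemma trig_poly_const: "trig_poly (\<lambda>x. c)"
  using trig_poly.exp[of c 0] by simp

lemma trig_poly_sum: "(\<And>i. i \<in> I \<Longrightarrow> trig_poly (f i)) \<Longrightarrow> trig_poly (\<lambda>x. \<Sum>i\<in>I. f i x)"
  by (induction I rule: infinite_finite_induct) (auto intro: trig_poly_const trig_poly.add)

lemma trig_poly_exp_mult: "trig_poly f \<Longrightarrow> trig_poly (\<lambda>x. c * iexp (t \<bullet> x) * f x)"
proof (induction rule: trig_poly.induct)
  case (exp d s)
  have "(\<lambda>x. c * iexp (t \<bullet> x) * (d * iexp (s \<bullet> x))) = (\<lambda>x. (c * d) * iexp ((t + s) \<bullet> x))"
    by (auto simp: inner_left_distrib algebra_simps exp_add)
  then show ?case using trig_poly.exp by metis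
next
  case (add f g)
  then show ?case using trig_poly.add by (fastforce simp: distrib_left)
qed

lemma trig_poly_mult: "trig_poly f \<Longrightarrow> trig_poly g \<Longrightarrow> trig_poly (\<lambda>x. f x * g x)"
proof (induction rule: trig_poly.induct)
  case (exp c t)
  then show ?case by (rule trig_poly_exp_mult)
next
  case (add f g')
  then show ?case using trig_poly.add by (fastforce simp: distrib_right)
qed

lemma trig_poly_sin: "trig_poly (\<lambda>x. of_real (sin (t \<bullet> x)))"
proof -
  have "of_real (sin y) = (1 / (2 * \<i>)) * iexp y + (- 1 / (2 * \<i>)) * iexp (- y)" for y :: real
    unfolding sin_of_real[symmetric] sin_exp_eq by (simp add: field_simps)
  from this[of "t \<bullet> _"] show ?thesis
    using trig_poly.add[OF trig_poly.exp[of "1 / (2 * \<i>)" t] trig_poly.exp[of "- 1 / (2 * \<i>)" "- t"]]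
    by simp
qed

text \<open>Trigonometric polynomials form an algebra containing the sines of the coordinates. This
  makes Stone-Weierstrass available for functions whose integrals are determined by characteristic
  functions.\<close>

lemma trig_poly_polynomial_sin:
  fixes P :: "'a::euclidean_space \<Rightarrow> real"
  assumes "real_polynomial_function P"
  shows "trig_poly (\<lambda>x. of_real (P (\<Sum>b\<in>Basis. sin (a * (x \<bullet> b)) *\<^sub>R b)))"
  using assms
proof (induction rule: real_polynomial_function.induct)
  case (linear f)
  interpret f: bounded_linear f by fact
  have "trig_poly (\<lambda>x. \<Sum>b\<in>Basis. of_real (f b) * of_real (sin ((a *\<^sub>R b) \<bullet> x)))"
    by (intro trig_poly_sum trig_poly_mult trig_poly_const trig_poly_sin)
  also have "(\<lambda>x. \<Sum>b\<in>Basis. of_real (f b) * of_real (sin ((a *\<^sub>R b) \<bullet> x))) =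
     (\<lambda>x. of_real (f (\<Sum>b\<in>Basis. sin (a * (x \<bullet> b)) *\<^sub>R b)))"
    by (auto simp: f.sum f.scaleR inner_commute mult.commute simp del: sin_of_real)
  finally show ?case .
next
  case (const c)
  show ?case by (rule trig_poly_const)
next
  case (add f g)
  then show ?case using trig_poly.add by (fastforce simp: distrib_right)
next
  case (mult f g)
  then show ?case using trig_poly_mult by fastforce
qed

lemma trig_poly_continuous: "trig_poly f \<Longrightarrow> continuous_on UNIV f"
  by (induction rule: trig_poly.induct) (auto intro!: continuous_intros)

lemma trig_poly_bounded: "trig_poly f \<Longrightarrow> \<exists>B. \<forall>x. cmod (f x) \<le> B"
proof (induction rule: trig_poly.induct)
  case (exp c t)
  show ?case by (rule exI[of _ "cmod c"]) (simp add: norm_mult)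
next
  case (add f g)
  then obtain A B where "\<And>x. cmod (f x) \<le> A" "\<And>x. cmod (g x) \<le> B" by auto
  then have "\<forall>x. cmod (f x + g x) \<le> A + B" by (meson add_mono norm_triangle_le)
  then show ?case by blast
qed

lemma integrable_bounded_continuous:
  fixes f :: "'a::euclidean_space \<Rightarrow> 'b::{banach, second_countable_topology}"
  assumes "prob_space M" "sets M = sets borel" "continuous_on UNIV f" "\<And>x. norm (f x) \<le> B"
  shows "integrable M f"
proof -
  interpret prob_space M by fact
  have "f \<in> borel_measurable borel" using assms(3) by (rule borel_measurable_continuous_onI)
  then have "f \<in> borel_measurable M" using assms(2) by (simp cong: measurable_cong_sets)
  then show ?thesis using assms(4) by (intro integrable_const_bound[of _ B]) auto
qed

lemma trig_poly_integral_tendsto: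
  fixes M :: "nat \<Rightarrow> 'a::euclidean_space measure"
  assumes M: "\<And>n. prob_space (M n)" "\<And>n. sets (M n) = sets borel"
    and N: "prob_space N" "sets N = sets borel"
    and char: "\<And>t. (\<lambda>n. CLINT x|M n. iexp (t \<bullet> x)) \<longlonglongrightarrow> (CLINT x|N. iexp (t \<bullet> x))"
    and f: "trig_poly f"
  shows "(\<lambda>n. CLINT x|M n. f x) \<longlonglongrightarrow> (CLINT x|N. f x)"
  using f
proof (induction rule: trig_poly.induct)
  case (exp c t)
  show ?case by (simp add: tendsto_mult_left[OF char])
next
  case (add f g)
  have int: "integrable Q f" "integrable Q g" if "prob_space Q" "sets Q = sets borel" for Q
    using add.hyps trig_poly_bounded integrable_bounded_continuous[OF that trig_poly_continuous] by metis+
  show ?case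
    using tendsto_add[OF add.IH] by (simp add: Bochner_Integration.integral_add int M N)
qed

section \<open>From characteristic functions and tightness to weak convergence\<close>

lemma integral_diff_outside_ball:
  fixes f q :: "'a::euclidean_space \<Rightarrow> real"
  assumes Q: "prob_space Q" "sets Q = sets borel"
    and f: "continuous_on UNIV f" "\<And>x. \<bar>f x\<bar> \<le> B" and q: "continuous_on UNIV q" "\<And>x. \<bar>q x\<bar> \<le> B + \<delta>"
    and near: "\<And>x. norm x \<le> L \<Longrightarrow> \<bar>f x - q x\<bar> \<le> \<delta>"
    and tail: "measure Q {x. norm x > L} \<le> \<delta>" and \<delta>: "0 \<le> \<delta>" "\<delta> \<le> 1"
  shows "\<bar>(\<integral>x. f x \<partial>Q) - (\<integral>x. q x \<partial>Q)\<bar> \<le> (2 * B + 2) * \<delta>"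
proof -
  interpret prob_space Q by fact
  have int: "integrable Q f" "integrable Q q"
    using integrable_bounded_continuous[OF Q f(1), of B] integrable_bounded_continuous[OF Q q(1), of "B + \<delta>"] f q
    by auto
  have B0: "0 \<le> B" using f(2)[of 0] by simp
  let ?A = "{x. norm x > L}"
  have A: "?A \<in> sets Q" unfolding Q(2) by measurable
  have "\<bar>(\<integral>x. f x \<partial>Q) - (\<integral>x. q x \<partial>Q)\<bar> = \<bar>\<integral>x. f x - q x \<partial>Q\<bar>"
    using int by simp
  also have "\<dots> \<le> (\<integral>x. \<bar>f x - q x\<bar> \<partial>Q)" by (rule integral_abs_bound)
  also have "\<dots> \<le> (\<integral>x. \<delta> + (2 * B + \<delta>) * indicator ?A x \<partial>Q)"
  proof (rule integral_mono)
    show "integrable Q (\<lambda>x. \<bar>f x - q x\<bar>)" using int by auto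
    show "integrable Q (\<lambda>x. \<delta> + (2 * B + \<delta>) * indicator ?A x)"
      using A by (intro Bochner_Integration.integrable_add integrable_const integrable_mult_right)
        (auto simp: emeasure_eq_measure)
    fix x
    \<comment> \<open>Inside the ball the error is \<delta>; outside, the crude bound 2 B + \<delta>
      is paid only with probability at most \<delta>.\<close>
    show "\<bar>f x - q x\<bar> \<le> \<delta> + (2 * B + \<delta>) * indicator ?A x"
      using near[of x] f(2)[of x] q(2)[of x] \<delta> by (cases "norm x \<le> L") auto
  qed
  also have "\<dots> = \<delta> + (2 * B + \<delta>) * measure Q ?A"
    using A by (subst Bochner_Integration.integral_add)
      (auto simp: prob_space emeasure_eq_measure intro!: integrable_mult_right)
  also have "\<dots> \<le> \<delta> + (2 * B + 1) * \<delta>"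
    using tail \<delta> B0 by (intro add_left_mono mult_mono) auto
  finally show ?thesis by (simp add: algebra_simps)
qed

lemma prob_tail_small:
  fixes Q :: "'a::euclidean_space measure"
  assumes Q: "prob_space Q" "sets Q = sets borel" and "e > 0"
  obtains L where "measure Q {x. norm x > L} \<le> e"
proof -
  interpret prob_space Q by fact
  have "(\<lambda>n. measure Q {x. norm x > real n}) \<longlonglongrightarrow> measure Q (\<Inter>n. {x. norm x > real n})"
  proof (rule finite_Lim_measure_decseq)
    show "range (\<lambda>n. {x. norm x > real n}) \<subseteq> sets Q" unfolding Q(2) by auto
    show "decseq (\<lambda>n. {x::'a. norm x > real n})" by (force simp: decseq_def)
  qed
  also have "(\<Inter>n. {x::'a. norm x > real n}) = {}"
  proof -
    have "x \<notin> (\<Inter>n. {x::'a. norm x > real n})" for x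
    proof -
      obtain n where "norm x < real n" using reals_Archimedean2 by blast
      then show ?thesis by (auto intro!: exI[of _ n])
    qed
    then show ?thesis by blast
  qed
  finally have "\<forall>\<^sub>F n in sequentially. measure Q {x. norm x > real n} < e"
    using order_tendstoD(2) \<open>e > 0\<close> by fastforce
  then obtain n where "measure Q {x. norm x > real n} < e"
    using eventually_happens'[OF sequentially_bot] by blast
  then show ?thesis using that[of "real n"] by simp
qed

text \<open>On the box \<open>\<bar>x \<bullet> b\<bar> \<le> L\<close> the map with coordinates \<open>sin (\<pi> (x \<bullet> b) / (2 L))\<close> is a
  homeomorphism onto the unit box, while on the whole space it takes values in the unit box. So a
  polynomial in these sines approximating \<open>f\<close> on the box stays bounded everywhere.\<close>

lemma trig_poly_approx:
  fixes f :: "'a::euclidean_space \<Rightarrow> real"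
  assumes f: "continuous_on UNIV f" "\<And>x. \<bar>f x\<bar> \<le> B" and L: "L > 0" and \<delta>: "\<delta> > 0"
  obtains q where "trig_poly (\<lambda>x. of_real (q x))" "\<And>x. \<bar>q x\<bar> \<le> B + \<delta>"
    "\<And>x. norm x \<le> L \<Longrightarrow> \<bar>f x - q x\<bar> \<le> \<delta>"
proof -
  define a where "a = pi / (2 * L)"
  have a: "a > 0" using L by (simp add: a_def)
  define s where "s x = (\<Sum>b\<in>Basis. sin (a * (x \<bullet> b)) *\<^sub>R b)" for x :: 'a
  \<comment> \<open>Inverse of \<open>s\<close> wherever \<open>a * (x \<bullet> b)\<close> stays
    within pi / 2; the choice of \<open>a\<close> ensures this for norm at most \<open>L\<close>.
    Stone-Weierstrass is applied to \<open>f \<circ> r\<close> on the unit box.\<close>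
  define r where "r y = (\<Sum>b\<in>Basis. (arcsin (y \<bullet> b) / a) *\<^sub>R b)" for y :: 'a
  let ?K = "cbox (- One) (One :: 'a)"
  have "continuous_on ?K r"
    unfolding r_def using a
    by (intro continuous_intros) (auto simp: mem_box inner_simps)
  then have "continuous_on ?K (f \<circ> r)"
    using f(1) by (intro continuous_on_compose) (auto intro: continuous_on_subset)
  then obtain P where P: "real_polynomial_function P" "\<And>y. y \<in> ?K \<Longrightarrow> \<bar>(f \<circ> r) y - P y\<bar> < \<delta>"
    using Stone_Weierstrass_real_polynomial_function[of ?K "f \<circ> r" \<delta>] \<delta> compact_cbox by metis
  have sK: "s x \<in> ?K" for x
    by (auto simp: s_def mem_box inner_simps)
  have rs: "r (s x) = x" if "norm x \<le> L" for x
  proof -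
    have "arcsin (sin (a * (x \<bullet> b))) = a * (x \<bullet> b)" if "b \<in> Basis" for b
    proof (rule arcsin_sin)
      have "\<bar>x \<bullet> b\<bar> \<le> L" using \<open>norm x \<le> L\<close> Basis_le_norm[OF that, of x] by linarith
      then have "\<bar>a * (x \<bullet> b)\<bar> \<le> a * L" using a by (simp add: abs_mult)
      then have "\<bar>a * (x \<bullet> b)\<bar> \<le> pi / 2" using L by (simp add: a_def)
      then show "- (pi / 2) \<le> a * (x \<bullet> b)" "a * (x \<bullet> b) \<le> pi / 2" by linarith+
    qed
    then have "r (s x) = (\<Sum>b\<in>Basis. (x \<bullet> b) *\<^sub>R b)"
      unfolding r_def s_def using a by (intro sum.cong) auto
    then show ?thesis by (simp add: euclidean_representation)
  qed
  show ?thesis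
  proof
    show "trig_poly (\<lambda>x. of_real (P (s x)))"
      unfolding s_def by (rule trig_poly_polynomial_sin[OF P(1)])
    show "\<bar>P (s x)\<bar> \<le> B + \<delta>" for x
      using P(2)[OF sK[of x]] f(2)[of "r (s x)"] by (simp add: o_def)
    show "\<bar>f x - P (s x)\<bar> \<le> \<delta>" if "norm x \<le> L" for x
      using P(2)[OF sK[of x]] rs[OF that] by (simp add: o_def)
  qed
qed

text \<open>Integrals of trigonometric polynomials converge by hypothesis. Tightness provides one
  ball, hence one approximating polynomial, that serves \<open>N\<close> and \<open>M n\<close> for
  all large n.\<close>

theorem weak_conv_vec_of_char:
  fixes M :: "nat \<Rightarrow> 'a::euclidean_space measure"
  assumes M: "\<And>n. prob_space (M n)" "\<And>n. sets (M n) = sets borel"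
    and N: "prob_space N" "sets N = sets borel"
    and char: "\<And>t. (\<lambda>n. CLINT x|M n. iexp (t \<bullet> x)) \<longlonglongrightarrow> (CLINT x|N. iexp (t \<bullet> x))"
    and tight: "\<And>e. e > 0 \<Longrightarrow> \<exists>L. \<forall>\<^sub>F n in sequentially. measure (M n) {x. norm x > L} \<le> e"
  shows "weak_conv_vec M N"
  unfolding weak_conv_vec_def
proof (intro allI impI)
  fix f :: "'a \<Rightarrow> real"
  assume f: "continuous_on UNIV f" and "bounded (range f)"
  then obtain B where B: "\<And>x. \<bar>f x\<bar> \<le> B" by (auto simp: bounded_iff)
  then have B0: "0 \<le> B" by (meson abs_ge_zero order_trans)
  show "(\<lambda>n. \<integral>x. f x \<partial>M n) \<longlonglongrightarrow> (\<integral>x. f x \<partial>N)"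
  proof (rule tendstoI)
    fix e :: real assume e: "e > 0"
    \<comment> \<open>Three errors of at most e / 4 are added: replacing f by q under
      \<open>M n\<close>, the convergence for q, and replacing q by f under
      \<open>N\<close>.\<close>
    define \<delta> where "\<delta> = min 1 (e / (4 * (2 * B + 2)))"
    have \<delta>: "0 < \<delta>" "\<delta> \<le> 1" using e B0 by (auto simp: \<delta>_def)
    have "(2 * B + 2) * \<delta> \<le> (2 * B + 2) * (e / (4 * (2 * B + 2)))"
      using B0 by (intro mult_left_mono) (auto simp: \<delta>_def)
    also have "\<dots> = e / 4" using B0 by (simp add: field_simps)
    finally have \<delta>e: "(2 * B + 2) * \<delta> \<le> e / 4" .
    obtain L1 where L1: "\<forall>\<^sub>F n in sequentially. measure (M n) {x. norm x > L1} \<le> \<delta>"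
      using tight[OF \<delta>(1)] by blast
    obtain L2 where L2: "measure N {x. norm x > L2} \<le> \<delta>"
      using prob_tail_small[OF N \<delta>(1)] .
    define L where "L = max 1 (max L1 L2)"
    have L0: "L > 0" by (simp add: L_def)
    have mono: "measure Q {x. norm x > L} \<le> \<delta>"
      if "measure Q {x. norm x > K} \<le> \<delta>" "K \<le> L" "prob_space Q" "sets Q = sets borel" for K and Q :: "'a measure"
    proof -
      interpret prob_space Q by fact
      have "{x. norm x > K} \<in> sets Q" unfolding that(4) by measurable
      then have "measure Q {x. norm x > L} \<le> measure Q {x. norm x > K}"
        using that(2) by (intro finite_measure_mono) auto
      then show ?thesis using that(1) by linarith
    qed
    obtain q where q: "trig_poly (\<lambda>x. of_real (q x))" "\<And>x. \<bar>q x\<bar> \<le> B + \<delta>"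
      "\<And>x. norm x \<le> L \<Longrightarrow> \<bar>f x - q x\<bar> \<le> \<delta>"
      using trig_poly_approx[OF f B L0 \<delta>(1)] by blast
    have qc: "continuous_on UNIV q"
      using continuous_on_Re[OF trig_poly_continuous[OF q(1)]] by simp
    have "(\<lambda>n. CLINT x|M n. of_real (q x)) \<longlonglongrightarrow> (CLINT x|N. of_real (q x))"
      by (rule trig_poly_integral_tendsto[OF M N char q(1)])
    then have "(\<lambda>n. \<integral>x. q x \<partial>M n) \<longlonglongrightarrow> (\<integral>x. q x \<partial>N)"
      by (simp add: tendsto_of_real_iff)
    then have "\<forall>\<^sub>F n in sequentially. dist (\<integral>x. q x \<partial>M n) (\<integral>x. q x \<partial>N) < e / 4"
      using e by (intro tendstoD) auto
    with L1 show "\<forall>\<^sub>F n in sequentially. dist (\<integral>x. f x \<partial>M n) (\<integral>x. f x \<partial>N) < e"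
    proof eventually_elim
      case (elim n)
      have "\<bar>(\<integral>x. f x \<partial>M n) - (\<integral>x. q x \<partial>M n)\<bar> \<le> (2 * B + 2) * \<delta>"
        using mono[OF elim(1) _ M] \<delta>
        by (intro integral_diff_outside_ball[OF M f B qc q(2) q(3)]) (auto simp: L_def)
      moreover have "\<bar>(\<integral>x. f x \<partial>N) - (\<integral>x. q x \<partial>N)\<bar> \<le> (2 * B + 2) * \<delta>"
        using mono[OF L2 _ N] \<delta>
        by (intro integral_diff_outside_ball[OF N f B qc q(2) q(3)]) (auto simp: L_def)
      ultimately show ?case using elim(2) \<delta>e e unfolding dist_real_def by linarith
    qed
  qed
qed

section \<open>Normal limits of star counts\<close>

text \<open>Image under \<open>B\<close> of a vector of independent standard normal variables.
  Starting from a factorisation of the covariance treats singular and regular matrices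
  alike.\<close>

lemma mv_normal_exists:
  fixes B :: "real ^ 'j ^ 'k"
  shows "\<exists>N. mv_normal N 0 (B ** transpose B)"
proof -
  interpret P: product_prob_space "\<lambda>_::'j. std_normal_distribution" UNIV
    by (intro product_prob_spaceI real_distribution.axioms(1) real_dist_normal_dist)
  define P where "P = (\<Pi>\<^sub>M j\<in>(UNIV::'j set). std_normal_distribution)"
  define Y where "Y f = B *v (\<chi> j. f j)" for f :: "'j \<Rightarrow> real"
  \<comment> \<open>Written as a combination of the columns of \<open>B\<close>, the map is visibly
    measurable.\<close>
  have "(\<lambda>f. \<Sum>j\<in>UNIV. f j *\<^sub>R column j B) \<in> borel_measurable P"
    unfolding P_def by measurable
  also have "(\<lambda>f. \<Sum>j\<in>UNIV. f j *\<^sub>R column j B) = Y"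
    by (auto simp: Y_def matrix_mult_sum scalar_mult_eq_scaleR)
  finally have Y: "Y \<in> borel_measurable P" .
  define N where "N = distr P borel Y"
  have "prob_space P" unfolding P_def by (rule P.prob_space_axioms)
  then have "prob_space N" unfolding N_def using Y by (rule prob_space.prob_space_distr)
  moreover have "(CLINT x|N. iexp (t \<bullet> x)) = exp (\<i> * of_real (t \<bullet> 0) - of_real (t \<bullet> ((B ** transpose B) *v t)) / 2)" for t
  proof -
    define u where "u = transpose B *v t"
    have Bu: "t \<bullet> Y f = (\<Sum>j\<in>UNIV. u $ j * f j)" for f
    proof -
      have "t \<bullet> Y f = u \<bullet> (\<chi> j. f j)"
        unfolding Y_def u_def by (simp add: dot_lmul_matrix)
      then show ?thesis by (simp add: inner_vec_def)
    qed
    have "(CLINT x|N. iexp (t \<bullet> x)) = (CLINT f|P. iexp (t \<bullet> Y f))"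
      unfolding N_def by (rule integral_distr[OF Y]) measurable
    also have "\<dots> = (CLINT f|P. (\<Prod>j\<in>UNIV. iexp (u $ j * f j)))"
      unfolding Bu by (simp add: exp_sum sum_distrib_left)
    also have "\<dots> = (\<Prod>j\<in>UNIV. CLINT x|std_normal_distribution. iexp (u $ j * x))"
      unfolding P_def
    proof (rule P.product_integral_prod)
      fix j :: 'j
      have "finite_measure std_normal_distribution"
        by (intro prob_space.finite_measure real_distribution.axioms(1) real_dist_normal_dist)
      then
      show "integrable std_normal_distribution (\<lambda>x. iexp (u $ j * x))"
        by (rule finite_measure.integrable_const_bound[of _ _ 1]) auto
    qed simp
    also have "\<dots> = (\<Prod>j\<in>UNIV. of_real (exp (- (u $ j)\<^sup>2 / 2)))"
      using char_std_normal_distribution by (simp add: char_def fun_eq_iff)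
    also have "\<dots> = of_real (exp (- (u \<bullet> u) / 2))"
      by (simp add: inner_vec_def power2_eq_square exp_sum sum_divide_distrib flip: of_real_prod sum_negf)
    also have "u \<bullet> u = t \<bullet> ((B ** transpose B) *v t)"
      unfolding u_def by (simp add: dot_lmul_matrix flip: matrix_vector_mul_assoc)
    finally show ?thesis by (simp flip: exp_of_real)
  qed
  ultimately have "mv_normal N 0 (B ** transpose B)"
    unfolding mv_normal_def by (simp add: N_def)
  then show ?thesis by blast
qed

lemma all_edges_eq: "all_edges n = edges {1..n}"
  by (simp add: all_edges_def edges_def)

lemma expectation_Gnp:
  fixes F :: "nat set set \<Rightarrow> 'b::{banach, second_countable_topology}"
  assumes "0 \<le> p" "p \<le> 1"
  shows "measure_pmf.expectation (Gnp n p) F = expect p (edges {1..n}) F"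
  using expect_pmf[of "edges {1..n}" p F] assms by (simp add: Gnp_def all_edges_eq)

text \<open>Bounded second moments of the coordinates give tightness by Chebyshev's inequality, so
  only \<open>expect\<close> has to be controlled from here on. The factor \<open>B\<close> serves
  only to construct the limit law.\<close>

lemma tends_in_distr_normalI:
  fixes X :: "nat \<Rightarrow> nat set set \<Rightarrow> real ^ 'k" and B :: "real ^ 'j ^ 'k"
  assumes p: "\<And>n. n \<ge> 1 \<Longrightarrow> 0 \<le> p n \<and> p n \<le> 1"
    and \<Sigma>: "\<Sigma> = B ** transpose B"
    and char: "\<And>t. (\<lambda>n. expect (p n) (edges {1..n}) (\<lambda>E. iexp (t \<bullet> X n E)))
      \<longlonglongrightarrow> of_real (exp (- (t \<bullet> (\<Sigma> *v t)) / 2))"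
    and mom: "\<forall>\<^sub>F n in sequentially. \<forall>i. expect (p n) (edges {1..n}) (\<lambda>E. (X n E $ i)\<^sup>2) \<le> C"
  shows "tends_in_distr_normal p X 0 \<Sigma>"
proof -
  obtain N where N: "mv_normal N 0 \<Sigma>" using mv_normal_exists[of B] \<Sigma> by blast
  then have N': "prob_space N" "sets N = sets borel"
    "\<And>t. (CLINT x|N. iexp (t \<bullet> x)) = of_real (exp (- (t \<bullet> (\<Sigma> *v t)) / 2))"
    by (auto simp: mv_normal_def simp flip: exp_of_real)
  define M where "M n = distr (measure_pmf (Gnp n (p n))) borel (X n)" for n
  have M: "prob_space (M n)" "sets (M n) = sets borel" for n
    unfolding M_def by (auto intro: measure_pmf.prob_space_distr)
  have "weak_conv_vec M N"
  proof (rule weak_conv_vec_of_char[OF M N'(1,2)])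
    fix t :: "real ^ 'k"
    have "\<forall>\<^sub>F n in sequentially. expect (p n) (edges {1..n}) (\<lambda>E. iexp (t \<bullet> X n E)) = (CLINT x|M n. iexp (t \<bullet> x))"
      using eventually_ge_at_top[of 1]
    proof eventually_elim
      case (elim n)
      have "(CLINT x|M n. iexp (t \<bullet> x)) = measure_pmf.expectation (Gnp n (p n)) (\<lambda>E. iexp (t \<bullet> X n E))"
        unfolding M_def by (rule integral_distr) auto
      then show ?case
        unfolding expectation_Gnp[OF p[OF elim, THEN conjunct1] p[OF elim, THEN conjunct2]] ..
    qed
    then show "(\<lambda>n. CLINT x|M n. iexp (t \<bullet> x)) \<longlonglongrightarrow> (CLINT x|N. iexp (t \<bullet> x))"
      using char[of t] tendsto_cong unfolding N'(3) by fastforce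
  next
    fix e :: real assume e: "e > 0"
    define D where "D = real CARD('k) * \<bar>C\<bar>"
    \<comment> \<open>Chosen so that D / L^2 \<le> e; the additional 1 keeps \<open>L\<close>
      positive when D = 0.\<close>
    define L where "L = sqrt (D / e) + 1"
    have L: "L > 0" "D \<le> e * L\<^sup>2"
    proof -
      have D0: "0 \<le> D" by (simp add: D_def)
      then show "L > 0" using e by (simp add: L_def add_nonneg_pos)
      have "D / e = (sqrt (D / e))\<^sup>2" using D0 e by simp
      also have "\<dots> \<le> L\<^sup>2" unfolding L_def using D0 e by (intro power_mono) auto
      finally show "D \<le> e * L\<^sup>2" using e by (simp add: field_simps)
    qed
    have "\<forall>\<^sub>F n in sequentially. measure (M n) {x. norm x > L} \<le> e"
      using mom eventually_ge_at_top[of 1]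
    proof eventually_elim
      case (elim n)
      note pn = p[OF elim(2), THEN conjunct1] p[OF elim(2), THEN conjunct2]
      let ?A = "{x::real ^ 'k. norm x > L}"
      have "?A \<in> sets borel" by measurable
      then have "measure (M n) ?A = measure_pmf.prob (Gnp n (p n)) (X n -` ?A)"
        unfolding M_def by (subst measure_distr) auto
      also have "\<dots> = measure_pmf.expectation (Gnp n (p n)) (indicator (X n -` ?A))"
        by simp
      also have "\<dots> = expect (p n) (edges {1..n}) (indicator (X n -` ?A))"
        using pn by (rule expectation_Gnp)
      also have "\<dots> \<le> expect (p n) (edges {1..n}) (\<lambda>E. (\<Sum>i\<in>UNIV. (X n E $ i)\<^sup>2) * (1 / L\<^sup>2))"
      proof (rule expect_mono[OF pn])
        fix E
        have *: "(\<Sum>i\<in>UNIV. (X n E $ i)\<^sup>2) = (norm (X n E))\<^sup>2"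
          by (simp add: norm_vec_def L2_set_def sum_nonneg)
        show "indicator (X n -` ?A) E \<le> (\<Sum>i\<in>UNIV. (X n E $ i)\<^sup>2) * (1 / L\<^sup>2)"
          unfolding * using L by (auto simp: indicator_def intro!: power_mono)
      qed
      also have "\<dots> = (\<Sum>i\<in>UNIV. expect (p n) (edges {1..n}) (\<lambda>E. (X n E $ i)\<^sup>2)) * (1 / L\<^sup>2)"
        by (simp only: expect_multc expect_sum)
      also have "\<dots> \<le> D * (1 / L\<^sup>2)"
      proof (rule mult_right_mono)
        have "(\<Sum>i\<in>UNIV. expect (p n) (edges {1..n}) (\<lambda>E. (X n E $ i)\<^sup>2)) \<le> (\<Sum>i\<in>(UNIV::'k set). \<bar>C\<bar>)"
          using elim(1) by (intro sum_mono) (meson abs_ge_self order_trans)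
        then show "(\<Sum>i\<in>UNIV. expect (p n) (edges {1..n}) (\<lambda>E. (X n E $ i)\<^sup>2)) \<le> D"
          by (simp add: D_def)
      qed simp
      also have "\<dots> \<le> e" using L by (simp add: field_simps)
      finally show ?case .
    qed
    then show "\<exists>L. \<forall>\<^sub>F n in sequentially. measure (M n) {x. norm x > L} \<le> e" by blast
  qed
  then show ?thesis using N unfolding tends_in_distr_normal_def M_def by blast
qed

section \<open>Star counts as sums over degrees\<close>

lemma prod_of_bool: "finite J \<Longrightarrow> (\<Prod>j\<in>J. of_bool (P j)) = (of_bool (\<forall>j\<in>J. P j) :: real)"
  by (induction J rule: finite_induct) auto

text \<open>A star with m leaves centred at i is an m-subset of the neighbourhood \<open>A\<close>
  of i. Since members of \<open>edges\<close> have two elements, i itself is not in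
  \<open>A\<close>, so \<open>A\<close> has as many elements as there are edges at i.\<close>

lemma stars_eq_deg_sum:
  assumes "E \<subseteq> edges {1..n}"
  shows "stars (Suc m) n E = deg_sum {1..n} (\<lambda>d. real (d choose m)) E"
  unfolding stars_def deg_sum_def
proof (rule sum.cong[OF refl])
  fix i assume i: "i \<in> {1..n}"
  define A where "A = {j \<in> {1..n}. {i, j} \<in> E}"
  have fA: "finite A" by (simp add: A_def)
  have ni: "i \<notin> A" using assms by (auto simp: A_def edges_def)
  have "(\<Sum>J | J \<subseteq> {1..n} \<and> card J = Suc m - 1. \<Prod>j\<in>J. adj E i j) =
      (\<Sum>J | J \<subseteq> {1..n} \<and> card J = m. of_bool (J \<subseteq> A))"
  proof (rule sum.cong)
    fix J assume "J \<in> {J. J \<subseteq> {1..n} \<and> card J = m}"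
    then have J: "J \<subseteq> {1..n}" "finite J" by (auto intro: finite_subset)
    have "(\<Prod>j\<in>J. adj E i j) = of_bool (\<forall>j\<in>J. {i, j} \<in> E)"
      unfolding adj_def by (rule prod_of_bool[OF J(2)])
    also have "(\<forall>j\<in>J. {i, j} \<in> E) \<longleftrightarrow> J \<subseteq> A" using J by (auto simp: A_def)
    finally show "(\<Prod>j\<in>J. adj E i j) = of_bool (J \<subseteq> A)" .
  qed simp
  also have "\<dots> = (\<Sum>J | J \<subseteq> A \<and> card J = m. 1)"
    by (rule sum.mono_neutral_cong_right) (auto simp: A_def)
  also have "\<dots> = real (card A choose m)"
    using n_subsets[OF fA, of m] by simp
  also have "card A = deg E i"
  proof -
    have "{e \<in> E. i \<in> e} = (\<lambda>j. {i, j}) ` A"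
    proof (intro equalityI subsetI)
      fix e assume e: "e \<in> {e \<in> E. i \<in> e}"
      then have "e \<subseteq> {1..n}" "card e = 2" using assms by (auto simp: edges_def)
      then obtain j where "e = {i, j}" using e by (auto simp: card_2_iff)
      then show "e \<in> (\<lambda>j. {i, j}) ` A" using e \<open>e \<subseteq> {1..n}\<close> by (auto simp: A_def)
    qed (auto simp: A_def)
    moreover have "card ((\<lambda>j. {i, j}) ` A) = card A"
      using ni by (intro card_image) (auto simp: inj_on_def doubleton_eq_iff)
    ultimately show ?thesis by (simp add: deg_def)
  qed
  finally show "(\<Sum>J | J \<subseteq> {1..n} \<and> card J = Suc m - 1. \<Prod>j\<in>J. adj E i j) = real (deg E i choose m)" .
qed

lemma expect_deg_sum:
  assumes "finite V"
  shows "expect p (edges V) (deg_sum V h) = real (card V) * bin_ex p (card V - 1) h"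
proof -
  have "expect p (edges V) (deg_sum V h) = (\<Sum>i\<in>V. expect p (edges V) (\<lambda>E. h (deg E i)))"
    unfolding deg_sum_def[abs_def] by (rule expect_sum)
  also have "\<dots> = (\<Sum>i\<in>V. bin_ex p (card V - 1) h)"
    by (intro sum.cong refl expect_deg assms)
  finally show ?thesis by simp
qed

lemma deg_sum_centered:
  "deg_sum V h E - real (card V) * \<mu> = deg_sum V (\<lambda>d. h d - \<mu>) E"
  by (simp add: deg_sum_def sum_subtractf)

lemma centered_stars_eq:
  assumes "0 \<le> p" "p \<le> 1" "E \<subseteq> edges {1..n}"
  shows "centered_stars (Suc m) n p E = deg_sum {1..n} (\<lambda>d. real (d choose m)) E -
    real n * bin_ex p (n - 1) (\<lambda>d. real (d choose m))"
proof -
  have "expect p (edges {1..n}) (stars (Suc m) n) = expect p (edges {1..n}) (deg_sum {1..n} (\<lambda>d. real (d choose m)))"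
    by (intro expect_cong refl stars_eq_deg_sum)
  then show ?thesis
    using expect_deg_sum[of "{1..n}" p "\<lambda>d. real (d choose m)"] assms
    by (simp add: centered_stars_def stars_eq_deg_sum expectation_Gnp)
qed

lemma choose_le_pow2: "real (d choose m) \<le> 2 ^ d"
proof (cases "m \<le> d")
  case True
  then have "d choose m \<le> (\<Sum>k\<le>d. d choose k)" by (intro member_le_sum) auto
  then show ?thesis by (simp add: choose_row_sum)
qed (simp add: binomial_eq_0)

text \<open>Cramer-Wold: a linear combination of star counts is again a degree sum, with
  \<open>h\<close> the combination of binomial coefficients. Its variance \<open>w n\<close> is a
  quadratic form in \<open>t\<close> whose coefficients converge to
  \<open>sigma_star\<close>.\<close>

lemma stars_char_tendsto:
  fixes p t :: "_ \<Rightarrow> real" and I :: "'i set"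
  assumes p: "\<And>n. n \<ge> 1 \<Longrightarrow> 0 < p n \<and> p n < 1" and c: "(\<lambda>n. real n * p n) \<longlonglongrightarrow> c"
    and I: "finite I" "\<And>i. i \<in> I \<Longrightarrow> m i \<ge> 1"
  shows "(\<lambda>n. expect (p n) (edges {1..n})
      (\<lambda>E. iexp (1 / sqrt (real n) * (\<Sum>i\<in>I. t i * centered_stars (m i + 1) n (p n) E))))
    \<longlonglongrightarrow> of_real (exp (- (\<Sum>i\<in>I. \<Sum>j\<in>I. t i * t j * sigma_star c (m i) (m j)) / 2))"
proof -
  define h where "h d = (\<Sum>i\<in>I. t i * real (d choose m i))" for d
  define K where "K = (\<Sum>i\<in>I. \<bar>t i\<bar>)"
  have hK: "\<bar>h d\<bar> \<le> K * 2 ^ d" for d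
    unfolding h_def K_def sum_distrib_right
    by (rule order_trans[OF sum_abs]) (intro sum_mono, simp add: abs_mult mult_left_mono[OF choose_le_pow2])
  define \<mu> where "\<mu> n = bin_ex (p n) (n - 1) h" for n
  define w where "w n = bin_ex (p n) (n - 1) (\<lambda>x. (h x)\<^sup>2) - (\<mu> n)\<^sup>2 +
      (real n - 1) * p n * (1 - p n) * (bin_ex (p n) (n - 2) (\<lambda>x. h (Suc x) - h x))\<^sup>2" for n
  define \<phi> where "\<phi> n = expect (p n) (edges {1..n})
      (\<lambda>E. iexp (1 / sqrt (real n) * (\<Sum>i\<in>I. t i * centered_stars (m i + 1) n (p n) E)))" for n
  have \<phi>_eq: "\<phi> n = expect (p n) (edges {1..n}) (\<lambda>E. iexp ((deg_sum {1..n} h E - real n * \<mu> n) / sqrt (real n)))"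
    if "n \<ge> 1" for n
    unfolding \<phi>_def
  proof (intro expect_cong refl)
    fix E assume E: "E \<subseteq> edges {1..n}"
    have "deg_sum {1..n} h E = (\<Sum>i\<in>I. t i * deg_sum {1..n} (\<lambda>d. real (d choose m i)) E)"
      unfolding deg_sum_def h_def sum_distrib_left by (rule sum.swap)
    moreover have "\<mu> n = (\<Sum>i\<in>I. t i * bin_ex (p n) (n - 1) (\<lambda>d. real (d choose m i)))"
      unfolding \<mu>_def h_def[abs_def] by (simp only: bin_ex_sum bin_ex_cmult)
    ultimately have "(\<Sum>i\<in>I. t i * centered_stars (m i + 1) n (p n) E) = deg_sum {1..n} h E - real n * \<mu> n"
      using p[OF that] E by (simp add: centered_stars_eq sum_subtractf sum_distrib_left algebra_simps)
    then show "iexp (1 / sqrt (real n) * (\<Sum>i\<in>I. t i * centered_stars (m i + 1) n (p n) E)) =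
        iexp ((deg_sum {1..n} h E - real n * \<mu> n) / sqrt (real n))" by simp
  qed
  have bound: "\<forall>\<^sub>F n in sequentially. cmod (\<phi> n - of_real (exp (- w n / 2))) \<le> stein_const K (c + 1) / sqrt (real n)"
  proof -
    \<comment> \<open>Convergence of np yields the uniform bound needed for the error constant, from
      some n on.\<close>
    have "\<forall>\<^sub>F n in sequentially. real n * p n < c + 1" using c by (rule order_tendstoD) simp
    then show ?thesis using eventually_ge_at_top[of 1]
    proof eventually_elim
      case (elim n)
      then show ?case
        using deg_sum_char_bound[of "p n" "{1..n}" "c + 1" h K] p[of n] hK
        unfolding \<phi>_eq[OF elim(2)] w_def \<mu>_def by simp
    qed
  qed
  have "(\<lambda>n. \<phi> n - of_real (exp (- w n / 2))) \<longlonglongrightarrow> 0"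
  proof (rule Lim_null_comparison[OF bound])
    have "(\<lambda>n. stein_const K (c + 1) * (1 / sqrt (real n))) \<longlonglongrightarrow> stein_const K (c + 1) * 0"
      by (intro tendsto_mult tendsto_const) real_asymp
    then show "(\<lambda>n. stein_const K (c + 1) / sqrt (real n)) \<longlonglongrightarrow> 0" by simp
  qed
  moreover have "w \<longlonglongrightarrow> (\<Sum>i\<in>I. \<Sum>j\<in>I. t i * t j * sigma_star c (m i) (m j))"
  proof -
    let ?C = "\<lambda>i x. real (x choose m i)"
    let ?D = "\<lambda>i x. real (Suc x choose m i) - real (x choose m i)"
    have "w n = (\<Sum>i\<in>I. \<Sum>j\<in>I. t i * t j *
       (bin_ex (p n) (n - 1) (\<lambda>x. ?C i x * ?C j x) - bin_ex (p n) (n - 1) (?C i) * bin_ex (p n) (n - 1) (?C j) +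
        (real n - 1) * p n * (1 - p n) * (bin_ex (p n) (n - 2) (?D i) * bin_ex (p n) (n - 2) (?D j))))" for n
    proof -
      have 1: "bin_ex (p n) (n - 1) (\<lambda>x. (h x)\<^sup>2) = (\<Sum>i\<in>I. \<Sum>j\<in>I. t i * t j * bin_ex (p n) (n - 1) (\<lambda>x. ?C i x * ?C j x))"
      proof -
        have "(\<lambda>x. (h x)\<^sup>2) = (\<lambda>x. \<Sum>i\<in>I. \<Sum>j\<in>I. (t i * t j) * (?C i x * ?C j x))"
          by (auto simp: h_def power2_eq_square sum_product mult_ac)
        then show ?thesis by (simp only: bin_ex_sum bin_ex_cmult)
      qed
      have 2: "\<mu> n = (\<Sum>i\<in>I. t i * bin_ex (p n) (n - 1) (?C i))"
        unfolding \<mu>_def h_def[abs_def] by (simp only: bin_ex_sum bin_ex_cmult)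
      have 3: "bin_ex (p n) (n - 2) (\<lambda>x. h (Suc x) - h x) = (\<Sum>i\<in>I. t i * bin_ex (p n) (n - 2) (?D i))"
      proof -
        have "(\<lambda>x. h (Suc x) - h x) = (\<lambda>x. \<Sum>i\<in>I. t i * ?D i x)"
          by (auto simp: h_def right_diff_distrib sum_subtractf)
        then show ?thesis by (simp only: bin_ex_sum bin_ex_cmult)
      qed
      show ?thesis
        unfolding w_def 1 2 3 unfolding power2_eq_square sum_product
        by (simp add: sum_distrib_left algebra_simps sum.distrib sum_subtractf)
    qed
    note w_eq = this
    show ?thesis
      by (subst tendsto_cong[OF always_eventually[OF allI[OF w_eq]]]) (intro tendsto_sum tendsto_mult tendsto_const sigma_star_tendsto c I)
  qed
  then have "(\<lambda>n. of_real (exp (- w n / 2))) \<longlonglongrightarrow> (of_real (exp (- (\<Sum>i\<in>I. \<Sum>j\<in>I. t i * t j * sigma_star c (m i) (m j)) / 2)) :: complex)"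
    by (intro tendsto_intros) auto
  ultimately show ?thesis
    unfolding \<phi>_def[symmetric] using tendsto_add by fastforce
qed

text \<open>The variance is put into the shape of \<open>sigma_star_tendsto\<close>, so the second
  moment bound for tightness follows from a limit already known.\<close>

lemma centered_stars_moment:
  assumes p: "0 < p" "p < 1" and n: "n \<ge> 1"
  shows "expect p (edges {1..n}) (\<lambda>E. (centered_stars (m + 1) n p E)\<^sup>2) =
    real n * (bin_ex p (n - 1) (\<lambda>x. real (x choose m) * real (x choose m)) -
      bin_ex p (n - 1) (\<lambda>x. real (x choose m)) * bin_ex p (n - 1) (\<lambda>x. real (x choose m)) +
      (real n - 1) * p * (1 - p) *
        (bin_ex p (n - 2) (\<lambda>x. real (Suc x choose m) - real (x choose m)) *
         bin_ex p (n - 2) (\<lambda>x. real (Suc x choose m) - real (x choose m))))"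
proof -
  let ?\<mu> = "bin_ex p (n - 1) (\<lambda>x. real (x choose m))"
  let ?f = "\<lambda>x. real (x choose m) - ?\<mu>"
  have "expect p (edges {1..n}) (\<lambda>E. (centered_stars (m + 1) n p E)\<^sup>2) =
     expect p (edges {1..n}) (\<lambda>E. (deg_sum {1..n} ?f E)\<^sup>2)"
    using p by (intro expect_cong refl) (simp add: centered_stars_eq flip: deg_sum_centered)
  also have "\<dots> = real n * (bin_ex p (n - 1) (\<lambda>x. (?f x)\<^sup>2) +
      (real n - 1) * p * (1 - p) * (bin_ex p (n - 2) (\<lambda>x. ?f (Suc x) - ?f x))\<^sup>2)"
    using expect_deg_sum_power2[of "{1..n}" p ?f] by (simp add: bin_ex_diff)
  finally show ?thesis unfolding bin_ex_variance by (simp add: power2_eq_square)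
qed

section \<open>The dense regime\<close>

text \<open>The square expands into powers of np with exponents between r and 2 r; as np \<ge> 1,
  all are dominated by the highest one.\<close>

lemma bin_ex_choose_power2_le:
  assumes p: "0 \<le> p" and N: "N \<le> n" and np: "1 \<le> real n * p"
  shows "bin_ex p N (\<lambda>x. (real (x choose r))\<^sup>2) \<le>
    (\<Sum>s\<le>r. fact (2 * r - s) / (fact s * (fact (r - s))\<^sup>2)) * (real n * p) ^ (2 * r)"
proof -
  have le: "real (N choose j) * p ^ j \<le> (real n * p) ^ (2 * r)" if "j \<le> 2 * r" for j
  proof -
    have "real (N choose j) \<le> real n ^ j"
    proof (cases "j \<le> N")
      case True
      then have "N choose j \<le> N ^ j" by (rule binomial_le_pow)
      also have "\<dots> \<le> n ^ j" using N by (rule power_mono) simp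
      finally show ?thesis by (metis of_nat_le_iff of_nat_power)
    qed (simp add: binomial_eq_0)
    then have "real (N choose j) * p ^ j \<le> (real n * p) ^ j"
      unfolding power_mult_distrib using p by (intro mult_right_mono) auto
    also have "\<dots> \<le> (real n * p) ^ (2 * r)" using np that by (rule power_increasing[rotated])
    finally show ?thesis .
  qed
  have "bin_ex p N (\<lambda>x. (real (x choose r))\<^sup>2) =
      (\<Sum>s\<le>r. fact (2 * r - s) / (fact s * (fact (r - s))\<^sup>2) * (real (N choose (2 * r - s)) * p ^ (2 * r - s)))"
    using bin_ex_choose_mult[of p N r r] by (simp add: power2_eq_square mult_2 mult.assoc)
  also have "\<dots> \<le> (\<Sum>s\<le>r. fact (2 * r - s) / (fact s * (fact (r - s))\<^sup>2) * (real n * p) ^ (2 * r))"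
    by (intro sum_mono mult_left_mono le) auto
  finally show ?thesis by (simp add: sum_distrib_right)
qed

text \<open>The slope is the mean increment of \<open>d choose m\<close> over n - 2 trials. With
  this choice both the residual and its increment are centred.\<close>

definition star_resid :: "real \<Rightarrow> nat \<Rightarrow> nat \<Rightarrow> nat \<Rightarrow> real" where
  "star_resid p n m d = real (d choose m) - bin_ex p (n - 1) (\<lambda>d. real (d choose m)) -
     real ((n - 2) choose (m - 1)) * p ^ (m - 1) * (real d - real (n - 1) * p)"

lemma bin_ex_id: "bin_ex p N real = real N * p"
  using bin_ex_choose[of p N 1] by simp

lemma star_resid_centered:
  "bin_ex p (n - 1) (star_resid p n m) = 0"
  unfolding star_resid_def[abs_def] bin_ex_diff bin_ex_cmult bin_ex_const
  by (simp add: bin_ex_id)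

lemma star_resid_diff:
  "star_resid p n m (Suc x) - star_resid p n m x =
    (real (Suc x choose m) - real (x choose m)) - real ((n - 2) choose (m - 1)) * p ^ (m - 1)"
  by (simp add: star_resid_def algebra_simps)

text \<open>The covariance of two degree functions is proportional to the product of their mean
  increments, so residuals at different vertices are uncorrelated. It also removes the mean from the
  second Poincare step.\<close>

lemma star_resid_diff_centered:
  assumes "m \<ge> 1"
  shows "bin_ex p (n - 2) (\<lambda>x. star_resid p n m (Suc x) - star_resid p n m x) = 0"
  unfolding star_resid_diff bin_ex_diff[of _ _ "\<lambda>x. real (Suc x choose m) - real (x choose m)"]
    bin_ex_choose_diff[OF assms] by simp

text \<open>The coefficient in \<open>bin_ex_choose_power2_le\<close> for r = m - 2: two differences
  lower the binomial coefficient by two.\<close>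

definition resid_const :: "nat \<Rightarrow> real" where
  "resid_const m = (\<Sum>s\<le>m - 2. fact (2 * (m - 2) - s) / (fact s * (fact (m - 2 - s))\<^sup>2))"

text \<open>The residual has no linear part, so the Poincare inequality can be applied to it twice.\<close>

lemma star_resid_moment:
  assumes p: "0 \<le> p" "p \<le> 1" and n: "n \<ge> 3" and m: "m \<ge> 1" and np: "1 \<le> real n * p"
  shows "expect p (edges {1..n}) (\<lambda>E. (deg_sum {1..n} (star_resid p n m) E)\<^sup>2) \<le>
    resid_const m * real n * (1 - p)\<^sup>2 * (real n * p) ^ (2 * (m - 1))"
proof -
  let ?\<psi> = "star_resid p n m"
  let ?D = "\<lambda>x. ?\<psi> (Suc x) - ?\<psi> x"
  \<comment> \<open>Each Poincare step uses up one trial: from n - 1 to n - 2, then to n -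
    3.\<close>
  obtain N where "n = N + 3" using n by (metis le_add_diff_inverse2)
  then have N: "n - 3 = N" "n - 2 = Suc N" "n - 1 = Suc (Suc N)" by auto
  have pq: "0 \<le> p * (1 - p)" using p by simp
  have r0: "0 \<le> resid_const m" unfolding resid_const_def by (intro sum_nonneg) auto
  have "expect p (edges {1..n}) (\<lambda>E. (deg_sum {1..n} ?\<psi> E)\<^sup>2) = real n * bin_ex p (n - 1) (\<lambda>x. (?\<psi> x)\<^sup>2)"
    using expect_deg_sum_power2[of "{1..n}" p ?\<psi>] star_resid_centered[of p n m] star_resid_diff_centered[OF m, of p n]
    by simp
  also have "\<dots> \<le> real n * (resid_const m * (1 - p)\<^sup>2 * (real n * p) ^ (2 * (m - 1)))"
  proof (intro mult_left_mono)
    show "bin_ex p (n - 1) (\<lambda>x. (?\<psi> x)\<^sup>2) \<le> resid_const m * (1 - p)\<^sup>2 * (real n * p) ^ (2 * (m - 1))"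
    proof (cases "m = 1")
      case True
      then have "?\<psi> = (\<lambda>_. 0)" by (auto simp: star_resid_def bin_ex_id)
      then show ?thesis using r0 np by simp
    next
      case False
      then have "m = Suc (Suc (m - 2))" using m by simp
      then obtain r where r: "m = Suc (Suc r)" by blast
      \<comment> \<open>The second difference forgets the subtracted linear part; Pascal's rule
        twice leaves \<open>x choose (m - 2)\<close>.\<close>
      have DD: "?D (Suc x) - ?D x = real (x choose r)" for x
        unfolding star_resid_diff by (simp add: r)
      have "bin_ex p (n - 1) (\<lambda>x. (?\<psi> x)\<^sup>2) \<le> real (Suc (Suc N)) * p * (1 - p) * bin_ex p (Suc N) (\<lambda>x. (?D x)\<^sup>2)"
        using bin_ex_poincare[OF p, of "Suc N" ?\<psi>] star_resid_centered[of p n m] N by simp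
      also have "bin_ex p (Suc N) (\<lambda>x. (?D x)\<^sup>2) \<le> real (Suc N) * p * (1 - p) * bin_ex p N (\<lambda>x. (real (x choose r))\<^sup>2)"
        using bin_ex_poincare[OF p, of N ?D] star_resid_diff_centered[OF m, of p n] N unfolding DD by simp
      also have "bin_ex p N (\<lambda>x. (real (x choose r))\<^sup>2) \<le> resid_const m * (real n * p) ^ (2 * r)"
        using bin_ex_choose_power2_le[OF p(1) _ np, of N r] N(1) by (simp add: resid_const_def r)
      also have "real (Suc (Suc N)) * p * (1 - p) * (real (Suc N) * p * (1 - p) * (resid_const m * (real n * p) ^ (2 * r)))
         \<le> real n * p * (1 - p) * (real n * p * (1 - p) * (resid_const m * (real n * p) ^ (2 * r)))"
        using N p np r0 n by (intro mult_mono mult_nonneg_nonneg) auto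
      also have "\<dots> = resid_const m * (1 - p)\<^sup>2 * (real n * p) ^ (2 * (m - 1))"
        by (simp add: r power2_eq_square)
      finally show ?thesis using p pq by (simp add: mult_left_mono mult.assoc)
    qed
  qed simp
  finally show ?thesis by (simp add: mult_ac)
qed

section \<open>Normal approximation for the number of edges\<close>

lemma handshake:
  assumes "E \<subseteq> edges {1..n}"
  shows "deg_sum {1..n} real E = 2 * real (card E)"
proof -
  have fE: "finite E" using assms finite_subset finite_edges by (metis finite_atLeastAtMost)
  have "deg_sum {1..n} real E = (\<Sum>i\<in>{1..n}. \<Sum>e\<in>E. of_bool (i \<in> e))"
    unfolding deg_sum_def deg_def
  proof (rule sum.cong[OF refl])
    fix i
    have "(\<Sum>e\<in>E. of_bool (i \<in> e) :: real) = (\<Sum>e\<in>{e \<in> E. i \<in> e}. 1)"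
      using fE by (intro sum.mono_neutral_cong_right) auto
    then show "real (card {e \<in> E. i \<in> e}) = (\<Sum>e\<in>E. of_bool (i \<in> e))" by simp
  qed
  also have "\<dots> = (\<Sum>e\<in>E. \<Sum>i\<in>{1..n}. of_bool (i \<in> e))" by (rule sum.swap)
  also have "\<dots> = (\<Sum>e\<in>E. 2)"
  proof (rule sum.cong[OF refl])
    fix e assume "e \<in> E"
    then have e: "e \<subseteq> {1..n}" "card e = 2" using assms by (auto simp: edges_def)
    then have "(\<Sum>i\<in>{1..n}. of_bool (i \<in> e) :: real) = (\<Sum>i\<in>e. 1)"
      by (intro sum.mono_neutral_cong_right) auto
    then show "(\<Sum>i\<in>{1..n}. of_bool (i \<in> e)) = (2::real)" using e(2) by simp
  qed
  finally show ?thesis by simp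
qed

lemma card_edges: "card (edges {1..n}) = n choose 2"
  unfolding edges_def using n_subsets[of "{1..n}" 2] by simp

lemma bin_ex_iexp:
  "bin_ex p N (\<lambda>x. iexp (\<theta> * (real x - real N * p))) =
    (of_real (1 - p) * iexp (- (\<theta> * p)) + of_real p * iexp (\<theta> * (1 - p))) ^ N"
proof -
  have pw: "bin_ex p N (\<lambda>x. a ^ x) = (1 + of_real p * (a - 1)) ^ N" for a :: complex
    by (induction N) (simp_all add: bin_ex_Suc bin_ex_cmult algebra_simps scaleR_conv_of_real)
  have "(\<lambda>x. iexp (\<theta> * (real x - real N * p))) = (\<lambda>x. iexp (- (\<theta> * p)) ^ N * iexp \<theta> ^ x)"
    by (auto simp: algebra_simps simp flip: exp_of_nat_mult exp_add)
  then have "bin_ex p N (\<lambda>x. iexp (\<theta> * (real x - real N * p))) = (iexp (- (\<theta> * p)) * (1 + of_real p * (iexp \<theta> - 1))) ^ N"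
    by (simp add: bin_ex_cmult pw power_mult_distrib)
  also have "iexp (- (\<theta> * p)) * (1 + of_real p * (iexp \<theta> - 1)) =
     of_real (1 - p) * iexp (- (\<theta> * p)) + of_real p * iexp (\<theta> * (1 - p))"
    by (simp add: algebra_simps flip: exp_add)
  finally show ?thesis .
qed

lemma exp_minus_approx:
  fixes y :: real
  assumes "0 \<le> y"
  shows "\<bar>exp (- y) - (1 - y)\<bar> \<le> y\<^sup>2"
proof -
  have "1 - y \<le> exp (- y)" using exp_ge_add_one_self[of "- y"] by simp
  moreover have "exp (- y) \<le> 1 / (1 + y)"
    using exp_ge_add_one_self[of y] assms by (simp add: exp_minus field_simps)
  moreover have "1 / (1 + y) \<le> 1 - y + y\<^sup>2"
  proof -
    have "(1 - y + y\<^sup>2) * (1 + y) = 1 + y ^ 3" by (simp add: power2_eq_square power3_eq_cube algebra_simps)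
    then show ?thesis using assms by (simp add: divide_le_eq)
  qed
  ultimately show ?thesis by linarith
qed

text \<open>Quantitative central limit theorem. The characteristic function of one centred Bernoulli
  variable is compared with exp(- y), where y is half the variance times \<theta>^2; the comparison
  then passes to the N-th power.\<close>

lemma bin_ex_iexp_bound:
  fixes p \<theta> :: real and N :: nat
  assumes p: "0 \<le> p" "p \<le> 1"
  defines "w \<equiv> real N * \<theta>\<^sup>2 * p * (1 - p)"
  shows "cmod (bin_ex p N (\<lambda>x. iexp (\<theta> * (real x - real N * p))) - of_real (exp (- w / 2))) \<le> w * (\<bar>\<theta>\<bar> + \<theta>\<^sup>2)"
proof -
  define y where "y = \<theta>\<^sup>2 * p * (1 - p) / 2"
  let ?r = "\<lambda>x. iexp x - (1 + \<i> * of_real x - of_real (x\<^sup>2 / 2))"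
  define z where "z = of_real (1 - p) * iexp (- (\<theta> * p)) + of_real p * iexp (\<theta> * (1 - p))"
  have y: "0 \<le> y" "y \<le> \<theta>\<^sup>2"
  proof -
    show "0 \<le> y" using p by (simp add: y_def)
    have "p * (1 - p) \<le> 1" using p by (simp add: mult_le_one)
    then have "\<theta>\<^sup>2 * (p * (1 - p)) \<le> \<theta>\<^sup>2 * 2" by (intro mult_left_mono) auto
    then show "y \<le> \<theta>\<^sup>2" by (simp add: y_def)
  qed
  have r: "cmod (?r x) \<le> \<bar>x\<bar> ^ 3" for x
  proof -
    have "cmod (?r x) \<le> \<bar>x\<bar> ^ 3 / 6"
      using iexp_approx1[of x 2] by (simp add: numeral_2_eq_2 numeral_3_eq_3 power_mult_distrib fact_numeral algebra_simps)
    also have "\<dots> \<le> \<bar>x\<bar> ^ 3" by simp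
    finally show ?thesis .
  qed
  \<comment> \<open>The linear terms cancel because the variable is centred, and the quadratic terms
    add up to y.\<close>
  have z: "z - of_real (1 - y) = of_real (1 - p) * ?r (- (\<theta> * p)) + of_real p * ?r (\<theta> * (1 - p))"
    by (simp add: z_def y_def power2_eq_square field_simps)
  have "cmod (z - of_real (1 - y)) \<le> (1 - p) * \<bar>\<theta> * p\<bar> ^ 3 + p * \<bar>\<theta> * (1 - p)\<bar> ^ 3"
    unfolding z using p r[of "- (\<theta> * p)"] r[of "\<theta> * (1 - p)"]
    by (intro order_trans[OF norm_triangle_ineq] add_mono) (simp_all only: norm_mult norm_of_real abs_of_nonneg diff_ge_0_iff_ge abs_minus_cancel mult_left_mono)
  also have "\<dots> = \<bar>\<theta>\<bar> ^ 3 * p * (1 - p) * (p\<^sup>2 + (1 - p)\<^sup>2)"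
  proof -
    have "\<bar>\<theta> * p\<bar> = \<bar>\<theta>\<bar> * p" "\<bar>\<theta> * (1 - p)\<bar> = \<bar>\<theta>\<bar> * (1 - p)"
      unfolding abs_mult using p by auto
    then show ?thesis
      by (simp only: power_mult_distrib) (simp add: power2_eq_square power3_eq_cube algebra_simps)
  qed
  also have "\<dots> \<le> \<bar>\<theta>\<bar> ^ 3 * p * (1 - p) * 1"
  proof (rule mult_left_mono)
    have "p\<^sup>2 + (1 - p)\<^sup>2 = 1 - 2 * (p * (1 - p))" by (simp add: power2_eq_square algebra_simps)
    then show "p\<^sup>2 + (1 - p)\<^sup>2 \<le> 1" using p by simp
  qed (use p in auto)
  also have "\<dots> = \<bar>\<theta>\<bar> * (2 * y)" by (simp add: y_def power3_eq_cube power2_eq_square)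
  finally have 1: "cmod (z - of_real (1 - y)) \<le> \<bar>\<theta>\<bar> * (2 * y)" .
  have "cmod (of_real (1 - y) - of_real (exp (- y))) = \<bar>exp (- y) - (1 - y)\<bar>"
    unfolding of_real_diff[symmetric] norm_of_real by simp
  also have "\<dots> \<le> y\<^sup>2" by (rule exp_minus_approx[OF y(1)])
  also have "\<dots> \<le> \<theta>\<^sup>2 * (2 * y)"
    unfolding power2_eq_square[of y] using y by (intro mult_mono) auto
  finally have 2: "cmod (z - of_real (exp (- y))) \<le> \<bar>\<theta>\<bar> * (2 * y) + \<theta>\<^sup>2 * (2 * y)"
    using norm_triangle_le[OF add_mono[OF 1]] by fastforce
  have "cmod z \<le> (1 - p) * 1 + p * 1"
    unfolding z_def using p by (intro order_trans[OF norm_triangle_ineq] add_mono) (simp_all add: norm_mult del: of_real_diff)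
  \<comment> \<open>Both bases lie in the closed unit disc, so N-th powers differ by at most N times
    the difference of the bases.\<close>
  then have "cmod (z ^ N - of_real (exp (- y)) ^ N) \<le> real N * cmod (z - of_real (exp (- y)))"
    using y by (intro norm_power_diff) auto
  also have "\<dots> \<le> real N * (\<bar>\<theta>\<bar> * (2 * y) + \<theta>\<^sup>2 * (2 * y))"
    by (intro mult_left_mono 2) auto
  also have "\<dots> = w * (\<bar>\<theta>\<bar> + \<theta>\<^sup>2)" 
  proof -
    have "w = real N * (2 * y)" by (simp add: w_def y_def)
    then show ?thesis by (simp only:) (simp add: algebra_simps)
  qed
  also have "of_real (exp (- y)) ^ N = (of_real (exp (- w / 2)) :: complex)"
    by (simp add: w_def y_def mult_ac flip: of_real_power exp_of_nat_mult)
  finally show ?thesis unfolding bin_ex_iexp z_def .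
qed

section \<open>Comparison of star counts with the number of edges\<close>

lemma expect_abs_le_sqrt:
  fixes F :: "'a set \<Rightarrow> real"
  assumes "0 \<le> p" "p \<le> 1" "finite A"
  shows "expect p A (\<lambda>S. \<bar>F S\<bar>) \<le> sqrt (expect p A (\<lambda>S. (F S)\<^sup>2))"
  using expect_power2_le[OF assms, of "\<lambda>S. \<bar>F S\<bar>"] by (intro real_le_rsqrt) simp

lemma deg_sum_affine:
  "deg_sum V (\<lambda>d. f d - b - a * (g d - e)) E =
    deg_sum V f E - real (card V) * b - a * (deg_sum V g E - real (card V) * e)"
  by (simp add: deg_sum_def sum_subtractf flip: sum_distrib_left)

text \<open>On graphs this is the first coordinate \<open>star_stat p n 1\<close>. It is written
  through degrees to match the linear part removed in \<open>star_resid\<close>.\<close>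

definition edge_stat :: "real \<Rightarrow> nat \<Rightarrow> nat set set \<Rightarrow> real" where
  "edge_stat p n E = sqrt (p / (2 * (1 - p))) / (real n * p) * (deg_sum {1..n} real E - real n * (real (n - 1) * p))"

definition star_stat :: "real \<Rightarrow> nat \<Rightarrow> nat \<Rightarrow> nat set set \<Rightarrow> real" where
  "star_stat p n m E = sqrt (p / (2 * (1 - p))) *
     (centered_stars (m + 1) n p E / (1 / fact (m - 1) * (real n * p) ^ m))"

lemma edge_stat_moment:
  assumes p: "0 < p" "p < 1" and n: "n \<ge> 2"
  shows "expect p (edges {1..n}) (\<lambda>E. (edge_stat p n E)\<^sup>2) \<le> 1"
proof -
  let ?f = "\<lambda>d. real d - real (n - 1) * p"
  let ?c = "sqrt (p / (2 * (1 - p))) / (real n * p)"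
  have n1: "n - 1 = Suc (n - 2)" using n by simp
  have f0: "bin_ex p (n - 1) ?f = 0" by (simp add: bin_ex_diff bin_ex_id)
  have var: "bin_ex p (n - 1) (\<lambda>x. (?f x)\<^sup>2) \<le> real (n - 1) * p * (1 - p)"
    using bin_ex_poincare[of p "n - 2" ?f] p f0 unfolding n1 by simp
  have c2: "?c\<^sup>2 = 1 / (2 * (1 - p) * (real n)\<^sup>2 * p)"
    using p n by (simp add: power_divide power_mult_distrib power2_eq_square)
  have "expect p (edges {1..n}) (\<lambda>E. (edge_stat p n E)\<^sup>2) =
      ?c\<^sup>2 * expect p (edges {1..n}) (\<lambda>E. (deg_sum {1..n} ?f E)\<^sup>2)"
  proof -
    have "(edge_stat p n E)\<^sup>2 = ?c\<^sup>2 * (deg_sum {1..n} ?f E)\<^sup>2" for E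
      using deg_sum_centered[of "{1..n}" real E "real (n - 1) * p"]
      unfolding edge_stat_def power_mult_distrib by simp
    then show ?thesis by (simp only: expect_cmult)
  qed
  also have "\<dots> = ?c\<^sup>2 * (real n * (bin_ex p (n - 1) (\<lambda>x. (?f x)\<^sup>2) + (real n - 1) * p * (1 - p)))"
    using expect_deg_sum_power2[of "{1..n}" p ?f] f0 by simp
  also have "\<dots> \<le> ?c\<^sup>2 * (real n * (real (n - 1) * p * (1 - p) + (real n - 1) * p * (1 - p)))"
    by (intro mult_left_mono add_right_mono var) auto
  also have "\<dots> = (real n - 1) / real n"
    unfolding c2 using p n by (simp add: of_nat_diff field_simps power2_eq_square)
  also have "\<dots> \<le> 1" using n by simp
  finally show ?thesis .
qed

text \<open>For p \<le> 1/2 the quantity n^2 p (1 - p) is at least np / 2; for p > 1/2 it is at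
  least half of n^2 (1 - p)^3. Adding both reciprocals gives one bound for either case.\<close>

lemma dense_tendsto_0:
  fixes p :: "nat \<Rightarrow> real"
  assumes p: "\<And>n. n \<ge> 1 \<Longrightarrow> 0 < p n \<and> p n < 1"
    and np: "filterlim (\<lambda>n. real n * p n) at_top sequentially"
    and nq: "filterlim (\<lambda>n. (real n)\<^sup>2 * (1 - p n) ^ 3) at_top sequentially"
  shows "(\<lambda>n. 1 / ((real n)\<^sup>2 * p n * (1 - p n))) \<longlonglongrightarrow> 0"
proof (rule tendsto_sandwich[where f = "\<lambda>_. 0" and
      h = "\<lambda>n. 2 * inverse (real n * p n) + 2 * inverse ((real n)\<^sup>2 * (1 - p n) ^ 3)"])
  have "(\<lambda>n. 2 * inverse (real n * p n) + 2 * inverse ((real n)\<^sup>2 * (1 - p n) ^ 3)) \<longlonglongrightarrow> 2 * 0 + 2 * 0"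
    by (intro tendsto_intros tendsto_inverse_0_at_top np nq)
  then show "(\<lambda>n. 2 * inverse (real n * p n) + 2 * inverse ((real n)\<^sup>2 * (1 - p n) ^ 3)) \<longlonglongrightarrow> 0" by simp
  show "\<forall>\<^sub>F n in sequentially. 1 / ((real n)\<^sup>2 * p n * (1 - p n)) \<le>
      2 * inverse (real n * p n) + 2 * inverse ((real n)\<^sup>2 * (1 - p n) ^ 3)"
    using eventually_ge_at_top[of 1]
  proof eventually_elim
    case (elim n)
    then have n: "real n \<ge> 1" and pn: "0 < p n" "p n < 1" using p by auto
    have pos: "0 < real n * p n" "0 < (real n)\<^sup>2 * (1 - p n) ^ 3" "0 < (real n)\<^sup>2 * p n * (1 - p n)"
      using n pn by auto
    have inv: "0 \<le> 2 * inverse x" if "0 < x" for x :: real using that by simp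
    show ?case
    proof (cases "p n \<le> 1 / 2")
      case True
      have "real n * p n * 1 \<le> real n * p n * (2 * (real n * (1 - p n)))"
      proof (rule mult_left_mono)
        have "1 * 1 \<le> real n * (2 * (1 - p n))" using True n by (intro mult_mono) auto
        then show "1 \<le> 2 * (real n * (1 - p n))" by (simp add: algebra_simps)
      qed (use pos in auto)
      then have "real n * p n \<le> 2 * ((real n)\<^sup>2 * p n * (1 - p n))"
        by (simp add: power2_eq_square mult_ac)
      then have "1 / ((real n)\<^sup>2 * p n * (1 - p n)) \<le> 2 * inverse (real n * p n)"
        using pos by (simp add: field_simps)
      moreover have "0 \<le> 2 * inverse ((real n)\<^sup>2 * (1 - p n) ^ 3)" by (rule inv[OF pos(2)])
      ultimately show ?thesis by linarith
    next
      case False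
      have "(1 - p n) ^ 3 \<le> 1 - p n"
        using pn power_decreasing[of 1 3 "1 - p n"] by simp
      also have "\<dots> \<le> 2 * (p n * (1 - p n))"
        using False pn mult_right_mono[of 1 "2 * p n" "1 - p n"] by simp
      finally have "(real n)\<^sup>2 * (1 - p n) ^ 3 \<le> (real n)\<^sup>2 * (2 * (p n * (1 - p n)))"
        by (rule mult_left_mono) simp
      then have "(real n)\<^sup>2 * (1 - p n) ^ 3 \<le> 2 * ((real n)\<^sup>2 * p n * (1 - p n))"
        by (simp only: mult_ac)
      then have "1 / ((real n)\<^sup>2 * p n * (1 - p n)) \<le> 2 * inverse ((real n)\<^sup>2 * (1 - p n) ^ 3)"
        using pos by (simp add: field_simps)
      moreover have "0 \<le> 2 * inverse (real n * p n)" by (rule inv[OF pos(1)])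
      ultimately show ?thesis by linarith
    qed
  qed
  show "\<forall>\<^sub>F n in sequentially. 0 \<le> 1 / ((real n)\<^sup>2 * p n * (1 - p n))"
    by (rule eventually_mono[OF eventually_ge_at_top[of 1]]) (simp add: p less_imp_le)
qed simp

lemma edge_stat_char_tendsto:
  fixes p :: "nat \<Rightarrow> real" and s :: real
  assumes p: "\<And>n. n \<ge> 1 \<Longrightarrow> 0 < p n \<and> p n < 1"
    and np: "filterlim (\<lambda>n. real n * p n) at_top sequentially"
    and nq: "filterlim (\<lambda>n. (real n)\<^sup>2 * (1 - p n) ^ 3) at_top sequentially"
  shows "(\<lambda>n. expect (p n) (edges {1..n}) (\<lambda>E. iexp (s * edge_stat (p n) n E)))
    \<longlonglongrightarrow> of_real (exp (- s\<^sup>2 / 2))"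
proof -
  \<comment> \<open>The factor 2 appears because the degree sum is twice the number of
    edges.\<close>
  define \<theta> where "\<theta> n = 2 * s * (sqrt (p n / (2 * (1 - p n))) / (real n * p n))" for n
  define w where "w n = real (n choose 2) * (\<theta> n)\<^sup>2 * p n * (1 - p n)" for n
  define \<phi> where "\<phi> n = expect (p n) (edges {1..n}) (\<lambda>E. iexp (s * edge_stat (p n) n E))" for n
  have N: "2 * real (n choose 2) = real n * real (n - 1)" for n
  proof -
    have "even (n * (n - 1))" by (cases n) auto
    then have "2 * (n choose 2) = n * (n - 1)" unfolding choose_two by (rule dvd_mult_div_cancel)
    then show ?thesis by (metis of_nat_mult of_nat_numeral)
  qed
  have \<theta>2: "(\<theta> n)\<^sup>2 = 2 * s\<^sup>2 * (1 / ((real n)\<^sup>2 * p n * (1 - p n)))" if "n \<ge> 1" for n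
    using p[OF that] that
    by (simp add: \<theta>_def power_mult_distrib power_divide) (simp add: power2_eq_square field_simps)
  have "(\<lambda>n. 2 * s\<^sup>2 * (1 / ((real n)\<^sup>2 * p n * (1 - p n)))) \<longlonglongrightarrow> 2 * s\<^sup>2 * 0"
    by (intro tendsto_mult tendsto_const dense_tendsto_0 p np nq)
  then have "(\<lambda>n. 2 * s\<^sup>2 * (1 / ((real n)\<^sup>2 * p n * (1 - p n)))) \<longlonglongrightarrow> 0"
    by simp
  then have \<theta>2_lim: "(\<lambda>n. (\<theta> n)\<^sup>2) \<longlonglongrightarrow> 0"
    by (rule Lim_transform_eventually)
      (rule eventually_mono[OF eventually_ge_at_top[of 1]], simp add: \<theta>2)
  have \<theta>_lim: "(\<lambda>n. \<bar>\<theta> n\<bar>) \<longlonglongrightarrow> 0"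
    using tendsto_real_sqrt[OF \<theta>2_lim] by simp
  have w: "w n = s\<^sup>2 * (1 - 1 / real n)" if "n \<ge> 1" for n
  proof -
    have "w n = (2 * real (n choose 2)) * (s\<^sup>2 * (1 / ((real n)\<^sup>2 * p n * (1 - p n)))) * p n * (1 - p n)"
      unfolding w_def \<theta>2[OF that] by simp
    also have "\<dots> = s\<^sup>2 * (1 - 1 / real n)"
      unfolding N using p[OF that] that by (simp add: of_nat_diff field_simps power2_eq_square)
    finally show ?thesis .
  qed
  have "(\<lambda>n. s\<^sup>2 * (1 - 1 / real n)) \<longlonglongrightarrow> s\<^sup>2 * (1 - 0)"
    by (intro tendsto_intros lim_1_over_n)
  then have w_lim: "w \<longlonglongrightarrow> s\<^sup>2"
    by (intro Lim_transform_eventually[where g = w, rotated])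
      (rule eventually_mono[OF eventually_ge_at_top[of 1]], simp_all add: w)
  have "\<forall>\<^sub>F n in sequentially. cmod (\<phi> n - of_real (exp (- w n / 2))) \<le> w n * (\<bar>\<theta> n\<bar> + (\<theta> n)\<^sup>2)"
    using eventually_ge_at_top[of 1]
  proof eventually_elim
    case (elim n)
    have "\<phi> n = expect (p n) (edges {1..n}) (\<lambda>E. iexp (\<theta> n * (real (card E) - real (n choose 2) * p n)))"
      unfolding \<phi>_def
    proof (intro expect_cong refl)
      fix E assume E: "E \<subseteq> edges {1..n}"
      have "deg_sum {1..n} real E - real n * (real (n - 1) * p n) = 2 * (real (card E) - real (n choose 2) * p n)"
        using handshake[OF E] N[of n] by (simp add: algebra_simps)
      then show "iexp (s * edge_stat (p n) n E) = iexp (\<theta> n * (real (card E) - real (n choose 2) * p n))"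
        unfolding edge_stat_def \<theta>_def by (simp only: mult_ac)
    qed
    then have "\<phi> n = bin_ex (p n) (n choose 2) (\<lambda>x. iexp (\<theta> n * (real x - real (n choose 2) * p n)))"
      using expect_card[of "edges {1..n}" "p n" "\<lambda>x. iexp (\<theta> n * (real x - real (n choose 2) * p n))"]
      unfolding card_edges by simp
    then show ?case
      using bin_ex_iexp_bound[of "p n" "n choose 2" "\<theta> n"] p[OF elim] unfolding w_def by simp
  qed
  moreover have "(\<lambda>n. w n * (\<bar>\<theta> n\<bar> + (\<theta> n)\<^sup>2)) \<longlonglongrightarrow> 0"
    using tendsto_mult[OF w_lim tendsto_add[OF \<theta>_lim \<theta>2_lim]] by simp
  ultimately have "(\<lambda>n. \<phi> n - of_real (exp (- w n / 2))) \<longlonglongrightarrow> 0"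
    by (rule Lim_null_comparison)
  moreover have "(\<lambda>n. of_real (exp (- w n / 2))) \<longlonglongrightarrow> (of_real (exp (- s\<^sup>2 / 2)) :: complex)"
    by (intro tendsto_intros w_lim) auto
  ultimately show ?thesis
    unfolding \<phi>_def[symmetric] using tendsto_add by fastforce
qed

text \<open>The scaled star count is \<open>b n * edge_stat\<close> plus a scaled residual. The
  ratio of slopes \<open>b n\<close> tends to 1, and the residual has second moment O(1 /
  (np)).\<close>

lemma star_stat_edge_stat:
  fixes p :: "nat \<Rightarrow> real"
  assumes p: "\<And>n. n \<ge> 1 \<Longrightarrow> 0 < p n \<and> p n < 1"
    and np: "filterlim (\<lambda>n. real n * p n) at_top sequentially"
    and m: "m \<ge> 1"
  shows "(\<lambda>n. expect (p n) (edges {1..n}) (\<lambda>E. (star_stat (p n) n m E - edge_stat (p n) n E)\<^sup>2)) \<longlonglongrightarrow> 0"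
proof -
  \<comment> \<open>The powers of p cancel, leaving 1 / n in their place; thus
    \<open>choose_power_tendsto\<close> applies with edge probability 1 / n and c = 1.\<close>
  define b where "b n = fact (m - 1) * (real ((n - 2) choose (m - 1)) * (1 / real n) ^ (m - 1))" for n
  define g where "g n = fact (m - 1) / (real n * p n) ^ m * sqrt (p n / (2 * (1 - p n)))" for n
  let ?D = "\<lambda>n. expect (p n) (edges {1..n}) (\<lambda>E. (star_stat (p n) n m E - edge_stat (p n) n E)\<^sup>2)"
  let ?U = "\<lambda>n. 2 * (b n - 1)\<^sup>2 + 2 * ((fact (m - 1))\<^sup>2 * resid_const m * inverse (real n * p n))"
  have "(\<lambda>n. real n * (1 / real n)) \<longlonglongrightarrow> 1"
    by (rule Lim_transform_eventually[OF tendsto_const])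
      (rule eventually_mono[OF eventually_gt_at_top[of 0]], simp)
  then have "b \<longlonglongrightarrow> fact (m - 1) * (1 ^ (m - 1) / fact (m - 1))"
    unfolding b_def by (intro tendsto_mult tendsto_const choose_power_tendsto)
  then have "b \<longlonglongrightarrow> 1" by simp
  then have "?U \<longlonglongrightarrow> 2 * (1 - 1)\<^sup>2 + 2 * ((fact (m - 1))\<^sup>2 * resid_const m * 0)"
    by (intro tendsto_intros tendsto_inverse_0_at_top np)
  then have U: "?U \<longlonglongrightarrow> 0" by simp
  have "\<forall>\<^sub>F n in sequentially. norm (?D n) \<le> ?U n"
    using eventually_ge_at_top[of 3] filterlim_at_top_dense[THEN iffD1, rule_format, OF np, of 1]
  proof eventually_elim
    case (elim n)
    let ?p = "p n"
    have n: "n \<ge> 1" "n \<ge> 2" and pn: "0 < ?p" "?p < 1" using p elim by auto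
    then have pn': "0 \<le> ?p" "?p \<le> 1" by auto
    have npos: "0 < real n * ?p" using n pn by simp
    have eq: "star_stat ?p n m E - edge_stat ?p n E =
        (b n - 1) * edge_stat ?p n E + g n * deg_sum {1..n} (star_resid ?p n m) E"
      if E: "E \<subseteq> edges {1..n}" for E
    proof -
      define a where "a = real ((n - 2) choose (m - 1)) * ?p ^ (m - 1)"
      define L where "L = deg_sum {1..n} real E - real n * (real (n - 1) * ?p)"
      have "centered_stars (Suc m) n ?p E = a * L + deg_sum {1..n} (star_resid ?p n m) E"
        unfolding centered_stars_eq[OF pn' E]
        by (simp add: star_resid_def[abs_def] deg_sum_affine a_def L_def)
      moreover have "g n * a = b n * (sqrt (?p / (2 * (1 - ?p))) / (real n * ?p))"
      proof -
        have "(real n * ?p) ^ m = real n * ?p * (real n ^ (m - 1) * ?p ^ (m - 1))"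
          using m by (metis power_eq_if power_mult_distrib not_one_le_zero)
        then show ?thesis using npos pn n
          by (simp add: g_def a_def b_def power_divide mult_ac)
      qed
      ultimately have "star_stat ?p n m E = b n * edge_stat ?p n E + g n * deg_sum {1..n} (star_resid ?p n m) E"
      proof -
        assume c: "centered_stars (Suc m) n ?p E = a * L + deg_sum {1..n} (star_resid ?p n m) E"
          and ga: "g n * a = b n * (sqrt (?p / (2 * (1 - ?p))) / (real n * ?p))"
        have "star_stat ?p n m E = g n * centered_stars (Suc m) n ?p E"
          by (simp add: star_stat_def g_def)
        also have "\<dots> = (g n * a) * L + g n * deg_sum {1..n} (star_resid ?p n m) E"
          unfolding c by (simp add: distrib_left)
        also have "(g n * a) * L = b n * edge_stat ?p n E"
          unfolding ga edge_stat_def L_def by (simp only: mult.assoc)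
        finally show ?thesis .
      qed
      then show ?thesis by (simp add: algebra_simps)
    qed
    have "?D n \<le> expect ?p (edges {1..n}) (\<lambda>E. 2 * (b n - 1)\<^sup>2 * (edge_stat ?p n E)\<^sup>2 +
        2 * (g n)\<^sup>2 * (deg_sum {1..n} (star_resid ?p n m) E)\<^sup>2)"
    proof (rule expect_mono[OF pn'])
      fix E assume E: "E \<subseteq> edges {1..n}"
      have "(x + y)\<^sup>2 \<le> 2 * x\<^sup>2 + 2 * y\<^sup>2" for x y :: real
        using zero_le_power2[of "x - y"] by (simp add: power2_eq_square algebra_simps)
      then show "(star_stat ?p n m E - edge_stat ?p n E)\<^sup>2 \<le> 2 * (b n - 1)\<^sup>2 * (edge_stat ?p n E)\<^sup>2 +
        2 * (g n)\<^sup>2 * (deg_sum {1..n} (star_resid ?p n m) E)\<^sup>2"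
        unfolding eq[OF E] by (metis (no_types, lifting) mult.assoc power_mult_distrib)
    qed
    also have "\<dots> = 2 * (b n - 1)\<^sup>2 * expect ?p (edges {1..n}) (\<lambda>E. (edge_stat ?p n E)\<^sup>2) +
        2 * (g n)\<^sup>2 * expect ?p (edges {1..n}) (\<lambda>E. (deg_sum {1..n} (star_resid ?p n m) E)\<^sup>2)"
      by (simp only: expect_add expect_cmult)
    also have "\<dots> \<le> 2 * (b n - 1)\<^sup>2 * 1 +
        2 * (g n)\<^sup>2 * (resid_const m * real n * (1 - ?p)\<^sup>2 * (real n * ?p) ^ (2 * (m - 1)))"
      using elim by (intro add_mono mult_left_mono edge_stat_moment star_resid_moment pn pn' n m) auto
    \<comment> \<open>The normalisation contributes 1 / (1 - p) and the two Poincare steps (1 -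
      p)^2, so the bound survives p \<rightarrow> 1.\<close>
    also have "2 * (g n)\<^sup>2 * (resid_const m * real n * (1 - ?p)\<^sup>2 * (real n * ?p) ^ (2 * (m - 1))) =
        2 * ((fact (m - 1))\<^sup>2 * resid_const m * inverse (real n * ?p)) * ((1 - ?p) / 2)"
    proof -
      have g2: "(g n)\<^sup>2 = (fact (m - 1))\<^sup>2 * (?p / (2 * (1 - ?p))) / ((real n * ?p) ^ (2 * m))"
        using pn by (simp add: g_def power_mult_distrib power_divide power_mult mult.commute[of 2 m])
      have "2 * m = 2 * (m - 1) + 2" using m by simp
      then have pm: "(real n * ?p) ^ (2 * m) = (real n * ?p) ^ (2 * (m - 1)) * (real n * ?p)\<^sup>2"
        by (metis power_add)
      have alg: "2 * (F * (q / (2 * r)) / (P * (x * q)\<^sup>2)) * (R * x * r\<^sup>2 * P) = 2 * (F * R * inverse (x * q)) * (r / 2)"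
        if "P \<noteq> 0" "x \<noteq> 0" "q \<noteq> 0" "r \<noteq> 0" for F P R x q r :: real
        using that by (simp add: field_simps power2_eq_square)
      have "(real n * ?p) ^ (2 * (m - 1)) \<noteq> 0"
        using npos by (metis less_irrefl zero_less_power)
      then show ?thesis
        unfolding g2 pm using pn n by (intro alg) auto
    qed
    also have "2 * ((fact (m - 1))\<^sup>2 * resid_const m * inverse (real n * ?p)) * ((1 - ?p) / 2) \<le>
        2 * ((fact (m - 1))\<^sup>2 * resid_const m * inverse (real n * ?p))"
    proof (rule mult_right_le_one_le)
      have "0 \<le> resid_const m" unfolding resid_const_def by (intro sum_nonneg) auto
      then show "0 \<le> 2 * ((fact (m - 1))\<^sup>2 * resid_const m * inverse (real n * ?p))"
        using npos by (intro mult_nonneg_nonneg) (auto simp del: inverse_mult_distrib)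
    qed (use pn in auto)
    finally have "?D n \<le> ?U n" by simp
    moreover have "0 \<le> ?D n" by (rule expect_nonneg[OF pn']) simp
    ultimately show ?case by simp
  qed
  then show ?thesis using U by (rule Lim_null_comparison)
qed

text \<open>\<open>iexp\<close> is Lipschitz, so closeness in mean square suffices to replace every
  coordinate by the same \<open>edge_stat\<close>. Only the sum of the coefficients survives, which
  is why the limit has rank one.\<close>

lemma star_stat_char_tendsto:
  fixes p t :: "_ \<Rightarrow> real" and I :: "'i set"
  assumes p: "\<And>n. n \<ge> 1 \<Longrightarrow> 0 < p n \<and> p n < 1"
    and np: "filterlim (\<lambda>n. real n * p n) at_top sequentially"
    and nq: "filterlim (\<lambda>n. (real n)\<^sup>2 * (1 - p n) ^ 3) at_top sequentially"
    and m: "\<And>i. i \<in> I \<Longrightarrow> m i \<ge> 1"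
  shows "(\<lambda>n. expect (p n) (edges {1..n}) (\<lambda>E. iexp (\<Sum>i\<in>I. t i * star_stat (p n) n (m i) E)))
    \<longlonglongrightarrow> of_real (exp (- (\<Sum>i\<in>I. t i)\<^sup>2 / 2))"
proof -
  define s where "s = (\<Sum>i\<in>I. t i)"
  let ?X = "\<lambda>n i E. star_stat (p n) n (m i) E"
  let ?Y = "\<lambda>n E. edge_stat (p n) n E"
  let ?E = "\<lambda>n. expect (p n) (edges {1..n})"
  have "(\<lambda>n. ?E n (\<lambda>E. iexp (\<Sum>i\<in>I. t i * ?X n i E)) - ?E n (\<lambda>E. iexp (s * ?Y n E))) \<longlonglongrightarrow> 0"
  proof (rule Lim_null_comparison)
    show "\<forall>\<^sub>F n in sequentially. cmod (?E n (\<lambda>E. iexp (\<Sum>i\<in>I. t i * ?X n i E)) - ?E n (\<lambda>E. iexp (s * ?Y n E)))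
      \<le> (\<Sum>i\<in>I. \<bar>t i\<bar> * sqrt (?E n (\<lambda>E. (?X n i E - ?Y n E)\<^sup>2)))"
      using eventually_ge_at_top[of 1]
    proof eventually_elim
      case (elim n)
      then have pn: "0 \<le> p n" "p n \<le> 1" using p by (auto simp: less_imp_le)
      have "cmod (?E n (\<lambda>E. iexp (\<Sum>i\<in>I. t i * ?X n i E)) - ?E n (\<lambda>E. iexp (s * ?Y n E))) =
          cmod (?E n (\<lambda>E. iexp (\<Sum>i\<in>I. t i * ?X n i E) - iexp (s * ?Y n E)))"
        by (simp only: expect_diff)
      also have "\<dots> \<le> ?E n (\<lambda>E. \<Sum>i\<in>I. \<bar>t i\<bar> * \<bar>?X n i E - ?Y n E\<bar>)"
      proof (rule norm_expect_le_mono[OF pn])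
        fix E
        have "cmod (iexp (\<Sum>i\<in>I. t i * ?X n i E) - iexp (s * ?Y n E)) \<le> \<bar>(\<Sum>i\<in>I. t i * ?X n i E) - s * ?Y n E\<bar>"
          by (rule norm_iexp_diff)
        also have "(\<Sum>i\<in>I. t i * ?X n i E) - s * ?Y n E = (\<Sum>i\<in>I. t i * (?X n i E - ?Y n E))"
          by (simp add: s_def sum_distrib_right right_diff_distrib sum_subtractf)
        also have "\<bar>\<dots>\<bar> \<le> (\<Sum>i\<in>I. \<bar>t i\<bar> * \<bar>?X n i E - ?Y n E\<bar>)"
          by (rule order_trans[OF sum_abs]) (simp add: abs_mult)
        finally show "cmod (iexp (\<Sum>i\<in>I. t i * ?X n i E) - iexp (s * ?Y n E)) \<le> (\<Sum>i\<in>I. \<bar>t i\<bar> * \<bar>?X n i E - ?Y n E\<bar>)" .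
      qed
      also have "\<dots> = (\<Sum>i\<in>I. \<bar>t i\<bar> * ?E n (\<lambda>E. \<bar>?X n i E - ?Y n E\<bar>))"
        by (simp only: expect_sum expect_cmult)
      also have "\<dots> \<le> (\<Sum>i\<in>I. \<bar>t i\<bar> * sqrt (?E n (\<lambda>E. (?X n i E - ?Y n E)\<^sup>2)))"
        by (intro sum_mono mult_left_mono expect_abs_le_sqrt pn) auto
      finally show ?case .
    qed
    have "(\<lambda>n. \<Sum>i\<in>I. \<bar>t i\<bar> * sqrt (?E n (\<lambda>E. (?X n i E - ?Y n E)\<^sup>2))) \<longlonglongrightarrow> (\<Sum>i\<in>I. \<bar>t i\<bar> * sqrt 0)"
      by (intro tendsto_sum tendsto_mult tendsto_const tendsto_real_sqrt star_stat_edge_stat p np m)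
    then show "(\<lambda>n. \<Sum>i\<in>I. \<bar>t i\<bar> * sqrt (?E n (\<lambda>E. (?X n i E - ?Y n E)\<^sup>2))) \<longlonglongrightarrow> 0" by simp
  qed
  from tendsto_add[OF this edge_stat_char_tendsto[OF p np nq, of s]]
  show ?thesis by (simp add: s_def)
qed

lemma star_stat_moment:
  fixes p :: "nat \<Rightarrow> real"
  assumes p: "\<And>n. n \<ge> 1 \<Longrightarrow> 0 < p n \<and> p n < 1"
    and np: "filterlim (\<lambda>n. real n * p n) at_top sequentially"
    and m: "m \<ge> 1"
  shows "\<forall>\<^sub>F n in sequentially. expect (p n) (edges {1..n}) (\<lambda>E. (star_stat (p n) n m E)\<^sup>2) \<le> 4"
proof -
  have "\<forall>\<^sub>F n in sequentially. expect (p n) (edges {1..n}) (\<lambda>E. (star_stat (p n) n m E - edge_stat (p n) n E)\<^sup>2) < 1"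
    using order_tendstoD(2)[OF star_stat_edge_stat[OF p np m], of 1] by simp
  then show ?thesis using eventually_ge_at_top[of 2]
  proof eventually_elim
    case (elim n)
    then have pn: "0 < p n" "p n < 1" using p by auto
    then have pn': "0 \<le> p n" "p n \<le> 1" by auto
    have "expect (p n) (edges {1..n}) (\<lambda>E. (star_stat (p n) n m E)\<^sup>2) \<le>
      expect (p n) (edges {1..n}) (\<lambda>E. 2 * (star_stat (p n) n m E - edge_stat (p n) n E)\<^sup>2 + 2 * (edge_stat (p n) n E)\<^sup>2)"
    proof (rule expect_mono[OF pn'])
      fix E
      have "x\<^sup>2 \<le> 2 * (x - y)\<^sup>2 + 2 * y\<^sup>2" for x y :: real
        using zero_le_power2[of "x - 2 * y"] by (simp add: power2_eq_square algebra_simps)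
      then show "(star_stat (p n) n m E)\<^sup>2 \<le> 2 * (star_stat (p n) n m E - edge_stat (p n) n E)\<^sup>2 + 2 * (edge_stat (p n) n E)\<^sup>2" .
    qed
    also have "\<dots> = 2 * expect (p n) (edges {1..n}) (\<lambda>E. (star_stat (p n) n m E - edge_stat (p n) n E)\<^sup>2) +
        2 * expect (p n) (edges {1..n}) (\<lambda>E. (edge_stat (p n) n E)\<^sup>2)"
      by (simp only: expect_add expect_cmult)
    \<comment> \<open>4 = 2 * 1 + 2 * 1, from the difference and from
      \<open>edge_stat\<close>.\<close>
    also have "\<dots> \<le> 4" using elim edge_stat_moment[OF pn elim(2)] by linarith
    finally show ?case .
  qed
qed

text \<open>For Poisson X with mean c, \<open>X choose m\<close> is the sum over s of c^(m - s) / (m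
  - s)! times Q_s, where the Charlier polynomials Q_s are orthogonal with squared norm c^s / s!.
  Edges shared by two vertices correlate only the linear parts, which doubles the s = 1
  component.\<close>

definition sigma_root :: "real \<Rightarrow> nat \<Rightarrow> nat \<Rightarrow> real" where
  "sigma_root c m s = (if s \<le> m then c ^ (m - s) / fact (m - s) * sqrt (c ^ s / fact s * (if s = 1 then 2 else 1)) else 0)"

lemma sigma_root_mult:
  assumes c: "c > 0" and ml: "1 \<le> m" "m \<le> k" "1 \<le> l" "l \<le> k"
  shows "(\<Sum>s=1..k. sigma_root c m s * sigma_root c l s) = sigma_star c m l"
proof -
  have "(\<Sum>s=1..k. sigma_root c m s * sigma_root c l s) = (\<Sum>s=1..min m l. sigma_root c m s * sigma_root c l s)"
    using ml by (intro sum.mono_neutral_right) (auto simp: sigma_root_def)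
  also have "\<dots> = (\<Sum>s=1..min m l. c ^ (m + l - s) / (fact s * fact (m - s) * fact (l - s)) * (if s = 1 then 2 else 1))"
  proof (rule sum.cong[OF refl])
    fix s assume s: "s \<in> {1..min m l}"
    let ?e = "c ^ s / fact s * (if s = 1 then 2 else 1)"
    have "sigma_root c m s * sigma_root c l s = (c ^ (m - s) / fact (m - s)) * (c ^ (l - s) / fact (l - s)) * (sqrt ?e * sqrt ?e)"
    proof -
      have "sigma_root c m s = c ^ (m - s) / fact (m - s) * sqrt ?e" "sigma_root c l s = c ^ (l - s) / fact (l - s) * sqrt ?e"
        using s by (auto simp: sigma_root_def)
      then show ?thesis by (simp only: mult_ac)
    qed
    also have "sqrt ?e * sqrt ?e = ?e"
      unfolding real_sqrt_mult_self by (rule abs_of_nonneg) (use c in simp)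
    also have "m + l - s = (m - s) + (l - s) + s" using s by simp
    then have "(c ^ (m - s) / fact (m - s)) * (c ^ (l - s) / fact (l - s)) * ?e =
      c ^ (m + l - s) / (fact s * fact (m - s) * fact (l - s)) * (if s = 1 then 2 else 1)"
      by (simp only: power_add) simp
    finally show "sigma_root c m s * sigma_root c l s = c ^ (m + l - s) / (fact s * fact (m - s) * fact (l - s)) * (if s = 1 then 2 else 1)" .
  qed
  \<comment> \<open>Half of the doubled s = 1 term is split off; it is the first summand of
    \<open>sigma_star\<close>.\<close>
  also have "\<dots> = (\<Sum>s=1..min m l. c ^ (m + l - s) / (fact s * fact (m - s) * fact (l - s)) +
      (if s = 1 then c ^ (m + l - 1) / (fact 1 * fact (m - 1) * fact (l - 1)) else 0))"
    by (intro sum.cong) (auto simp: mult.commute)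
  also have "\<dots> = sigma_star c m l"
    unfolding sum.distrib using ml by (simp add: sigma_star_def)
  finally show ?thesis .
qed

lemma inner_matrix_vector_mult:
  "t \<bullet> ((\<chi> i j. \<sigma> i j) *v t) = (\<Sum>i\<in>UNIV. \<Sum>j\<in>UNIV. t $ i * t $ j * \<sigma> i j)"
  for t :: "real ^ 'k"
  by (simp add: inner_vec_def matrix_vector_mult_def sum_distrib_left mult_ac)

text \<open>Vectors are indexed by a finite type; \<open>idx\<close> numbers its elements from 1 to
  k, which ties the dimension to k.\<close>

theorem theorem1:
  fixes p :: "nat \<Rightarrow> real" and k :: nat and idx :: "'k::finite \<Rightarrow> nat"
  assumes p: "\<And>n. n \<ge> 1 \<Longrightarrow> 0 < p n \<and> p n < 1"
    and k: "k \<ge> 1"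
    and idx: "bij_betw idx UNIV {1..k}"
  shows "(\<forall>c>0. (\<lambda>n. real n * p n) \<longlonglongrightarrow> c \<longrightarrow>
            tends_in_distr_normal p
              (\<lambda>n E. (1 / sqrt (real n)) *\<^sub>R (\<chi> i. centered_stars (idx i + 1) n (p n) E))
              0 (\<chi> i j. sigma_star c (idx i) (idx j))) \<and>
         (filterlim (\<lambda>n. real n * p n) at_top sequentially \<longrightarrow>
          filterlim (\<lambda>n. (real n)\<^sup>2 * (1 - p n) ^ 3) at_top sequentially \<longrightarrow>
            tends_in_distr_normal p
              (\<lambda>n E. sqrt (p n / (2 * (1 - p n))) *\<^sub>R
                 (\<chi> i. centered_stars (idx i + 1) n (p n) E /
                        (1 / fact (idx i - 1) * (real n * p n) ^ idx i)))
              0 (\<chi> i j. 1))"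
proof (intro conjI allI impI)
  have idx1: "idx i \<ge> 1" "idx i \<le> k" for i
    using bij_betwE[OF idx] by auto
  have p': "0 \<le> p n \<and> p n \<le> 1" if "n \<ge> 1" for n using p[OF that] by auto
  have sum_idx: "(\<Sum>j\<in>UNIV. f (idx j)) = (\<Sum>s=1..k. f s)" for f :: "nat \<Rightarrow> real"
    by (rule sum.reindex_bij_betw[OF idx])
  {
    fix c :: real assume c: "c > 0" and lim: "(\<lambda>n. real n * p n) \<longlonglongrightarrow> c"
    let ?X = "\<lambda>n E. (1 / sqrt (real n)) *\<^sub>R (\<chi> i. centered_stars (idx i + 1) n (p n) E) :: real ^ 'k"
    let ?S = "(\<chi> i j. sigma_star c (idx i) (idx j)) :: real ^ 'k ^ 'k"
    define B where "B = (\<chi> i j. sigma_root c (idx i) (idx j) :: real ^ 'k ^ 'k)"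
    have "(\<Sum>j\<in>UNIV. sigma_root c (idx i) (idx j) * sigma_root c (idx l) (idx j)) = sigma_star c (idx i) (idx l)" for i l
      unfolding sum_idx[of "\<lambda>s. sigma_root c (idx i) s * sigma_root c (idx l) s"]
      by (rule sigma_root_mult[OF c idx1 idx1])
    then have S: "?S = B ** transpose B"
      by (simp only: B_def matrix_matrix_mult_def transpose_def vec_lambda_beta)
    show "tends_in_distr_normal p ?X 0 ?S"
    proof (rule tends_in_distr_normalI[OF p' S])
      fix t :: "real ^ 'k"
      have 1: "t \<bullet> ?X n E = 1 / sqrt (real n) * (\<Sum>i\<in>UNIV. t $ i * centered_stars (idx i + 1) n (p n) E)" for n E
        by (simp add: inner_vec_def sum_divide_distrib)
      show "(\<lambda>n. expect (p n) (edges {1..n}) (\<lambda>E. iexp (t \<bullet> ?X n E)))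
          \<longlonglongrightarrow> of_real (exp (- (t \<bullet> (?S *v t)) / 2))"
        unfolding 1 inner_matrix_vector_mult
        by (rule stars_char_tendsto[OF p lim _ idx1(1)]) auto
    next
      have "\<forall>\<^sub>F n in sequentially. expect (p n) (edges {1..n}) (\<lambda>E. (?X n E $ i)\<^sup>2) \<le> (\<Sum>i\<in>UNIV. \<bar>sigma_star c (idx i) (idx i)\<bar>) + 1" for i
      proof -
        \<comment> \<open>One bound has to serve all coordinates, hence the sum over them; the
          additional 1 leaves room above the limit.\<close>
        have le: "sigma_star c (idx i) (idx i) \<le> (\<Sum>i\<in>UNIV. \<bar>sigma_star c (idx i) (idx i)\<bar>)"
          using member_le_sum[of i UNIV "\<lambda>i. \<bar>sigma_star c (idx i) (idx i)\<bar>"] by simp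
        have "\<forall>\<^sub>F n in sequentially. expect (p n) (edges {1..n}) (\<lambda>E. (centered_stars (idx i + 1) n (p n) E)\<^sup>2) / real n < (\<Sum>i\<in>UNIV. \<bar>sigma_star c (idx i) (idx i)\<bar>) + 1"
        proof -
          have "(\<lambda>n. expect (p n) (edges {1..n}) (\<lambda>E. (centered_stars (idx i + 1) n (p n) E)\<^sup>2) / real n)
            \<longlonglongrightarrow> sigma_star c (idx i) (idx i)"
          proof (rule Lim_transform_eventually[OF sigma_star_tendsto[OF lim idx1(1)[of i] idx1(1)[of i]]],
              rule eventually_mono[OF eventually_ge_at_top[of 1]])
            fix n :: nat assume n: "1 \<le> n"
            show "bin_ex (p n) (n - 1) (\<lambda>x. real (x choose idx i) * real (x choose idx i)) -
              bin_ex (p n) (n - 1) (\<lambda>x. real (x choose idx i)) * bin_ex (p n) (n - 1) (\<lambda>x. real (x choose idx i)) +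
              (real n - 1) * p n * (1 - p n) *
                (bin_ex (p n) (n - 2) (\<lambda>x. real (Suc x choose idx i) - real (x choose idx i)) *
                 bin_ex (p n) (n - 2) (\<lambda>x. real (Suc x choose idx i) - real (x choose idx i))) =
              expect (p n) (edges {1..n}) (\<lambda>E. (centered_stars (idx i + 1) n (p n) E)\<^sup>2) / real n"
              unfolding centered_stars_moment[OF p[OF n, THEN conjunct1] p[OF n, THEN conjunct2] n]
              by (rule nonzero_mult_div_cancel_left[symmetric]) (use n in simp)
          qed
          then show ?thesis using le by (intro order_tendstoD(2)) auto
        qed
        then show ?thesis
        proof eventually_elim
          case (elim n)
          have "expect (p n) (edges {1..n}) (\<lambda>E. (?X n E $ i)\<^sup>2) =
              expect (p n) (edges {1..n}) (\<lambda>E. (centered_stars (idx i + 1) n (p n) E)\<^sup>2 * (1 / real n))"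
            by (simp add: power_divide)
          then show ?case using elim by (simp only: expect_multc) simp
        qed
      qed
      then show "\<forall>\<^sub>F n in sequentially. \<forall>i. expect (p n) (edges {1..n}) (\<lambda>E. (?X n E $ i)\<^sup>2) \<le> (\<Sum>i\<in>UNIV. \<bar>sigma_star c (idx i) (idx i)\<bar>) + 1"
        by (intro eventually_all_finite) auto
    qed
  }
  assume np: "filterlim (\<lambda>n. real n * p n) at_top sequentially"
    and nq: "filterlim (\<lambda>n. (real n)\<^sup>2 * (1 - p n) ^ 3) at_top sequentially"
  let ?X = "\<lambda>n E. sqrt (p n / (2 * (1 - p n))) *\<^sub>R
                 (\<chi> i. centered_stars (idx i + 1) n (p n) E /
                        (1 / fact (idx i - 1) * (real n * p n) ^ idx i)) :: real ^ 'k"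
  have X: "?X n E $ i = star_stat (p n) n (idx i) E" for n E i
    by (simp add: star_stat_def)
  \<comment> \<open>Root of the all-ones matrix: a single column of ones, placed at the index
    numbered 1, which exists as k \<ge> 1.\<close>
  define B where "B = (\<chi> i j. if idx j = 1 then 1 else 0 :: real ^ 'k ^ 'k)"
  have S: "(\<chi> i j. 1) = B ** transpose B"
    using k sum_idx[of "\<lambda>s. if s = 1 then 1 else 0"]
    by (simp add: B_def matrix_matrix_mult_def transpose_def vec_eq_iff if_distrib cong: if_cong)
  show "tends_in_distr_normal p ?X 0 (\<chi> i j. 1)"
  proof (rule tends_in_distr_normalI[OF p' S])
    fix t :: "real ^ 'k"
    have 1: "t \<bullet> ?X n E = (\<Sum>i\<in>UNIV. t $ i * star_stat (p n) n (idx i) E)" for n E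
      unfolding inner_vec_def X by simp
    have 2: "t \<bullet> ((\<chi> i j. 1) *v t) = (\<Sum>i\<in>UNIV. t $ i)\<^sup>2"
      unfolding inner_matrix_vector_mult by (simp add: power2_eq_square sum_product)
    show "(\<lambda>n. expect (p n) (edges {1..n}) (\<lambda>E. iexp (t \<bullet> ?X n E)))
        \<longlonglongrightarrow> of_real (exp (- (t \<bullet> ((\<chi> i j. 1) *v t)) / 2))"
      unfolding 1 2 by (rule star_stat_char_tendsto[OF p np nq idx1(1)])
  next
    show "\<forall>\<^sub>F n in sequentially. \<forall>i. expect (p n) (edges {1..n}) (\<lambda>E. (?X n E $ i)\<^sup>2) \<le> 4"
      unfolding X by (intro eventually_all_finite star_stat_moment p np idx1)
  qed
qed

end
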